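(* Let $I$ be a singular support of the diagonal action, with transverse model $(\mathbb C^{|I|-r_I}\times\mathbb C^J,0)$ carrying the transverse foliation $\mathcal F_I$. Then: (1) The local leaf space of $\mathcal F_I$ at $0$ is not a $T_1$ space, and hence it is not a complex analytic quotient (there is no holomorphic map from the transversal germ to a complex analytic germ whose fibres are exactly the connected local leaves). (2) Nevertheless the transverse analytic envelope exists and is given by the holomorphic map $$\operatorname{id}\times q_I:(\mathbb C^{|I|-r_I}\times\mathbb C^J,0)\longrightarrow(\mathbb C^{|I|-r_I}\times Q_I,(0,o_I)),$$ which is universal: it is constant on the local leaves of $\mathcal F_I$, and every germ of holomorphic map from $(\mathbb C^{|I|-r_I}\times\mathbb C^J,0)$ to a complex analytic germ $(Y,y)$ that is constant on the local leaves of $\mathcal F_I$ factors uniquely through it. The target is the germ of a normal affine toric variety. (3) Every germ of biholomorphism $h$ between two such transverse models (of singular supports $I$ and $I'$) that fixes base points and maps local leaves bijectively onto local leaves descends uniquely to a germ of biholomorphism $\bar h$ between the corresponding envelopes, commuting with the envelope maps. If $I=I'$, the kernel of the resulting action on the envelope of the isotropy group of foliation-preserving transverse germs at the base point consists exactly of those germs $h$ with $h^*f=f$ for every germ $f$ of holomorphic first integral of $\mathcal F_I$.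
   Context: Let $\mathfrak g=\mathbb C^k$ and let $\Lambda_1,\dots,\Lambda_n\in\mathfrak g^*$ span $\mathfrak g^*$. The group $\mathfrak g$ acts on $\mathbb C^n$ by $t\cdot(z_1,\dots,z_n)=(e^{\Lambda_1(t)}z_1,\dots,e^{\Lambda_n(t)}z_n)$. The support of $p\in\mathbb C^n$ is $\{j:p_j\ne0\}$. For $I\subset\{1,\dots,n\}$ put $J=I^c$, $r_I=\dim_{\mathbb C}\operatorname{Span}\{\Lambda_i:i\in I\}$, $\mathfrak h_I=\bigcap_{i\in I}\ker\Lambda_i$, and $\mu_j=\Lambda_j|_{\mathfrak h_I}$ for $j\in J$ (residual weights). $I$ is a singular support if $r_I<k$ (equivalently the orbits of points with support $I$ have dimension $<k$). The transverse model at the orbit of a point of support $I$ is the germ $(\mathbb C^{|I|-r_I}\times\mathbb C^J,0)$ with the foliation $\mathcal F_I$ that is the product of the zero foliation (points as leaves) on $\mathbb C^{|I|-r_I}$ and the orbit foliation on $\mathbb C^J$ of the diagonal action of $\mathfrak h_I$, generated by the vector fields $Y_v=\sum_{j\in J}\mu_j(v)w_j\,\partial/\partial w_j$, $v\in\mathfrak h_I$. Local leaves in a neighbourhood $U$ are the connected leaves of the foliation restricted to $U$; the local leaf space is the quotient of a sufficiently small neighbourhood of $0$ by the connected local leaves, with the quotient topology. A holomorphic first integral is a germ of holomorphic function constant on local leaves. With $\mathbb N=\{0,1,2,\dots\}$ put $S_I=\{\alpha\in\mathbb N^J:\sum_{j\in J}\alpha_j\mu_j=0\}$ and $Q_I=\operatorname{Spec}\mathbb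 C[S_I]$ (also denoting its analytification). $\mathbb C[S_I]$ has monomial basis $X^\alpha$, $\alpha\in S_I$; $q_I:\mathbb C^J\to Q_I$ is the map with $q_I^*X^\alpha=w^\alpha$, and $o_I=q_I(0)$. *)

theory Defs
  imports
    "HOL-Analysis.Analysis"
    "HOL-Algebra.Coset"
    "HOL-Library.Function_Algebras"
    "HOL-Library.Poly_Mapping"
begin

section \<open>Holomorphic functions of several variables\<close>

text \<open>
  For an index set \<open>A\<close>, the space of vectors indexed by \<open>A\<close> is the set of functions vanishing
  outside \<open>A\<close>. The library topology on functions is the product topology, so for finite \<open>A\<close> it
  induces the Euclidean topology. Index sets are sets and not types because the dimensions below
  depend on the support.
\<close>

definition cspace :: "'i set \<Rightarrow> ('i \<Rightarrow> complex) set"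
  where "cspace A = {x. \<forall>i. i \<notin> A \<longrightarrow> x i = 0}"

definition multi_indices :: "'i set \<Rightarrow> ('i \<Rightarrow> nat) set"
  where "multi_indices A = {\<alpha>. \<forall>i. i \<notin> A \<longrightarrow> \<alpha> i = 0}"

definition monomial :: "'i set \<Rightarrow> ('i \<Rightarrow> nat) \<Rightarrow> ('i \<Rightarrow> complex) \<Rightarrow> complex"
  where "monomial A \<alpha> x = (\<Prod>i\<in>A. x i ^ \<alpha> i)"

text \<open>
  \<open>f\<close> is holomorphic near \<open>p\<close>: on some polydisc around \<open>p\<close> it is the sum of an (absolutely)
  convergent power series.
\<close>

definition hol_at :: "'i set \<Rightarrow> ('i \<Rightarrow> complex) \<Rightarrow> (('i \<Rightarrow> complex) \<Rightarrow> complex) \<Rightarrow> bool"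
  where "hol_at A p f \<longleftrightarrow>
    (\<exists>r>0. \<exists>c. \<forall>x\<in>cspace A. (\<forall>i\<in>A. cmod (x i - p i) < r) \<longrightarrow>
        ((\<lambda>\<alpha>. c \<alpha> * monomial A \<alpha> (x - p)) has_sum f x) (multi_indices A))"


section \<open>Complex analytic germs and their morphisms\<close>

text \<open>
  A germ is presented by a local model: a subset \<open>pts\<close> of a coordinate space and a base point.
  A germ of map is represented by a total function, of which only the values near the base point
  matter. All sources of morphisms below (coordinate spaces and toric varieties) are reduced. For
  a possibly non-reduced target, cut out by an ideal in the coordinate space, a morphism from a
  reduced germ is a tuple of holomorphic functions on which that ideal vanishes, that is, a tuple
  with values in the zero set. Hence it is enough to record the zero set of the target.
\<close>

record 'i germ_space =
  coords :: "'i set"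
  pts :: "('i \<Rightarrow> complex) set"
  base :: "'i \<Rightarrow> complex"

definition near :: "'i germ_space \<Rightarrow> ('i \<Rightarrow> complex) filter"
  where "near X = inf (nhds (base X)) (principal (pts X))"

definition nbhd :: "'i germ_space \<Rightarrow> ('i \<Rightarrow> complex) set \<Rightarrow> bool"
  where "nbhd X U \<longleftrightarrow> openin (top_of_set (pts X)) U \<and> base X \<in> U"

definition analytic_germ :: "'i germ_space \<Rightarrow> bool"
  where "analytic_germ X \<longleftrightarrow>
    finite (coords X) \<and> pts X \<subseteq> cspace (coords X) \<and> base X \<in> pts X \<and>
    (\<exists>U F. openin (top_of_set (cspace (coords X))) U \<and> base X \<in> U \<and>
       finite F \<and> (\<forall>f\<in>F. \<forall>p\<in>U. hol_at (coords X) p f) \<and>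
       pts X \<inter> U = {x\<in>U. \<forall>f\<in>F. f x = 0})"

definition hol_map_germ ::
  "'i germ_space \<Rightarrow> 'j germ_space \<Rightarrow> (('i \<Rightarrow> complex) \<Rightarrow> ('j \<Rightarrow> complex)) \<Rightarrow> bool"
  where "hol_map_germ X Y \<phi> \<longleftrightarrow>
    \<phi> (base X) = base Y \<and> (\<forall>\<^sub>F x in near X. \<phi> x \<in> pts Y) \<and>
    (\<forall>j\<in>coords Y. \<exists>F. hol_at (coords X) (base X) F \<and> (\<forall>\<^sub>F x in near X. \<phi> x j = F x))"

definition biholo_germ ::
  "'i germ_space \<Rightarrow> 'j germ_space \<Rightarrow> (('i \<Rightarrow> complex) \<Rightarrow> ('j \<Rightarrow> complex)) \<Rightarrow> bool"
  where "biholo_germ X Y \<phi> \<longleftrightarrow> hol_map_germ X Y \<phi> \<and>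
    (\<exists>\<psi>. hol_map_germ Y X \<psi> \<and> (\<forall>\<^sub>F x in near X. \<psi> (\<phi> x) = x) \<and> (\<forall>\<^sub>F y in near Y. \<phi> (\<psi> y) = y))"

definition germ :: "'i germ_space \<Rightarrow> (('i \<Rightarrow> complex) \<Rightarrow> 'b) \<Rightarrow> (('i \<Rightarrow> complex) \<Rightarrow> 'b) set"
  where "germ X f = {g. \<forall>\<^sub>F x in near X. g x = f x}"

definition germ_group ::
  "'i germ_space \<Rightarrow> (('i \<Rightarrow> complex) \<Rightarrow> ('i \<Rightarrow> complex)) set \<Rightarrow>
   (('i \<Rightarrow> complex) \<Rightarrow> ('i \<Rightarrow> complex)) set monoid"
  where "germ_group X H =
    \<lparr>carrier = germ X ` H,
     monoid.mult = (\<lambda>G K. {f. \<exists>g\<in>G. \<exists>k\<in>K. \<forall>\<^sub>F x in near X. f x = g (k x)}),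
     one = germ X id\<rparr>"


section \<open>Quotient topology\<close>

definition quotient_topology :: "'a topology \<Rightarrow> ('a \<Rightarrow> 'b) \<Rightarrow> 'b topology"
  where "quotient_topology T q =
    topology (\<lambda>V. V \<subseteq> q ` topspace T \<and> openin T {x\<in>topspace T. q x \<in> V})"

lemma openin_quotient_topology:
  "openin (quotient_topology T q) V \<longleftrightarrow>
     V \<subseteq> q ` topspace T \<and> openin T {x\<in>topspace T. q x \<in> V}"
proof -
  have "istopology (\<lambda>V. V \<subseteq> q ` topspace T \<and> openin T {x\<in>topspace T. q x \<in> V})"
    unfolding istopology_def
  proof (intro conjI allI impI; (elim conjE)?)
    fix S V assume "openin T {x\<in>topspace T. q x \<in> S}" "openin T {x\<in>topspace T. q x \<in> V}"
    then have "openin T ({x\<in>topspace T. q x \<in> S} \<inter> {x\<in>topspace T. q x \<in> V})" by blast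
    also have "{x\<in>topspace T. q x \<in> S} \<inter> {x\<in>topspace T. q x \<in> V} = {x\<in>topspace T. q x \<in> S \<inter> V}"
      by blast
    finally show "openin T {x\<in>topspace T. q x \<in> S \<inter> V}" .
  next
    fix \<K> assume "\<forall>K\<in>\<K>. K \<subseteq> q ` topspace T \<and> openin T {x\<in>topspace T. q x \<in> K}"
    then have "openin T (\<Union>K\<in>\<K>. {x\<in>topspace T. q x \<in> K})" by blast
    also have "(\<Union>K\<in>\<K>. {x\<in>topspace T. q x \<in> K}) = {x\<in>topspace T. q x \<in> \<Union>\<K>}" by blast
    finally show "openin T {x\<in>topspace T. q x \<in> \<Union>\<K>}" .
  qed blast+
  then show ?thesis by (simp add: quotient_topology_def topology_inverse')
qed


section \<open>The diagonal action and its transverse models\<close>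

text \<open>
  The Lie algebra is \<open>complex^'k\<close>; a weight is given by its coordinates in the dual basis. The
  weights are indexed by the finite type \<open>'n\<close>, and \<open>- I\<close> is the complement of a support \<open>I\<close>.
\<close>

definition pairing :: "complex^'k \<Rightarrow> complex^'k \<Rightarrow> complex"
  where "pairing l v = (\<Sum>a\<in>UNIV. l $ a * v $ a)"

definition rank_supp :: "('n::finite \<Rightarrow> complex^'k) \<Rightarrow> 'n set \<Rightarrow> nat"
  where "rank_supp \<Lambda> I = vec.dim (\<Lambda> ` I)"

definition singular_support :: "('n::finite \<Rightarrow> complex^'k) \<Rightarrow> 'n set \<Rightarrow> bool"
  where "singular_support \<Lambda> I \<longleftrightarrow> rank_supp \<Lambda> I < CARD('k)"

definition isotropy_alg :: "('n::finite \<Rightarrow> complex^'k) \<Rightarrow> 'n set \<Rightarrow> (complex^'k) set"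
  where "isotropy_alg \<Lambda> I = {v. \<forall>i\<in>I. pairing (\<Lambda> i) v = 0}"

text \<open>
  Points of the transverse model: the coordinates \<open>Inl i\<close> with \<open>i < card I - rank_supp \<Lambda> I\<close> are
  those of the factor carrying the zero foliation, the coordinates \<open>Inr j\<close> with \<open>j \<in> - I\<close> are
  the \<open>w j\<close>.
\<close>

definition codim_supp :: "('n::finite \<Rightarrow> complex^'k) \<Rightarrow> 'n set \<Rightarrow> nat"
  where "codim_supp \<Lambda> I = card I - rank_supp \<Lambda> I"

definition transverse_model :: "('n::finite \<Rightarrow> complex^'k) \<Rightarrow> 'n set \<Rightarrow> (nat + 'n) germ_space"
  where "transverse_model \<Lambda> I =
    \<lparr>coords = Inl ` {..<codim_supp \<Lambda> I} \<union> Inr ` (- I),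
     pts = cspace (Inl ` {..<codim_supp \<Lambda> I} \<union> Inr ` (- I)),
     base = 0\<rparr>"

definition transverse_act ::
  "('n::finite \<Rightarrow> complex^'k) \<Rightarrow> complex^'k \<Rightarrow> (nat + 'n \<Rightarrow> complex) \<Rightarrow> (nat + 'n \<Rightarrow> complex)"
  where "transverse_act \<Lambda> v z =
    case_sum (\<lambda>i. z (Inl i)) (\<lambda>j. exp (pairing (\<Lambda> j) v) * z (Inr j))"

text \<open>
  The leaf through \<open>z\<close> is its orbit under \<open>isotropy_alg \<Lambda> I\<close> with the leaf (immersed) topology,
  which is the quotient topology coming from the orbit map; it is in general finer than the
  topology induced by the ambient space. The local leaves in \<open>U\<close> are the connected components,
  for the leaf topology, of the intersections of the leaves with \<open>U\<close>.
\<close>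

definition leaf_topology ::
  "('n::finite \<Rightarrow> complex^'k) \<Rightarrow> 'n set \<Rightarrow> (nat + 'n \<Rightarrow> complex) \<Rightarrow> (nat + 'n \<Rightarrow> complex) topology"
  where "leaf_topology \<Lambda> I z =
    quotient_topology (top_of_set (isotropy_alg \<Lambda> I)) (\<lambda>v. transverse_act \<Lambda> v z)"

definition local_leaf ::
  "('n::finite \<Rightarrow> complex^'k) \<Rightarrow> 'n set \<Rightarrow> (nat + 'n \<Rightarrow> complex) set \<Rightarrow>
   (nat + 'n \<Rightarrow> complex) \<Rightarrow> (nat + 'n \<Rightarrow> complex) set"
  where "local_leaf \<Lambda> I U z = connected_component_of_set (subtopology (leaf_topology \<Lambda> I z) U) z"

definition local_leaf_space ::
  "('n::finite \<Rightarrow> complex^'k) \<Rightarrow> 'n set \<Rightarrow> (nat + 'n \<Rightarrow> complex) set \<Rightarrow>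
   (nat + 'n \<Rightarrow> complex) set topology"
  where "local_leaf_space \<Lambda> I U = quotient_topology (top_of_set U) (local_leaf \<Lambda> I U)"

definition const_on_leaves ::
  "('n::finite \<Rightarrow> complex^'k) \<Rightarrow> 'n set \<Rightarrow> ((nat + 'n \<Rightarrow> complex) \<Rightarrow> 'b) \<Rightarrow> bool"
  where "const_on_leaves \<Lambda> I F \<longleftrightarrow>
    (\<exists>U. nbhd (transverse_model \<Lambda> I) U \<and> (\<forall>z\<in>U. \<forall>z'\<in>local_leaf \<Lambda> I U z. F z' = F z))"

definition first_integral ::
  "('n::finite \<Rightarrow> complex^'k) \<Rightarrow> 'n set \<Rightarrow> ((nat + 'n \<Rightarrow> complex) \<Rightarrow> complex) \<Rightarrow> bool"
  where "first_integral \<Lambda> I f \<longleftrightarrow>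
    hol_at (coords (transverse_model \<Lambda> I)) 0 f \<and> const_on_leaves \<Lambda> I f"

definition foliated_germ ::
  "('n::finite \<Rightarrow> complex^'k) \<Rightarrow> 'n set \<Rightarrow> 'n set \<Rightarrow>
   ((nat + 'n \<Rightarrow> complex) \<Rightarrow> (nat + 'n \<Rightarrow> complex)) \<Rightarrow> bool"
  where "foliated_germ \<Lambda> I I' h \<longleftrightarrow>
    biholo_germ (transverse_model \<Lambda> I) (transverse_model \<Lambda> I') h \<and>
    (\<exists>U\<^sub>0. nbhd (transverse_model \<Lambda> I) U\<^sub>0 \<and>
      (\<forall>U. nbhd (transverse_model \<Lambda> I) U \<and> U \<subseteq> U\<^sub>0 \<longrightarrow>
        (\<forall>z\<in>U. bij_betw h (local_leaf \<Lambda> I U z) (local_leaf \<Lambda> I' (h ` U) (h z)))))"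


section \<open>The affine toric variety of resonant monomials\<close>

definition resonances :: "('n::finite \<Rightarrow> complex^'k) \<Rightarrow> 'n set \<Rightarrow> ('n \<Rightarrow> nat) set"
  where "resonances \<Lambda> I =
    {\<alpha>\<in>multi_indices (- I). \<forall>v\<in>isotropy_alg \<Lambda> I. (\<Sum>j\<in>- I. of_nat (\<alpha> j) * pairing (\<Lambda> j) v) = 0}"

text \<open>
  The monoid algebra of \<open>S\<close> is the subalgebra of finitely supported functions
  \<open>('n \<Rightarrow> nat) \<Rightarrow>\<^sub>0 complex\<close> with support in \<open>S\<close>; its monomial basis is \<open>Poly_Mapping.single \<alpha> 1\<close>.
  The points of the analytification of its spectrum are the algebra homomorphisms to the complex
  numbers, determined by their values at the monomials of a generating set.
\<close>

definition monoid_algebra :: "('n \<Rightarrow> nat) set \<Rightarrow> (('n \<Rightarrow> nat) \<Rightarrow>\<^sub>0 complex) set"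
  where "monoid_algebra S = {p. Poly_Mapping.keys p \<subseteq> S}"

definition spec_points :: "('n \<Rightarrow> nat) set \<Rightarrow> ((('n \<Rightarrow> nat) \<Rightarrow>\<^sub>0 complex) \<Rightarrow> complex) set"
  where "spec_points S = {\<phi>. \<phi> 1 = 1 \<and>
    (\<forall>p\<in>monoid_algebra S. \<forall>q\<in>monoid_algebra S. \<phi> (p + q) = \<phi> p + \<phi> q \<and> \<phi> (p * q) = \<phi> p * \<phi> q) \<and>
    (\<forall>c. \<forall>p\<in>monoid_algebra S. \<phi> (Poly_Mapping.single 0 c * p) = c * \<phi> p)}"

text \<open>
  For a submonoid of multi-indices of the form \<open>resonances \<Lambda> I\<close>, the indecomposable elements
  form a finite generating set, contained in every other generating set. We use it to realize the
  spectrum as an algebraic subset of a coordinate space; another finite generating set would give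
  an isomorphic one.
\<close>

definition hilbert_basis :: "('n \<Rightarrow> nat) set \<Rightarrow> ('n \<Rightarrow> nat) set"
  where "hilbert_basis S =
    {\<alpha>\<in>S. \<alpha> \<noteq> 0 \<and> \<not> (\<exists>\<beta>\<in>S. \<exists>\<gamma>\<in>S. \<beta> \<noteq> 0 \<and> \<gamma> \<noteq> 0 \<and> \<alpha> = \<beta> + \<gamma>)}"

definition spec_an :: "('n \<Rightarrow> nat) set \<Rightarrow> (('n \<Rightarrow> nat) \<Rightarrow> complex) set"
  where "spec_an S =
    (\<lambda>\<phi> \<alpha>. if \<alpha> \<in> hilbert_basis S then \<phi> (Poly_Mapping.single \<alpha> 1) else 0) ` spec_points S"

definition toric_map ::
  "('n::finite \<Rightarrow> complex^'k) \<Rightarrow> 'n set \<Rightarrow> ('n \<Rightarrow> complex) \<Rightarrow> (('n \<Rightarrow> nat) \<Rightarrow> complex)"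
  where "toric_map \<Lambda> I w =
    (\<lambda>\<alpha>. if \<alpha> \<in> hilbert_basis (resonances \<Lambda> I) then monomial (- I) \<alpha> w else 0)"

definition envelope_map ::
  "('n::finite \<Rightarrow> complex^'k) \<Rightarrow> 'n set \<Rightarrow> (nat + 'n \<Rightarrow> complex) \<Rightarrow> (nat + ('n \<Rightarrow> nat) \<Rightarrow> complex)"
  where "envelope_map \<Lambda> I z = case_sum (\<lambda>i. z (Inl i)) (toric_map \<Lambda> I (\<lambda>j. z (Inr j)))"

definition toric_envelope ::
  "('n::finite \<Rightarrow> complex^'k) \<Rightarrow> 'n set \<Rightarrow> (nat + ('n \<Rightarrow> nat)) germ_space"
  where "toric_envelope \<Lambda> I =
    \<lparr>coords = Inl ` {..<codim_supp \<Lambda> I} \<union> Inr ` hilbert_basis (resonances \<Lambda> I),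
     pts = {case_sum x u | x u. x \<in> cspace {..<codim_supp \<Lambda> I} \<and> u \<in> spec_an (resonances \<Lambda> I)},
     base = case_sum 0 (toric_map \<Lambda> I 0)\<rparr>"


section \<open>Analytic envelopes\<close>

text \<open>
  Test germs have coordinates indexed by natural numbers, which covers all complex analytic germs
  up to renaming of the coordinates.
\<close>

definition analytic_envelope ::
  "('n::finite \<Rightarrow> complex^'k) \<Rightarrow> 'n set \<Rightarrow> 'j germ_space \<Rightarrow>
   ((nat + 'n \<Rightarrow> complex) \<Rightarrow> ('j \<Rightarrow> complex)) \<Rightarrow> bool"
  where "analytic_envelope \<Lambda> I E \<pi> \<longleftrightarrow>
    analytic_germ E \<and> hol_map_germ (transverse_model \<Lambda> I) E \<pi> \<and> const_on_leaves \<Lambda> I \<pi> \<and>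
    (\<forall>(Y :: nat germ_space) F.
       analytic_germ Y \<and> hol_map_germ (transverse_model \<Lambda> I) Y F \<and> const_on_leaves \<Lambda> I F \<longrightarrow>
       (\<exists>G. hol_map_germ E Y G \<and> (\<forall>\<^sub>F z in near (transverse_model \<Lambda> I). G (\<pi> z) = F z) \<and>
          (\<forall>G'. hol_map_germ E Y G' \<and> (\<forall>\<^sub>F z in near (transverse_model \<Lambda> I). G' (\<pi> z) = F z) \<longrightarrow>
             (\<forall>\<^sub>F y in near E. G' y = G y))))"

definition descends ::
  "('n::finite \<Rightarrow> complex^'k) \<Rightarrow> 'n set \<Rightarrow> 'n set \<Rightarrow>
   ((nat + 'n \<Rightarrow> complex) \<Rightarrow> (nat + 'n \<Rightarrow> complex)) \<Rightarrow>
   ((nat + ('n \<Rightarrow> nat) \<Rightarrow> complex) \<Rightarrow> (nat + ('n \<Rightarrow> nat) \<Rightarrow> complex)) \<Rightarrow> bool"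
  where "descends \<Lambda> I I' h k \<longleftrightarrow>
    biholo_germ (toric_envelope \<Lambda> I) (toric_envelope \<Lambda> I') k \<and>
    (\<forall>\<^sub>F z in near (transverse_model \<Lambda> I). k (envelope_map \<Lambda> I z) = envelope_map \<Lambda> I' (h z))"

definition isotropy_group ::
  "('n::finite \<Rightarrow> complex^'k) \<Rightarrow> 'n set \<Rightarrow> ((nat + 'n \<Rightarrow> complex) \<Rightarrow> (nat + 'n \<Rightarrow> complex)) set monoid"
  where "isotropy_group \<Lambda> I = germ_group (transverse_model \<Lambda> I) {h. foliated_germ \<Lambda> I I h}"

definition envelope_aut ::
  "('n::finite \<Rightarrow> complex^'k) \<Rightarrow> 'n set \<Rightarrow>
   ((nat + ('n \<Rightarrow> nat) \<Rightarrow> complex) \<Rightarrow> (nat + ('n \<Rightarrow> nat) \<Rightarrow> complex)) set monoid"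
  where "envelope_aut \<Lambda> I =
    germ_group (toric_envelope \<Lambda> I) {k. biholo_germ (toric_envelope \<Lambda> I) (toric_envelope \<Lambda> I) k}"

definition envelope_action ::
  "('n::finite \<Rightarrow> complex^'k) \<Rightarrow> 'n set \<Rightarrow>
   ((nat + 'n \<Rightarrow> complex) \<Rightarrow> (nat + 'n \<Rightarrow> complex)) set \<Rightarrow>
   ((nat + ('n \<Rightarrow> nat) \<Rightarrow> complex) \<Rightarrow> (nat + ('n \<Rightarrow> nat) \<Rightarrow> complex)) set"
  where "envelope_action \<Lambda> I H = {k. \<exists>h\<in>H. descends \<Lambda> I I h k}"


section \<open>Normal affine toric varieties\<close>

definition poly_funs :: "'i set \<Rightarrow> (('i \<Rightarrow> complex) \<Rightarrow> complex) set"
  where "poly_funs A =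
    {\<lambda>x. \<Sum>\<alpha>\<in>F. c \<alpha> * monomial A \<alpha> x | F c. finite F \<and> F \<subseteq> multi_indices A}"

definition algebraic_set :: "'i set \<Rightarrow> ('i \<Rightarrow> complex) set \<Rightarrow> bool"
  where "algebraic_set A V \<longleftrightarrow> (\<exists>P\<subseteq>poly_funs A. V = {x\<in>cspace A. \<forall>f\<in>P. f x = 0})"

definition irreducible_variety :: "'i set \<Rightarrow> ('i \<Rightarrow> complex) set \<Rightarrow> bool"
  where "irreducible_variety A V \<longleftrightarrow> finite A \<and> algebraic_set A V \<and> V \<noteq> {} \<and>
    (\<forall>V\<^sub>1 V\<^sub>2. algebraic_set A V\<^sub>1 \<and> algebraic_set A V\<^sub>2 \<and> V = V\<^sub>1 \<union> V\<^sub>2 \<longrightarrow> V = V\<^sub>1 \<or> V = V\<^sub>2)"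

text \<open>
  Normality: the coordinate ring (polynomial functions on \<open>V\<close>) is integrally closed in its field
  of fractions. The displayed identity is the equation of integral dependence
  \<open>(f/g)^d + (\<Sum>i<d. a i * (f/g)^i) = 0\<close> multiplied by \<open>g^d\<close>.
\<close>

definition normal_variety :: "'i set \<Rightarrow> ('i \<Rightarrow> complex) set \<Rightarrow> bool"
  where "normal_variety A V \<longleftrightarrow> irreducible_variety A V \<and>
    (\<forall>f\<in>poly_funs A. \<forall>g\<in>poly_funs A. \<forall>d a.
       (\<exists>x\<in>V. g x \<noteq> 0) \<and> (\<forall>i<d. a i \<in> poly_funs A) \<and>
       (\<forall>x\<in>V. f x ^ d + (\<Sum>i<d. a i x * f x ^ i * g x ^ (d - i)) = 0) \<longrightarrow>
       (\<exists>h\<in>poly_funs A. \<forall>x\<in>V. f x = h x * g x))"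

text \<open>The torus of rank \<open>m\<close>, with pointwise multiplication.\<close>

definition torus :: "nat \<Rightarrow> (nat \<Rightarrow> complex) set"
  where "torus m = {t. (\<forall>i<m. t i \<noteq> 0) \<and> (\<forall>i\<ge>m. t i = 1)}"

text \<open>
  Regular functions on the product of the torus with a variety: Laurent polynomials in the torus
  variables with polynomial coefficients.
\<close>

definition torus_regular ::
  "nat \<Rightarrow> 'i set \<Rightarrow> ((nat \<Rightarrow> complex) \<Rightarrow> ('i \<Rightarrow> complex) \<Rightarrow> complex) \<Rightarrow> bool"
  where "torus_regular m A F \<longleftrightarrow>
    (\<exists>(K :: (nat \<Rightarrow> int) set) a. finite K \<and> (\<forall>\<beta>\<in>K. a \<beta> \<in> poly_funs A) \<and>
       (\<forall>t\<in>torus m. \<forall>x\<in>cspace A. F t x = (\<Sum>\<beta>\<in>K. (\<Prod>i<m. t i powi \<beta> i) * a \<beta> x)))"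

text \<open>
  An irreducible affine variety with an embedding \<open>\<iota>\<close> of a torus as a Zariski open subset (\<open>\<iota>\<close> is
  a morphism whose inverse is regular, i.e. locally a quotient of polynomials) such that the
  action of the torus on itself extends to an algebraic action on the variety.
\<close>

definition affine_toric_variety :: "'i set \<Rightarrow> ('i \<Rightarrow> complex) set \<Rightarrow> bool"
  where "affine_toric_variety A V \<longleftrightarrow> irreducible_variety A V \<and>
    (\<exists>m \<iota> act.
       (\<forall>i\<in>A. torus_regular m A (\<lambda>t x. \<iota> t i)) \<and>
       (\<exists>Z. algebraic_set A Z \<and> \<iota> ` torus m = V - Z) \<and>
       (\<forall>s\<in>torus m. \<forall>i<m. \<exists>f\<in>poly_funs A. \<exists>g\<in>poly_funs A. g (\<iota> s) \<noteq> 0 \<and>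
          (\<forall>t\<in>torus m. g (\<iota> t) \<noteq> 0 \<longrightarrow> t i = f (\<iota> t) / g (\<iota> t))) \<and>
       (\<forall>i\<in>A. torus_regular m A (\<lambda>t x. act t x i)) \<and>
       (\<forall>t\<in>torus m. \<forall>x\<in>V. act t x \<in> V) \<and>
       (\<forall>x\<in>V. act 1 x = x) \<and>
       (\<forall>s\<in>torus m. \<forall>t\<in>torus m. \<forall>x\<in>V. act (s * t) x = act s (act t x)) \<and>
       (\<forall>s\<in>torus m. \<forall>t\<in>torus m. act s (\<iota> t) = \<iota> (s * t)))"

end

theory Submission
  imports Defs "HOL-Complex_Analysis.Cauchy_Integral_Formula"
    "HOL-Computational_Algebra.Computational_Algebra" "HOL-Computational_Algebra.Field_as_Ring"
begin

text \<open>
  A first integral is invariant under the scalings \<open>exp (t v)\<close> with small real \<open>t\<close>, so its power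
  series contains only resonant monomials. Such a series is a power series in the generating
  monomials, and it vanishes on the toric variety once its pullback does, because both can be
  regrouped along the fibres of the total exponent; this is the universal property of the envelope.
  Conversely, every point of the variety is a homomorphism on the semigroup, and the binomial
  relations, finitely many by Dickson's lemma, cut the variety out. Normality is inherited from the
  coordinate space: an integral quotient pulls back to a polynomial, by division along parallel
  lines, which is again invariant.

  In a singular direction some coordinate line has a punctured disc as a local leaf. The origin lies
  in its closure, so the leaf space is not \<open>T\<^sub>1\<close>, and a map with these fibres would be constant on
  the disc by continuity. Germs of foliated maps act on the envelope by its universal property.
\<close>

section \<open>Convergent power series in several variables\<close>

text \<open>\<open>hol_at\<close> gives convergence about a single centre, so products, compositions
  and nearby centres have to be earned; they all come from the weighted l1 norm of the coefficients
  at a fixed radius, which is submultiplicative. The toric image is studied for an arbitrary finite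
  family of nonzero exponents. Nonzero exponents make the fibres of the total exponent finite, so
  the regrouping works at points of the variety that are not known to lie in the image of the
  monomial map. What is special to resonances is saturation: their semigroup consists of all
  multi-indices solving linear equations, and this turns invariance back into factorization. Real
  times suffice because a single t with t times the weight nonzero and of modulus at most 1 already
  kills a coefficient; being small, they also keep a whole path inside a polydisc, so that its end
  lies on the same local leaf and not just on the same orbit. A possibly singular target is reached
  through its ambient space: its equations hold on the envelope because they hold after
  pullback.\<close>

definition mdeg :: "'i set \<Rightarrow> ('i \<Rightarrow> nat) \<Rightarrow> nat"
  where "mdeg A \<alpha> = (\<Sum>i\<in>A. \<alpha> i)"

definition polydisc :: "'i set \<Rightarrow> ('i \<Rightarrow> complex) \<Rightarrow> real \<Rightarrow> ('i \<Rightarrow> complex) set"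
  where "polydisc A p r = {x\<in>cspace A. \<forall>i\<in>A. cmod (x i - p i) \<le> r}"

text \<open>The weighted l1 norm of the Taylor coefficients at \<open>p\<close>, with weight
  \<open>r\<close> in every variable, is at most \<open>M\<close>. Like a sup norm it is
  submultiplicative, but it also controls the series termwise, so no Cauchy estimates enter.\<close>

definition series_bound ::
  "'i set \<Rightarrow> ('i \<Rightarrow> complex) \<Rightarrow> real \<Rightarrow> real \<Rightarrow> (('i \<Rightarrow> complex) \<Rightarrow> complex) \<Rightarrow> bool"
  where "series_bound A p r M f \<longleftrightarrow>
    (\<exists>c. (\<lambda>\<alpha>. cmod (c \<alpha>) * r ^ mdeg A \<alpha>) summable_on multi_indices A \<and>
       (\<Sum>\<^sub>\<infinity>\<alpha>\<in>multi_indices A. cmod (c \<alpha>) * r ^ mdeg A \<alpha>) \<le> M \<and>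
       (\<forall>x\<in>polydisc A p r.
          ((\<lambda>\<alpha>. c \<alpha> * monomial A \<alpha> (x - p)) has_sum f x) (multi_indices A)))"

lemma multi_indices_0 [simp]: "0 \<in> multi_indices A"
  by (simp add: multi_indices_def)

lemma multi_indices_add: "\<alpha> \<in> multi_indices A \<Longrightarrow> \<beta> \<in> multi_indices A \<Longrightarrow> \<alpha> + \<beta> \<in> multi_indices A"
  by (simp add: multi_indices_def)

lemma multi_indices_diff: "\<alpha> \<in> multi_indices A \<Longrightarrow> \<alpha> - \<beta> \<in> multi_indices A"
  by (simp add: multi_indices_def)

lemma multi_indices_add_iff:
  "\<alpha> + \<beta> \<in> multi_indices A \<longleftrightarrow> \<alpha> \<in> multi_indices A \<and> \<beta> \<in> multi_indices A"
  by (auto simp: multi_indices_def)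

lemma mdeg_0 [simp]: "mdeg A 0 = 0"
  by (simp add: mdeg_def)

lemma mdeg_add: "mdeg A (\<alpha> + \<beta>) = mdeg A \<alpha> + mdeg A \<beta>"
  by (simp add: mdeg_def sum.distrib)

lemma mdeg_eq_0_iff: "finite A \<Longrightarrow> \<alpha> \<in> multi_indices A \<Longrightarrow> mdeg A \<alpha> = 0 \<longleftrightarrow> \<alpha> = 0"
  by (auto simp: mdeg_def multi_indices_def fun_eq_iff)

lemma monomial_0 [simp]: "monomial A 0 x = 1"
  by (simp add: monomial_def)

lemma monomial_add: "monomial A (\<alpha> + \<beta>) x = monomial A \<alpha> x * monomial A \<beta> x"
  by (simp add: monomial_def power_add prod.distrib)

lemma monomial_zero_arg: "finite A \<Longrightarrow> \<alpha> \<in> multi_indices A \<Longrightarrow> \<alpha> \<noteq> 0 \<Longrightarrow> monomial A \<alpha> 0 = 0"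
  by (auto simp: monomial_def multi_indices_def fun_eq_iff)

lemma cmod_monomial_le:
  assumes "\<And>i. i \<in> A \<Longrightarrow> cmod (x i) \<le> r"
  shows "cmod (monomial A \<alpha> x) \<le> r ^ mdeg A \<alpha>"
proof -
  have "cmod (monomial A \<alpha> x) = (\<Prod>i\<in>A. cmod (x i) ^ \<alpha> i)"
    by (simp add: monomial_def prod_norm[symmetric] norm_power)
  also have "\<dots> \<le> (\<Prod>i\<in>A. r ^ \<alpha> i)"
    by (intro prod_mono conjI power_mono) (use assms in auto)
  also have "\<dots> = r ^ mdeg A \<alpha>"
    by (simp add: mdeg_def power_sum)
  finally show ?thesis .
qed

lemma polydisc_mono: "r \<le> r' \<Longrightarrow> polydisc A p r \<subseteq> polydisc A p r'"
  by (auto simp: polydisc_def)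

lemma center_in_polydisc: "p \<in> cspace A \<Longrightarrow> 0 \<le> r \<Longrightarrow> p \<in> polydisc A p r"
  by (simp add: polydisc_def)

text \<open>Multiplying a power series by the monomial with exponent \<beta> moves its coefficients
  by \<beta>; the translated index set is the set of multi-indices above \<beta>, and the new
  coefficients vanish off it.\<close>

lemma has_sum_multi_index_shift:
  assumes "((\<lambda>\<alpha>. h (\<alpha> + \<beta>)) has_sum s) (multi_indices A)"
    and "\<beta> \<in> multi_indices A"
    and "\<And>\<gamma>. \<gamma> \<in> multi_indices A \<Longrightarrow> \<not> \<beta> \<le> \<gamma> \<Longrightarrow> h \<gamma> = 0"
  shows "(h has_sum s) (multi_indices A)"
proof -
  have "inj_on (\<lambda>\<alpha>. \<alpha> + \<beta>) (multi_indices A)"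
    by (auto simp: inj_on_def)
  then have "(h has_sum s) ((\<lambda>\<alpha>. \<alpha> + \<beta>) ` multi_indices A)"
    using assms(1) by (simp add: has_sum_reindex o_def)
  moreover have "\<gamma> \<in> (\<lambda>\<alpha>. \<alpha> + \<beta>) ` multi_indices A" if "\<gamma> \<in> multi_indices A" "\<beta> \<le> \<gamma>" for \<gamma>
  proof
    show "\<gamma> = (\<gamma> - \<beta>) + \<beta>"
      using that(2) by (auto simp: fun_eq_iff le_fun_def)
  qed (use that multi_indices_diff in blast)
  ultimately show ?thesis
    by (subst has_sum_cong_neutral[where T = "(\<lambda>\<alpha>. \<alpha> + \<beta>) ` multi_indices A" and g = h])
      (use assms(2,3) in \<open>auto simp: multi_indices_add_iff\<close>)
qed

lemma series_bound_nonneg: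
  assumes "series_bound A p r M f" "0 \<le> r"
  shows "0 \<le> M"
proof -
  obtain c where "(\<Sum>\<^sub>\<infinity>\<alpha>\<in>multi_indices A. cmod (c \<alpha>) * r ^ mdeg A \<alpha>) \<le> M"
    using assms by (auto simp: series_bound_def)
  moreover have "0 \<le> (\<Sum>\<^sub>\<infinity>\<alpha>\<in>multi_indices A. cmod (c \<alpha>) * r ^ mdeg A \<alpha>)"
    using assms(2) by (intro infsum_nonneg) simp
  ultimately show ?thesis by linarith
qed

lemma series_term_le:
  assumes "x \<in> polydisc A p r"
  shows "norm (c * monomial A \<alpha> (x - p)) \<le> cmod c * r ^ mdeg A \<alpha>"
proof -
  have "cmod (monomial A \<alpha> (x - p)) \<le> r ^ mdeg A \<alpha>"
    by (intro cmod_monomial_le) (use assms in \<open>auto simp: polydisc_def\<close>)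
  then show ?thesis
    by (simp add: norm_mult mult_left_mono)
qed

lemma series_bound_norm_le:
  assumes "series_bound A p r M f" "x \<in> polydisc A p r"
  shows "cmod (f x) \<le> M"
proof -
  obtain c where c: "(\<lambda>\<alpha>. cmod (c \<alpha>) * r ^ mdeg A \<alpha>) summable_on multi_indices A"
    "(\<Sum>\<^sub>\<infinity>\<alpha>\<in>multi_indices A. cmod (c \<alpha>) * r ^ mdeg A \<alpha>) \<le> M"
    "((\<lambda>\<alpha>. c \<alpha> * monomial A \<alpha> (x - p)) has_sum f x) (multi_indices A)"
    using assms unfolding series_bound_def by blast
  have "f x = (\<Sum>\<^sub>\<infinity>\<alpha>\<in>multi_indices A. c \<alpha> * monomial A \<alpha> (x - p))"
    using c(3) by (simp add: infsumI)
  moreover have "norm (\<Sum>\<^sub>\<infinity>\<alpha>\<in>multi_indices A. c \<alpha> * monomial A \<alpha> (x - p)) \<le>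
      (\<Sum>\<^sub>\<infinity>\<alpha>\<in>multi_indices A. cmod (c \<alpha>) * r ^ mdeg A \<alpha>)"
    by (intro norm_infsum_le[OF has_sum_infsum has_sum_infsum])
      (use c assms(2) series_term_le has_sum_imp_summable in blast)+
  ultimately show ?thesis using c(2) by simp
qed

lemma series_bound_mono:
  assumes "series_bound A p r M f" "0 \<le> r'" "r' \<le> r" "M \<le> M'"
  shows "series_bound A p r' M' f"
proof -
  obtain c where c: "(\<lambda>\<alpha>. cmod (c \<alpha>) * r ^ mdeg A \<alpha>) summable_on multi_indices A"
    "(\<Sum>\<^sub>\<infinity>\<alpha>\<in>multi_indices A. cmod (c \<alpha>) * r ^ mdeg A \<alpha>) \<le> M"
    "\<And>x. x \<in> polydisc A p r \<Longrightarrow>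
      ((\<lambda>\<alpha>. c \<alpha> * monomial A \<alpha> (x - p)) has_sum f x) (multi_indices A)"
    using assms unfolding series_bound_def by blast
  have le: "cmod (c \<alpha>) * r' ^ mdeg A \<alpha> \<le> cmod (c \<alpha>) * r ^ mdeg A \<alpha>" for \<alpha>
    using assms by (intro mult_left_mono power_mono) auto
  have s: "(\<lambda>\<alpha>. cmod (c \<alpha>) * r' ^ mdeg A \<alpha>) summable_on multi_indices A"
    by (rule summable_on_comparison_test[OF c(1)]) (use le assms in auto)
  have "(\<Sum>\<^sub>\<infinity>\<alpha>\<in>multi_indices A. cmod (c \<alpha>) * r' ^ mdeg A \<alpha>) \<le> M'"
    using infsum_mono[OF s c(1) le] c(2) assms by linarith
  then show ?thesis
    unfolding series_bound_def using s c(3) polydisc_mono[OF assms(3)] by blast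
qed

text \<open>Completeness of the norm: the coefficients are summed in \<open>n\<close> for each
  multi-index, and absolute convergence of the double family permits the exchange. Products and
  compositions are instances of this, without formulas for the resulting coefficients.\<close>

lemma series_bound_infsum:
  assumes r: "0 < r" and f: "\<And>n. n \<in> N \<Longrightarrow> series_bound A p r (M n) (f n)"
    and M: "M summable_on N"
    and g: "\<And>x. x \<in> polydisc A p r \<Longrightarrow> ((\<lambda>n. f n x) has_sum g x) N"
  shows "series_bound A p r (infsum M N) g"
proof -
  define W where "W = (\<lambda>c \<alpha>. cmod (c \<alpha>) * r ^ mdeg A \<alpha>)"
  have "\<forall>n\<in>N. \<exists>c. W c summable_on multi_indices A \<and> infsum (W c) (multi_indices A) \<le> M n \<and>
       (\<forall>x\<in>polydisc A p r.
          ((\<lambda>\<alpha>. c \<alpha> * monomial A \<alpha> (x - p)) has_sum f n x) (multi_indices A))"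
    using f unfolding series_bound_def W_def by blast
  then obtain c where c1: "\<And>n. n \<in> N \<Longrightarrow> W (c n) summable_on multi_indices A"
    and c2: "\<And>n. n \<in> N \<Longrightarrow> infsum (W (c n)) (multi_indices A) \<le> M n"
    and c3: "\<And>n x. n \<in> N \<Longrightarrow> x \<in> polydisc A p r \<Longrightarrow>
        ((\<lambda>\<alpha>. c n \<alpha> * monomial A \<alpha> (x - p)) has_sum f n x) (multi_indices A)"
    by metis
  have W0: "0 \<le> W c \<alpha>" for c \<alpha>
    using r by (simp add: W_def)
  have sM: "(\<lambda>n. infsum (W (c n)) (multi_indices A)) summable_on N"
    by (rule summable_on_comparison_test[OF M]) (use c2 W0 in \<open>auto intro: infsum_nonneg\<close>)
  \<comment> \<open>The rows are summable and their sums are dominated by \<open>M\<close>, so the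
    double family is summable in either order.\<close>
  have WS: "(\<lambda>(n, \<alpha>). W (c n) \<alpha>) summable_on N \<times> multi_indices A"
    by (rule summable_on_SigmaI[where g = "\<lambda>n. infsum (W (c n)) (multi_indices A)"])
      (use c1 sM W0 in \<open>auto intro: has_sum_infsum\<close>)
  then have WS': "(\<lambda>(\<alpha>, n). W (c n) \<alpha>) summable_on multi_indices A \<times> N"
    by (subst summable_on_swap) auto
  have col: "(\<lambda>n. W (c n) \<alpha>) summable_on N" if "\<alpha> \<in> multi_indices A" for \<alpha>
    using summable_on_SigmaD1[OF WS' that] by simp
  have abs: "(\<lambda>n. cmod (c n \<alpha>)) summable_on N" if "\<alpha> \<in> multi_indices A" for \<alpha>
    using col[OF that] r unfolding W_def by (simp add: summable_on_cmult_left')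
  define C where "C \<alpha> = (\<Sum>\<^sub>\<infinity>n\<in>N. c n \<alpha>)" for \<alpha>
  have C: "((\<lambda>n. c n \<alpha>) has_sum C \<alpha>) N" if "\<alpha> \<in> multi_indices A" for \<alpha>
    using abs[OF that] unfolding C_def by (rule has_sum_infsum[OF abs_summable_summable])
  have Wle: "W C \<alpha> \<le> (\<Sum>\<^sub>\<infinity>n\<in>N. W (c n) \<alpha>)" if "\<alpha> \<in> multi_indices A" for \<alpha>
  proof -
    have "cmod (C \<alpha>) \<le> (\<Sum>\<^sub>\<infinity>n\<in>N. cmod (c n \<alpha>))"
      unfolding C_def using abs[OF that] by (rule norm_infsum_bound)
    then have "W C \<alpha> \<le> (\<Sum>\<^sub>\<infinity>n\<in>N. cmod (c n \<alpha>)) * r ^ mdeg A \<alpha>"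
      unfolding W_def using r by (intro mult_right_mono) auto
    also have "\<dots> = (\<Sum>\<^sub>\<infinity>n\<in>N. W (c n) \<alpha>)"
      unfolding W_def by (rule infsum_cmult_left'[symmetric])
    finally show ?thesis .
  qed
  have rows: "(\<lambda>\<alpha>. \<Sum>\<^sub>\<infinity>n\<in>N. W (c n) \<alpha>) summable_on multi_indices A"
    using summable_on_SigmaD[OF WS'] col by simp
  have sC: "W C summable_on multi_indices A"
    by (rule summable_on_comparison_test[OF rows]) (use Wle W0 in auto)
  have "infsum (W C) (multi_indices A) \<le> (\<Sum>\<^sub>\<infinity>\<alpha>\<in>multi_indices A. \<Sum>\<^sub>\<infinity>n\<in>N. W (c n) \<alpha>)"
    by (rule infsum_mono[OF sC rows Wle])
  also have "\<dots> = (\<Sum>\<^sub>\<infinity>n\<in>N. infsum (W (c n)) (multi_indices A))"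
    using infsum_swap_banach[OF WS] by simp
  also have "\<dots> \<le> infsum M N"
    by (rule infsum_mono[OF sM M c2])
  finally have le: "infsum (W C) (multi_indices A) \<le> infsum M N" .
  have "((\<lambda>\<alpha>. C \<alpha> * monomial A \<alpha> (x - p)) has_sum g x) (multi_indices A)"
    if x: "x \<in> polydisc A p r" for x
  proof -
    let ?T = "\<lambda>(n, \<alpha>). c n \<alpha> * monomial A \<alpha> (x - p)"
    have "?T summable_on N \<times> multi_indices A"
      by (rule abs_summable_summable, rule Infinite_Sum.abs_summable_on_comparison_test'[OF WS])
        (use series_term_le[OF x] in \<open>auto simp: W_def\<close>)
    then obtain t where t: "(?T has_sum t) (N \<times> multi_indices A)"
      by (auto simp: summable_on_def)
    have "((\<lambda>n. f n x) has_sum t) N"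
      by (rule has_sum_SigmaD[OF t]) (use c3 x in auto)
    then have "t = g x"
      using g[OF x] has_sum_unique by blast
    moreover have "((\<lambda>(\<alpha>, n). ?T (n, \<alpha>)) has_sum t) (multi_indices A \<times> N)"
      using t by (subst (asm) has_sum_swap)
    then have "((\<lambda>\<alpha>. C \<alpha> * monomial A \<alpha> (x - p)) has_sum t) (multi_indices A)"
      by (rule has_sum_SigmaD) (use C in \<open>auto intro: has_sum_cmult_left\<close>)
    ultimately show ?thesis by simp
  qed
  then show ?thesis
    unfolding series_bound_def using sC le unfolding W_def by blast
qed

lemma series_bound_const: "series_bound A p r (cmod k) (\<lambda>x. k)"
proof -
  let ?c = "\<lambda>\<alpha>. if \<alpha> = 0 then k else 0"
  have "((\<lambda>\<alpha>. cmod (?c \<alpha>) * r ^ mdeg A \<alpha>) has_sum cmod k) (multi_indices A)"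
    by (rule has_sum_finite_neutralI[where B = "{0}"]) auto
  moreover have "((\<lambda>\<alpha>. ?c \<alpha> * monomial A \<alpha> (x - p)) has_sum k) (multi_indices A)" for x
    by (rule has_sum_finite_neutralI[where B = "{0}"]) auto
  ultimately show ?thesis
    unfolding series_bound_def by (intro exI[of _ ?c]) (auto simp: infsumI summable_on_def)
qed

lemma series_bound_monomial_mult:
  assumes f: "series_bound A p r M f" and r: "0 \<le> r" and \<beta>: "\<beta> \<in> multi_indices A"
  shows "series_bound A p r (cmod k * r ^ mdeg A \<beta> * M) (\<lambda>x. k * monomial A \<beta> (x - p) * f x)"
    (is "series_bound _ _ _ ?M _")
proof -
  obtain c where c: "(\<lambda>\<alpha>. cmod (c \<alpha>) * r ^ mdeg A \<alpha>) summable_on multi_indices A"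
    "(\<Sum>\<^sub>\<infinity>\<alpha>\<in>multi_indices A. cmod (c \<alpha>) * r ^ mdeg A \<alpha>) \<le> M"
    "\<And>x. x \<in> polydisc A p r \<Longrightarrow>
      ((\<lambda>\<alpha>. c \<alpha> * monomial A \<alpha> (x - p)) has_sum f x) (multi_indices A)"
    using f unfolding series_bound_def by blast
  let ?c = "\<lambda>\<gamma>. if \<beta> \<le> \<gamma> then k * c (\<gamma> - \<beta>) else 0"
  have c': "?c (\<alpha> + \<beta>) = k * c \<alpha>" for \<alpha>
    by (simp add: le_fun_def)
  let ?s = "\<Sum>\<^sub>\<infinity>\<alpha>\<in>multi_indices A. cmod (c \<alpha>) * r ^ mdeg A \<alpha>"
  have "((\<lambda>\<gamma>. cmod (?c \<gamma>) * r ^ mdeg A \<gamma>) has_sum cmod k * r ^ mdeg A \<beta> * ?s) (multi_indices A)"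
  proof (rule has_sum_multi_index_shift[OF _ \<beta>])
    have "((\<lambda>\<alpha>. cmod k * r ^ mdeg A \<beta> * (cmod (c \<alpha>) * r ^ mdeg A \<alpha>)) has_sum
        cmod k * r ^ mdeg A \<beta> * ?s) (multi_indices A)"
      by (intro has_sum_cmult_right has_sum_infsum c(1))
    then show "((\<lambda>\<alpha>. cmod (?c (\<alpha> + \<beta>)) * r ^ mdeg A (\<alpha> + \<beta>)) has_sum
        cmod k * r ^ mdeg A \<beta> * ?s) (multi_indices A)"
      unfolding c' by (simp add: norm_mult mdeg_add power_add mult_ac)
  qed auto
  moreover have "cmod k * r ^ mdeg A \<beta> * ?s \<le> ?M"
    using c(2) r by (intro mult_left_mono) auto
  moreover have "((\<lambda>\<gamma>. ?c \<gamma> * monomial A \<gamma> (x - p)) has_sum k * monomial A \<beta> (x - p) * f x)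
      (multi_indices A)" if x: "x \<in> polydisc A p r" for x
  proof (rule has_sum_multi_index_shift[OF _ \<beta>])
    have "((\<lambda>\<alpha>. k * monomial A \<beta> (x - p) * (c \<alpha> * monomial A \<alpha> (x - p))) has_sum
        k * monomial A \<beta> (x - p) * f x) (multi_indices A)"
      by (intro has_sum_cmult_right c(3) x)
    then show "((\<lambda>\<alpha>. ?c (\<alpha> + \<beta>) * monomial A (\<alpha> + \<beta>) (x - p)) has_sum
        k * monomial A \<beta> (x - p) * f x) (multi_indices A)"
      unfolding c' by (simp add: monomial_add mult_ac)
  qed auto
  ultimately show ?thesis
    unfolding series_bound_def by (intro exI[of _ ?c]) (auto simp: infsumI summable_on_def)
qed

text \<open>The product is the sum over \<alpha> of the terms of \<open>f\<close> times
  \<open>g\<close>, and each of these is a monomial multiple of \<open>g\<close>; this replaces a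
  Cauchy product of multi-index series.\<close>

lemma series_bound_mult:
  assumes r: "0 < r" and f: "series_bound A p r M f" and g: "series_bound A p r M' g"
  shows "series_bound A p r (M * M') (\<lambda>x. f x * g x)"
proof -
  obtain c where c: "(\<lambda>\<alpha>. cmod (c \<alpha>) * r ^ mdeg A \<alpha>) summable_on multi_indices A"
    "(\<Sum>\<^sub>\<infinity>\<alpha>\<in>multi_indices A. cmod (c \<alpha>) * r ^ mdeg A \<alpha>) \<le> M"
    "\<And>x. x \<in> polydisc A p r \<Longrightarrow>
      ((\<lambda>\<alpha>. c \<alpha> * monomial A \<alpha> (x - p)) has_sum f x) (multi_indices A)"
    using f unfolding series_bound_def by blast
  have M': "0 \<le> M'"
    using series_bound_nonneg[OF g] r by simp
  have "series_bound A p r (\<Sum>\<^sub>\<infinity>\<alpha>\<in>multi_indices A. cmod (c \<alpha>) * r ^ mdeg A \<alpha> * M')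
      (\<lambda>x. f x * g x)"
  proof (rule series_bound_infsum[OF r])
    show "series_bound A p r (cmod (c \<alpha>) * r ^ mdeg A \<alpha> * M')
        (\<lambda>x. c \<alpha> * monomial A \<alpha> (x - p) * g x)" if "\<alpha> \<in> multi_indices A" for \<alpha>
      using r by (intro series_bound_monomial_mult g that) simp
    show "(\<lambda>\<alpha>. cmod (c \<alpha>) * r ^ mdeg A \<alpha> * M') summable_on multi_indices A"
      by (intro summable_on_cmult_left c(1))
    show "((\<lambda>\<alpha>. c \<alpha> * monomial A \<alpha> (x - p) * g x) has_sum f x * g x) (multi_indices A)"
      if "x \<in> polydisc A p r" for x
      by (intro has_sum_cmult_left c(3) that)
  qed
  moreover have "(\<Sum>\<^sub>\<infinity>\<alpha>\<in>multi_indices A. cmod (c \<alpha>) * r ^ mdeg A \<alpha> * M') \<le> M * M'"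
    using c(2) M' by (subst infsum_cmult_left') (rule mult_right_mono)
  ultimately show ?thesis
    using series_bound_mono r by (meson less_imp_le order_refl)
qed

lemma series_bound_add:
  assumes r: "0 < r" and f: "series_bound A p r M f" and g: "series_bound A p r M' g"
  shows "series_bound A p r (M + M') (\<lambda>x. f x + g x)"
proof -
  have "series_bound A p r (infsum (\<lambda>b. if b then M else M') (UNIV :: bool set)) (\<lambda>x. f x + g x)"
  proof (rule series_bound_infsum[OF r])
    show "series_bound A p r (if b then M else M') (if b then f else g)" for b
      using f g by simp
    show "((\<lambda>b. (if b then f else g) x) has_sum f x + g x) UNIV" for x
      by (rule has_sum_finiteI) (auto simp: UNIV_bool)
  qed simp
  then show ?thesis by (simp add: UNIV_bool add.commute)
qed

lemma series_bound_power:
  assumes "0 < r" and "series_bound A p r M f"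
  shows "series_bound A p r (M ^ n) (\<lambda>x. f x ^ n)"
proof (induction n)
  case 0
  show ?case using series_bound_const[of A p r 1] by simp
next
  case (Suc n)
  then show ?case using series_bound_mult[OF assms(1,2)] by simp
qed

lemma series_bound_prod:
  assumes "finite B" "0 < r" and "\<And>i. i \<in> B \<Longrightarrow> series_bound A p r (M i) (f i)"
  shows "series_bound A p r (\<Prod>i\<in>B. M i) (\<lambda>x. \<Prod>i\<in>B. f i x)"
  using assms(1,3)
proof (induction B rule: finite_induct)
  case empty
  show ?case using series_bound_const[of A p r 1] by simp
next
  case (insert i B)
  then show ?case by (auto intro!: series_bound_mult assms(2))
qed

lemma series_bound_coordinate:
  assumes "finite A" "i \<in> A" "0 \<le> r"
  shows "series_bound A p r r (\<lambda>x. x i - p i)"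
proof -
  let ?\<beta> = "\<lambda>j. if j = i then 1 else 0 :: nat"
  have "monomial A ?\<beta> x = x i" for x
  proof -
    have "monomial A ?\<beta> x = (\<Prod>j\<in>A. if j = i then x j else 1)"
      unfolding monomial_def by (rule prod.cong) auto
    then show ?thesis using assms(1,2) by simp
  qed
  moreover have "mdeg A ?\<beta> = 1"
    using assms by (simp add: mdeg_def)
  moreover have "?\<beta> \<in> multi_indices A"
    using assms by (auto simp: multi_indices_def)
  ultimately show ?thesis
    using series_bound_monomial_mult[OF series_bound_const[of A p r 1] assms(3), of ?\<beta> 1] by simp
qed

text \<open>If each component of \<open>G\<close> minus that of \<open>q\<close> has norm at most
  \<open>s\<close>, then by submultiplicativity the monomial with exponent \<alpha> in these
  differences has norm at most \<open>s ^ mdeg B \<alpha>\<close>, so the norm of \<open>f\<close>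
  at radius \<open>s\<close> majorizes the substituted series.\<close>

lemma series_bound_compose:
  assumes "finite B" and r: "0 < r" and f: "series_bound B q s M f"
    and G: "\<And>i. i \<in> B \<Longrightarrow> series_bound A p r s (\<lambda>x. G x i - q i)"
    and sp: "\<And>x. x \<in> polydisc A p r \<Longrightarrow> G x \<in> cspace B"
  shows "series_bound A p r M (\<lambda>x. f (G x))"
proof -
  obtain c where c: "(\<lambda>\<alpha>. cmod (c \<alpha>) * s ^ mdeg B \<alpha>) summable_on multi_indices B"
    "(\<Sum>\<^sub>\<infinity>\<alpha>\<in>multi_indices B. cmod (c \<alpha>) * s ^ mdeg B \<alpha>) \<le> M"
    "\<And>x. x \<in> polydisc B q s \<Longrightarrow>
      ((\<lambda>\<alpha>. c \<alpha> * monomial B \<alpha> (x - q)) has_sum f x) (multi_indices B)"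
    using f unfolding series_bound_def by blast
  have "series_bound A p r (\<Sum>\<^sub>\<infinity>\<alpha>\<in>multi_indices B. cmod (c \<alpha>) * s ^ mdeg B \<alpha>) (\<lambda>x. f (G x))"
  proof (rule series_bound_infsum[OF r])
    show "series_bound A p r (cmod (c \<alpha>) * s ^ mdeg B \<alpha>) (\<lambda>x. c \<alpha> * monomial B \<alpha> (G x - q))"
      for \<alpha>
    proof -
      have "series_bound A p r (\<Prod>i\<in>B. s ^ \<alpha> i) (\<lambda>x. \<Prod>i\<in>B. (G x i - q i) ^ \<alpha> i)"
        by (intro series_bound_prod series_bound_power assms)
      then have "series_bound A p r (s ^ mdeg B \<alpha>) (\<lambda>x. monomial B \<alpha> (G x - q))"
        by (simp add: mdeg_def power_sum monomial_def)
      then show ?thesis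
        by (intro series_bound_mult series_bound_const r)
    qed
    show "((\<lambda>\<alpha>. c \<alpha> * monomial B \<alpha> (G x - q)) has_sum f (G x)) (multi_indices B)"
      if x: "x \<in> polydisc A p r" for x
    proof (rule c(3))
      show "G x \<in> polydisc B q s"
        using sp[OF x] series_bound_norm_le[OF G x] by (simp add: polydisc_def)
    qed
  qed (rule c(1))
  then show ?thesis
    by (rule series_bound_mono) (use r c(2) in auto)
qed

text \<open>Composition with the identity: \<open>x i - p i\<close> is \<open>x i - p' i\<close>
  plus a constant of modulus at most \<open>r / 2\<close>, so its norm at radius
  \<open>r / 2\<close> about \<open>p'\<close> is at most \<open>r\<close>.\<close>

lemma series_bound_recenter:
  assumes "finite A" and r: "0 < r" and f: "series_bound A p r M f"
    and p': "\<And>i. i \<in> A \<Longrightarrow> cmod (p' i - p i) \<le> r / 2"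
  shows "series_bound A p' (r / 2) M f"
proof -
  have "series_bound A p' (r / 2) M (\<lambda>x. f (x :: 'a \<Rightarrow> complex))"
  proof (rule series_bound_compose[OF assms(1) _ f])
    show "series_bound A p' (r / 2) r (\<lambda>x. x i - p i)" if "i \<in> A" for i
    proof -
      have "series_bound A p' (r / 2) (r / 2 + cmod (p' i - p i)) (\<lambda>x. (x i - p' i) + (p' i - p i))"
        by (intro series_bound_add series_bound_const series_bound_coordinate)
          (use r assms(1) that in auto)
      then show ?thesis
        using series_bound_mono[of A p' "r / 2" _ "\<lambda>x. x i - p i" "r / 2" r] r p'[OF that] by simp
    qed
  qed (use r in \<open>auto simp: polydisc_def\<close>)
  then show ?thesis by simp
qed

text \<open>Without a constant term every remaining term has degree at least 1, so multiplying the
  radius by a factor at most 1 multiplies the norm by at most that factor. This supplies the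
  smallness that a composition requires.\<close>

lemma series_bound_shrink:
  assumes "finite A" "p \<in> cspace A" and r: "0 < r" and f: "series_bound A p r M f" "f p = 0"
    and s: "0 < s"
  obtains r' where "0 < r'" "r' \<le> r" "series_bound A p r' s f"
proof -
  obtain c where c: "(\<lambda>\<alpha>. cmod (c \<alpha>) * r ^ mdeg A \<alpha>) summable_on multi_indices A"
    "(\<Sum>\<^sub>\<infinity>\<alpha>\<in>multi_indices A. cmod (c \<alpha>) * r ^ mdeg A \<alpha>) \<le> M"
    "\<And>x. x \<in> polydisc A p r \<Longrightarrow>
      ((\<lambda>\<alpha>. c \<alpha> * monomial A \<alpha> (x - p)) has_sum f x) (multi_indices A)"
    using f unfolding series_bound_def by blast
  have "p \<in> polydisc A p r"
    using assms(2) r by (intro center_in_polydisc) auto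
  from c(3)[OF this] have "((\<lambda>\<alpha>. c \<alpha> * monomial A \<alpha> 0) has_sum 0) (multi_indices A)"
    using f(2) by simp
  moreover have "((\<lambda>\<alpha>. c \<alpha> * monomial A \<alpha> 0) has_sum c 0) (multi_indices A)"
    by (rule has_sum_finite_neutralI[where B = "{0}"]) (use assms(1) in \<open>auto simp: monomial_zero_arg\<close>)
  ultimately have c0: "c 0 = 0"
    using has_sum_unique by blast
  have M: "0 \<le> M"
    using series_bound_nonneg f(1) r by (meson less_imp_le)
  \<comment> \<open>The factor \<open>s / (M + 1)\<close> brings a norm \<open>M\<close> down to at
    most \<open>s\<close>; the summand 1 covers \<open>M = 0\<close>.\<close>
  define r' where "r' = r * min 1 (s / (M + 1))"
  have m: "0 < min 1 (s / (M + 1))" "min 1 (s / (M + 1)) \<le> 1"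
    using s M by auto
  have r': "0 < r'" "r' \<le> r"
    using r m by (auto simp: r'_def mult_left_le)
  define T where "T = min 1 (s / (M + 1))"
  have le: "cmod (c \<alpha>) * r' ^ mdeg A \<alpha> \<le> T * (cmod (c \<alpha>) * r ^ mdeg A \<alpha>)"
    if "\<alpha> \<in> multi_indices A" for \<alpha>
  proof (cases "\<alpha> = 0")
    case False
    then have "0 < mdeg A \<alpha>"
      using mdeg_eq_0_iff[OF assms(1) that] by simp
    then have "T ^ mdeg A \<alpha> \<le> T ^ 1"
      using m unfolding T_def by (intro power_decreasing) auto
    then have "T ^ mdeg A \<alpha> * (cmod (c \<alpha>) * r ^ mdeg A \<alpha>) \<le> T * (cmod (c \<alpha>) * r ^ mdeg A \<alpha>)"
      using r by (intro mult_right_mono) auto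
    then show ?thesis
      by (simp add: r'_def T_def[symmetric] power_mult_distrib mult_ac)
  qed (use c0 in simp)
  have s1: "(\<lambda>\<alpha>. T * (cmod (c \<alpha>) * r ^ mdeg A \<alpha>)) summable_on multi_indices A"
    by (intro summable_on_cmult_right c(1))
  have s2: "(\<lambda>\<alpha>. cmod (c \<alpha>) * r' ^ mdeg A \<alpha>) summable_on multi_indices A"
    by (rule summable_on_comparison_test[OF s1]) (use le r' in auto)
  have "(\<Sum>\<^sub>\<infinity>\<alpha>\<in>multi_indices A. cmod (c \<alpha>) * r' ^ mdeg A \<alpha>) \<le> T * M"
  proof -
    have "(\<Sum>\<^sub>\<infinity>\<alpha>\<in>multi_indices A. cmod (c \<alpha>) * r' ^ mdeg A \<alpha>)
        \<le> T * (\<Sum>\<^sub>\<infinity>\<alpha>\<in>multi_indices A. cmod (c \<alpha>) * r ^ mdeg A \<alpha>)"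
      using infsum_mono[OF s2 s1 le] by (simp add: infsum_cmult_right')
    also have "\<dots> \<le> T * M"
      using m by (intro mult_left_mono c(2)) (simp add: T_def)
    finally show ?thesis .
  qed
  also have "T * M \<le> s / (M + 1) * M"
    using M by (intro mult_right_mono) (auto simp: T_def)
  also have "\<dots> \<le> s"
    using M s by (simp add: field_simps)
  finally have "series_bound A p r' s f"
    unfolding series_bound_def using s2 c(3) polydisc_mono[OF r'(2)] by blast
  with r' that show thesis by blast
qed

lemma hol_at_iff_series_bound:
  assumes "finite A" "p \<in> cspace A"
  shows "hol_at A p f \<longleftrightarrow> (\<exists>r>0. \<exists>M. series_bound A p r M f)"
proof
  assume "hol_at A p f"
  then obtain r c where r: "0 < r" and c: "\<And>x. x \<in> cspace A \<Longrightarrow> \<forall>i\<in>A. cmod (x i - p i) < r \<Longrightarrow>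
        ((\<lambda>\<alpha>. c \<alpha> * monomial A \<alpha> (x - p)) has_sum f x) (multi_indices A)"
    unfolding hol_at_def by blast
  \<comment> \<open>At the point whose offsets from \<open>p\<close> all equal \<open>r / 2\<close>
    every monomial is a power of \<open>r / 2\<close>. Summability of a complex family is absolute,
    so this single point already yields the weighted norm.\<close>
  define x where "x i = (if i \<in> A then p i + of_real (r / 2) else 0)" for i
  have m: "monomial A \<alpha> (x - p) = of_real ((r / 2) ^ mdeg A \<alpha>)" for \<alpha>
    by (simp add: monomial_def x_def mdeg_def power_sum)
  have "((\<lambda>\<alpha>. c \<alpha> * monomial A \<alpha> (x - p)) has_sum f x) (multi_indices A)"
    by (rule c) (use r in \<open>auto simp: x_def cspace_def\<close>)
  then have "(\<lambda>\<alpha>. norm (c \<alpha> * monomial A \<alpha> (x - p))) summable_on multi_indices A"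
    by (intro summable_on_iff_abs_summable_on_complex[THEN iffD1]) (rule has_sum_imp_summable)
  then have "(\<lambda>\<alpha>. cmod (c \<alpha>) * (r / 2) ^ mdeg A \<alpha>) summable_on multi_indices A"
    unfolding m norm_mult norm_of_real using r by (simp add: power_divide)
  moreover have "((\<lambda>\<alpha>. c \<alpha> * monomial A \<alpha> (x - p)) has_sum f x) (multi_indices A)"
    if "x \<in> polydisc A p (r / 2)" for x
    using that r by (intro c) (auto simp: polydisc_def intro: le_less_trans)
  ultimately have "series_bound A p (r / 2)
      (\<Sum>\<^sub>\<infinity>\<alpha>\<in>multi_indices A. cmod (c \<alpha>) * (r / 2) ^ mdeg A \<alpha>) f"
    unfolding series_bound_def by blast
  then show "\<exists>r>0. \<exists>M. series_bound A p r M f"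
    using r half_gt_zero by blast
next
  assume "\<exists>r>0. \<exists>M. series_bound A p r M f"
  then obtain r M where r: "0 < r" "series_bound A p r M f" by blast
  then obtain c where "\<And>x. x \<in> polydisc A p r \<Longrightarrow>
      ((\<lambda>\<alpha>. c \<alpha> * monomial A \<alpha> (x - p)) has_sum f x) (multi_indices A)"
    unfolding series_bound_def by blast
  moreover have "x \<in> polydisc A p r" if "x \<in> cspace A" "\<forall>i\<in>A. cmod (x i - p i) < r" for x
    using that by (simp add: polydisc_def less_imp_le)
  ultimately show "hol_at A p f"
    unfolding hol_at_def using r(1) by blast
qed

lemma series_bound_common_radius:
  assumes "finite A" "p \<in> cspace A" "hol_at A p f" "hol_at A p g"
  obtains r M M' where "0 < r" "series_bound A p r M f" "series_bound A p r M' g"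
proof -
  obtain r M r' M' where *: "0 < r" "series_bound A p r M f" "0 < r'" "series_bound A p r' M' g"
    using assms(3,4) unfolding hol_at_iff_series_bound[OF assms(1,2)] by blast
  have "series_bound A p (min r r') M f" "series_bound A p (min r r') M' g"
    by (rule series_bound_mono[OF *(2)] series_bound_mono[OF *(4)]; use * in simp)+
  then show thesis
    using that[of "min r r'"] * by simp
qed

section \<open>Closure properties of holomorphic functions at a fixed centre\<close>

context
  fixes A :: "'i set" and p :: "'i \<Rightarrow> complex"
  assumes A: "finite A" "p \<in> cspace A"
begin

lemma hol_atI: "0 < r \<Longrightarrow> series_bound A p r M f \<Longrightarrow> hol_at A p f"
  unfolding hol_at_iff_series_bound[OF A] by blast

lemma hol_at_const: "hol_at A p (\<lambda>x. k)"
  by (rule hol_atI[OF zero_less_one series_bound_const])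

lemma hol_at_add:
  assumes "hol_at A p f" "hol_at A p g"
  shows "hol_at A p (\<lambda>x. f x + g x)"
proof -
  obtain r M M' where "0 < r" "series_bound A p r M f" "series_bound A p r M' g"
    using A assms by (rule series_bound_common_radius)
  then show ?thesis
    by (intro hol_atI[OF _ series_bound_add])
qed

lemma hol_at_mult:
  assumes "hol_at A p f" "hol_at A p g"
  shows "hol_at A p (\<lambda>x. f x * g x)"
proof -
  obtain r M M' where "0 < r" "series_bound A p r M f" "series_bound A p r M' g"
    using A assms by (rule series_bound_common_radius)
  then show ?thesis
    by (intro hol_atI[OF _ series_bound_mult])
qed

lemma hol_at_coordinate:
  assumes "i \<in> A"
  shows "hol_at A p (\<lambda>x. x i)"
proof -
  have "series_bound A p 1 1 (\<lambda>x. x i - p i)"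
    using A assms by (intro series_bound_coordinate) auto
  then have "hol_at A p (\<lambda>x. x i - p i)"
    by (rule hol_atI[OF zero_less_one])
  from hol_at_add[OF this hol_at_const[of "p i"]] show ?thesis by simp
qed

lemma hol_at_power: "hol_at A p f \<Longrightarrow> hol_at A p (\<lambda>x. f x ^ n)"
  by (induction n) (auto intro: hol_at_const hol_at_mult)

lemma hol_at_prod:
  "finite B \<Longrightarrow> (\<And>i. i \<in> B \<Longrightarrow> hol_at A p (f i)) \<Longrightarrow> hol_at A p (\<lambda>x. \<Prod>i\<in>B. f i x)"
  by (induction B rule: finite_induct) (auto intro: hol_at_const hol_at_mult)

lemma hol_at_sum:
  "finite B \<Longrightarrow> (\<And>i. i \<in> B \<Longrightarrow> hol_at A p (f i)) \<Longrightarrow> hol_at A p (\<lambda>x. \<Sum>i\<in>B. f i x)"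
  by (induction B rule: finite_induct) (auto intro: hol_at_const hol_at_add)

lemma hol_at_diff: "hol_at A p f \<Longrightarrow> hol_at A p g \<Longrightarrow> hol_at A p (\<lambda>x. f x - g x)"
  using hol_at_add[of f "\<lambda>x. - 1 * g x"] hol_at_mult[OF hol_at_const, of g "- 1"] by simp

lemma hol_at_near_center:
  assumes f: "hol_at A p f" "f p = 0" and s: "0 < s"
  obtains r where "0 < r" "series_bound A p r s f"
proof -
  obtain r M where r: "0 < r" "series_bound A p r M f"
    using f(1) unfolding hol_at_iff_series_bound[OF A] by blast
  show thesis
    by (rule series_bound_shrink[OF A r f(2) s]) (rule that)
qed

lemma hol_at_continuous:
  assumes f: "hol_at A p f" and e: "0 < e"
  obtains d where "0 < d" "\<And>x. x \<in> polydisc A p d \<Longrightarrow> cmod (f x - f p) < e"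
proof -
  have "hol_at A p (\<lambda>x. f x - f p)"
    by (intro hol_at_diff f hol_at_const)
  then obtain r where "0 < r" "series_bound A p r (e / 2) (\<lambda>x. f x - f p)"
    using hol_at_near_center[of "\<lambda>x. f x - f p" "e / 2"] e by auto
  moreover have "e / 2 < e"
    using e by simp
  ultimately show thesis
    using that[of r] series_bound_norm_le by (metis le_less_trans)
qed

lemma hol_at_nearby:
  assumes f: "hol_at A p f"
  obtains d where "0 < d" "\<And>p'. p' \<in> polydisc A p d \<Longrightarrow> hol_at A p' f"
proof -
  obtain r M where r: "0 < r" "series_bound A p r M f"
    using f A hol_at_iff_series_bound by blast
  have "hol_at A p' f" if "p' \<in> polydisc A p (r / 2)" for p'
  proof -
    have "series_bound A p' (r / 2) M f"
      using that by (intro series_bound_recenter[OF A(1) r]) (auto simp: polydisc_def)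
    moreover have "p' \<in> cspace A"
      using that by (simp add: polydisc_def)
    ultimately show ?thesis
      using A(1) r(1) hol_at_iff_series_bound half_gt_zero by blast
  qed
  then show thesis
    using that[of "r / 2"] r by simp
qed

lemma hol_at_compose:
  assumes B: "finite B" and q: "G p \<in> cspace B" and f: "hol_at B (G p) f"
    and G: "\<And>i. i \<in> B \<Longrightarrow> hol_at A p (\<lambda>x. G x i)"
    and sp: "\<And>x. x \<in> cspace A \<Longrightarrow> G x \<in> cspace B"
  shows "hol_at A p (\<lambda>x. f (G x))"
proof -
  obtain s M where s: "0 < s" "series_bound B (G p) s M f"
    using f B q hol_at_iff_series_bound by blast
  have "\<exists>r>0. series_bound A p r s (\<lambda>x. G x i - G p i)" if "i \<in> B" for i
  proof -
    have "hol_at A p (\<lambda>x. G x i - G p i)"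
      by (intro hol_at_diff hol_at_const G that)
    then show ?thesis
      using hol_at_near_center[of "\<lambda>x. G x i - G p i" s] s by auto
  qed
  then obtain r where r: "\<And>i. i \<in> B \<Longrightarrow> 0 < r i"
    "\<And>i. i \<in> B \<Longrightarrow> series_bound A p (r i) s (\<lambda>x. G x i - G p i)"
    by metis
  \<comment> \<open>The least of finitely many radii; the element 1 makes the minimum meaningful
    when \<open>B\<close> is empty.\<close>
  define R where "R = Min (insert 1 (r ` B))"
  have R: "0 < R" "\<And>i. i \<in> B \<Longrightarrow> R \<le> r i"
    using B r(1) by (auto simp: R_def)
  have "series_bound A p R M (\<lambda>x. f (G x))"
  proof (rule series_bound_compose[OF B R(1) s(2)])
    show "series_bound A p R s (\<lambda>x. G x i - G p i)" if "i \<in> B" for i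
      by (rule series_bound_mono[OF r(2)[OF that]]) (use R that in auto)
  qed (use sp in \<open>auto simp: polydisc_def\<close>)
  then show ?thesis
    by (rule hol_atI[OF R(1)])
qed

end

section \<open>Germs and neighbourhoods\<close>

lemma open_polydisc_cylinder: "finite A \<Longrightarrow> open {x :: 'i \<Rightarrow> complex. \<forall>i\<in>A. x i \<in> ball (p i) r}"
  using product_topology_basis'[of A "\<lambda>i. ball (p i) r" "\<lambda>i. i"] by simp

text \<open>A basic open set of the product topology restricts each coordinate separately.
  Coordinates outside \<open>A\<close> vanish both at \<open>p\<close> and on the polydisc, so only
  the finitely many radii indexed by \<open>A\<close> matter.\<close>

lemma open_contains_polydisc:
  assumes "finite A" "p \<in> cspace A" "open S" "p \<in> S"
  obtains r where "0 < r" "polydisc A p r \<subseteq> S"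
proof -
  have "openin (product_topology (\<lambda>i. euclidean) UNIV) S"
    using assms(3) by (simp add: euclidean_product_topology)
  from product_topology_open_contains_basis[OF this assms(4)]
  obtain X where X: "p \<in> Pi\<^sub>E UNIV X" "\<And>i. open (X i)" "Pi\<^sub>E UNIV X \<subseteq> S"
    by auto
  have "\<exists>e>0. cball (p i) e \<subseteq> X i" for i
    using X(1,2) by (meson PiE_mem UNIV_I open_contains_cball)
  then obtain e where e: "\<And>i. 0 < e i" "\<And>i. cball (p i) (e i) \<subseteq> X i"
    by metis
  define r where "r = Min (insert 1 (e ` A))"
  have r: "0 < r" "\<And>i. i \<in> A \<Longrightarrow> r \<le> e i"
    using assms(1) e(1) by (auto simp: r_def)
  have "x \<in> S" if x: "x \<in> polydisc A p r" for x
  proof -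
    have "x i \<in> X i" for i
    proof (cases "i \<in> A")
      case True
      then have "x i \<in> cball (p i) (e i)"
        using x r(2)[OF True] by (auto simp: polydisc_def dist_norm norm_minus_commute)
      then show ?thesis using e(2) by blast
    next
      case False
      then show ?thesis
        using x assms(2) X(1) by (metis (mono_tags, lifting) PiE_mem UNIV_I cspace_def mem_Collect_eq polydisc_def)
    qed
    then show ?thesis using X(3) by (auto simp: PiE_iff)
  qed
  then show thesis using that r(1) by blast
qed

lemma eventually_nhds_polydisc:
  assumes "finite A" "p \<in> cspace A" "V \<subseteq> cspace A"
  shows "eventually P (inf (nhds p) (principal V)) \<longleftrightarrow> (\<exists>r>0. \<forall>x\<in>V \<inter> polydisc A p r. P x)"
proof
  assume "eventually P (inf (nhds p) (principal V))"
  then obtain S where S: "open S" "p \<in> S" "\<And>x. x \<in> S \<Longrightarrow> x \<in> V \<Longrightarrow> P x"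
    by (auto simp: eventually_inf_principal eventually_nhds)
  show "\<exists>r>0. \<forall>x\<in>V \<inter> polydisc A p r. P x"
    by (rule open_contains_polydisc[OF assms(1,2) S(1,2)]) (use S(3) in blast)
next
  assume "\<exists>r>0. \<forall>x\<in>V \<inter> polydisc A p r. P x"
  then obtain r where r: "0 < r" "\<And>x. x \<in> V \<inter> polydisc A p r \<Longrightarrow> P x" by blast
  let ?S = "{x. \<forall>i\<in>A. x i \<in> ball (p i) r}"
  have "x \<in> polydisc A p r" if "x \<in> ?S" "x \<in> V" for x
    using that assms(3) by (force simp: polydisc_def dist_norm norm_minus_commute)
  moreover have "open ?S" "p \<in> ?S"
    using open_polydisc_cylinder[OF assms(1)] r(1) by auto
  ultimately show "eventually P (inf (nhds p) (principal V))"
    unfolding eventually_inf_principal eventually_nhds using r(2) by blast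
qed

lemma openin_iff_polydisc:
  assumes "finite A" "V \<subseteq> cspace A"
  shows "openin (top_of_set V) U \<longleftrightarrow> U \<subseteq> V \<and> (\<forall>p\<in>U. \<exists>r>0. V \<inter> polydisc A p r \<subseteq> U)"
proof (intro iffI conjI ballI)
  assume U: "openin (top_of_set V) U"
  then show "U \<subseteq> V" by (rule openin_imp_subset)
  fix p assume "p \<in> U"
  obtain S where S: "open S" "U = V \<inter> S"
    using U by (auto simp: openin_open)
  show "\<exists>r>0. V \<inter> polydisc A p r \<subseteq> U"
    by (rule open_contains_polydisc[OF assms(1) _ S(1), of p]) (use S \<open>p \<in> U\<close> assms in auto)
next
  assume U: "U \<subseteq> V \<and> (\<forall>p\<in>U. \<exists>r>0. V \<inter> polydisc A p r \<subseteq> U)"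
  show "openin (top_of_set V) U"
  proof (subst openin_subopen, intro ballI)
    fix p assume "p \<in> U"
    then obtain r where r: "0 < r" "V \<inter> polydisc A p r \<subseteq> U" using U by blast
    let ?S = "{x. \<forall>i\<in>A. x i \<in> ball (p i) r}"
    have "openin (top_of_set V) (V \<inter> ?S)"
      using open_polydisc_cylinder[OF assms(1)] by (rule openin_open_Int)
    moreover have "p \<in> V \<inter> ?S"
      using U \<open>p \<in> U\<close> r(1) by auto
    moreover have "V \<inter> ?S \<subseteq> V \<inter> polydisc A p r"
      using assms(2) by (force simp: polydisc_def dist_norm norm_minus_commute)
    ultimately show "\<exists>T. openin (top_of_set V) T \<and> p \<in> T \<and> T \<subseteq> U"
      using r(2) by blast
  qed
qed

text \<open>Separates the topological side of germs from their equations: the toric image is of this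
  kind before finitely many equations for it are available, and limits and compositions of germs can
  be treated at that stage.\<close>

definition affine_germ :: "'i germ_space \<Rightarrow> bool"
  where "affine_germ X \<longleftrightarrow>
    finite (coords X) \<and> pts X \<subseteq> cspace (coords X) \<and> base X \<in> pts X"

lemma analytic_imp_affine_germ: "analytic_germ X \<Longrightarrow> affine_germ X"
  by (simp add: analytic_germ_def affine_germ_def)

lemma eventually_near:
  assumes "affine_germ X"
  shows "eventually P (near X) \<longleftrightarrow>
    (\<exists>r>0. \<forall>x\<in>pts X \<inter> polydisc (coords X) (base X) r. P x)"
  unfolding near_def using assms
  by (intro eventually_nhds_polydisc) (auto simp: affine_germ_def)

lemma eventually_near_base: "affine_germ X \<Longrightarrow> eventually P (near X) \<Longrightarrow> P (base X)"
  by (auto simp: near_def eventually_inf_principal affine_germ_def dest: eventually_nhds_x_imp_x)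

lemma eventually_near_pts: "eventually (\<lambda>x. x \<in> pts X) (near X)"
  by (simp add: near_def eventually_inf_principal)

lemma eventually_near_nbhd: "nbhd X U \<Longrightarrow> eventually (\<lambda>x. x \<in> U) (near X)"
  by (auto simp: nbhd_def near_def openin_open eventually_inf_principal eventually_nhds)

lemma eventually_near_obtain_nbhd:
  assumes "affine_germ X" "eventually P (near X)"
  obtains U where "nbhd X U" "\<And>x. x \<in> U \<Longrightarrow> P x"
proof -
  obtain S where "open S" "base X \<in> S" "\<And>x. x \<in> S \<Longrightarrow> x \<in> pts X \<Longrightarrow> P x"
    using assms(2) by (auto simp: near_def eventually_inf_principal eventually_nhds)
  then show thesis
    using that[of "pts X \<inter> S"] assms(1) by (auto simp: nbhd_def affine_germ_def openin_open_Int)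
qed

lemma nbhd_pts: "affine_germ X \<Longrightarrow> nbhd X (pts X)"
  by (simp add: nbhd_def affine_germ_def)

lemma nbhd_Int: "nbhd X U \<Longrightarrow> nbhd X V \<Longrightarrow> nbhd X (U \<inter> V)"
  by (auto simp: nbhd_def)

lemma nbhd_subset: "nbhd X U \<Longrightarrow> U \<subseteq> pts X"
  by (auto simp: nbhd_def dest: openin_imp_subset)

text \<open>Continuity at the base point, coordinate by coordinate. In this form a property that
  holds near \<open>base Y\<close> can be pulled back along \<phi>, which is how identities of germs
  are composed below.\<close>

lemma hol_map_germ_filterlim:
  assumes X: "affine_germ X" and Y: "affine_germ Y" and \<phi>: "hol_map_germ X Y \<phi>"
  shows "filterlim \<phi> (near Y) (near X)"
  unfolding filterlim_iff
proof (intro allI impI)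
  fix P assume "eventually P (near Y)"
  then obtain r where r: "0 < r" "\<And>y. y \<in> pts Y \<inter> polydisc (coords Y) (base Y) r \<Longrightarrow> P y"
    unfolding eventually_near[OF Y] by blast
  have "\<forall>\<^sub>F x in near X. cmod (\<phi> x j - base Y j) < r" if j: "j \<in> coords Y" for j
  proof -
    obtain F where F: "hol_at (coords X) (base X) F" "\<forall>\<^sub>F x in near X. \<phi> x j = F x"
      using \<phi> j unfolding hol_map_germ_def by blast
    have base: "F (base X) = base Y j"
      using eventually_near_base[OF X F(2)] \<phi> by (simp add: hol_map_germ_def)
    obtain d where d: "0 < d"
      "\<And>x. x \<in> polydisc (coords X) (base X) d \<Longrightarrow> cmod (F x - F (base X)) < r"
      using hol_at_continuous[OF _ _ F(1) r(1)] X by (auto simp: affine_germ_def)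
    then have "\<forall>\<^sub>F x in near X. cmod (F x - base Y j) < r"
      unfolding eventually_near[OF X] base by blast
    with F(2) show ?thesis
      by eventually_elim simp
  qed
  then have "\<forall>\<^sub>F x in near X. \<forall>j\<in>coords Y. cmod (\<phi> x j - base Y j) < r"
    using Y by (intro eventually_ball_finite) (auto simp: affine_germ_def)
  moreover have "\<forall>\<^sub>F x in near X. \<phi> x \<in> pts Y"
    using \<phi> by (simp add: hol_map_germ_def)
  ultimately show "\<forall>\<^sub>F x in near X. P (\<phi> x)"
  proof eventually_elim
    case (elim x)
    then show ?case
      using Y by (intro r(2)) (auto simp: polydisc_def affine_germ_def less_imp_le)
  qed
qed

lemma hol_map_germ_cong:
  assumes X: "affine_germ X" and \<phi>: "hol_map_germ X Y \<phi>" and eq: "\<forall>\<^sub>F x in near X. \<psi> x = \<phi> x"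
  shows "hol_map_germ X Y \<psi>"
  unfolding hol_map_germ_def
proof (intro conjI ballI)
  show "\<psi> (base X) = base Y"
    using eventually_near_base[OF X eq] \<phi> by (simp add: hol_map_germ_def)
  have "\<forall>\<^sub>F x in near X. \<phi> x \<in> pts Y"
    using \<phi> by (simp add: hol_map_germ_def)
  with eq show "\<forall>\<^sub>F x in near X. \<psi> x \<in> pts Y"
    by eventually_elim simp
  fix j assume "j \<in> coords Y"
  then obtain F where F: "hol_at (coords X) (base X) F" "\<forall>\<^sub>F x in near X. \<phi> x j = F x"
    using \<phi> unfolding hol_map_germ_def by blast
  from F(2) eq have "\<forall>\<^sub>F x in near X. \<psi> x j = F x"
    by eventually_elim simp
  with F(1) show "\<exists>F. hol_at (coords X) (base X) F \<and> (\<forall>\<^sub>F x in near X. \<psi> x j = F x)"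
    by blast
qed

lemma hol_map_germ_id:
  assumes "affine_germ X"
  shows "hol_map_germ X X id"
  unfolding hol_map_germ_def
proof (intro conjI ballI)
  fix i assume "i \<in> coords X"
  then have "hol_at (coords X) (base X) (\<lambda>x. x i)"
    using assms by (intro hol_at_coordinate) (auto simp: affine_germ_def)
  then show "\<exists>F. hol_at (coords X) (base X) F \<and> (\<forall>\<^sub>F x in near X. id x i = F x)"
    by (intro exI[of _ "\<lambda>x. x i"]) simp
qed (simp_all add: eventually_near_pts)

text \<open>\<phi> agrees with a tuple of holomorphic functions only near the base point. Extending
  the tuple by 0 outside \<open>coords Y\<close> gives a map defined everywhere with values in the
  coordinate space, to which the composition result applies.\<close>

lemma hol_map_germ_pullback:
  assumes X: "affine_germ X" and Y: "affine_germ Y" and \<phi>: "hol_map_germ X Y \<phi>"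
    and f: "hol_at (coords Y) (base Y) f"
  obtains F where "hol_at (coords X) (base X) F" "\<forall>\<^sub>F x in near X. f (\<phi> x) = F x"
proof -
  obtain G where G: "\<And>i. i \<in> coords Y \<Longrightarrow> hol_at (coords X) (base X) (G i)"
    "\<And>i. i \<in> coords Y \<Longrightarrow> \<forall>\<^sub>F x in near X. \<phi> x i = G i x"
    using \<phi> unfolding hol_map_germ_def by metis
  define \<phi>' where "\<phi>' x = (\<lambda>i. if i \<in> coords Y then G i x else 0)" for x
  have "\<forall>\<^sub>F x in near X. \<forall>i\<in>coords Y. \<phi> x i = G i x"
    using G(2) Y by (intro eventually_ball_finite) (auto simp: affine_germ_def)
  moreover have "\<forall>\<^sub>F x in near X. \<phi> x \<in> pts Y"
    using \<phi> by (simp add: hol_map_germ_def)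
  ultimately have eq: "\<forall>\<^sub>F x in near X. \<phi> x = \<phi>' x"
  proof eventually_elim
    case (elim x)
    then show ?case
      using Y by (auto simp: \<phi>'_def affine_germ_def cspace_def fun_eq_iff)
  qed
  have base: "\<phi>' (base X) = base Y"
    using eventually_near_base[OF X eq] \<phi> by (simp add: hol_map_germ_def)
  have "hol_at (coords X) (base X) (\<lambda>x. f (\<phi>' x))"
  proof (rule hol_at_compose[where G = \<phi>' and f = f and B = "coords Y"])
    show "hol_at (coords X) (base X) (\<lambda>x. \<phi>' x i)" if "i \<in> coords Y" for i
      using G(1)[OF that] that by (simp add: \<phi>'_def)
  qed (use X Y f base in \<open>auto simp: affine_germ_def \<phi>'_def cspace_def\<close>)
  moreover from eq have "\<forall>\<^sub>F x in near X. f (\<phi> x) = f (\<phi>' x)"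
    by eventually_elim simp
  ultimately show thesis using that by blast
qed

lemma hol_map_germ_compose:
  assumes X: "affine_germ X" and Y: "affine_germ Y"
    and \<phi>: "hol_map_germ X Y \<phi>" and \<psi>: "hol_map_germ Y Z \<psi>"
  shows "hol_map_germ X Z (\<psi> \<circ> \<phi>)"
  unfolding hol_map_germ_def
proof (intro conjI ballI)
  note lim = hol_map_germ_filterlim[OF X Y \<phi>]
  show "(\<psi> \<circ> \<phi>) (base X) = base Z"
    using \<phi> \<psi> by (simp add: hol_map_germ_def)
  have "\<forall>\<^sub>F y in near Y. \<psi> y \<in> pts Z"
    using \<psi> by (simp add: hol_map_germ_def)
  from eventually_compose_filterlim[OF this lim] show "\<forall>\<^sub>F x in near X. (\<psi> \<circ> \<phi>) x \<in> pts Z"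
    by simp
  fix j assume "j \<in> coords Z"
  then obtain f where f: "hol_at (coords Y) (base Y) f" "\<forall>\<^sub>F y in near Y. \<psi> y j = f y"
    using \<psi> unfolding hol_map_germ_def by blast
  obtain F where F: "hol_at (coords X) (base X) F" "\<forall>\<^sub>F x in near X. f (\<phi> x) = F x"
    using hol_map_germ_pullback[OF X Y \<phi> f(1)] .
  from eventually_compose_filterlim[OF f(2) lim] F(2)
  have "\<forall>\<^sub>F x in near X. (\<psi> \<circ> \<phi>) x j = F x"
    by eventually_elim simp
  with F(1) show "\<exists>F. hol_at (coords X) (base X) F \<and> (\<forall>\<^sub>F x in near X. (\<psi> \<circ> \<phi>) x j = F x)"
    by blast
qed

lemma biholo_germ_compose:
  assumes X: "affine_germ X" and Y: "affine_germ Y" and Z: "affine_germ Z"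
    and \<phi>: "biholo_germ X Y \<phi>" and \<psi>: "biholo_germ Y Z \<psi>"
  shows "biholo_germ X Z (\<psi> \<circ> \<phi>)"
proof -
  obtain \<phi>' where \<phi>': "hol_map_germ Y X \<phi>'" "\<forall>\<^sub>F x in near X. \<phi>' (\<phi> x) = x"
      "\<forall>\<^sub>F y in near Y. \<phi> (\<phi>' y) = y"
    using \<phi> by (auto simp: biholo_germ_def)
  obtain \<psi>' where \<psi>': "hol_map_germ Z Y \<psi>'" "\<forall>\<^sub>F y in near Y. \<psi>' (\<psi> y) = y"
      "\<forall>\<^sub>F z in near Z. \<psi> (\<psi>' z) = z"
    using \<psi> by (auto simp: biholo_germ_def)
  have h: "hol_map_germ X Y \<phi>" "hol_map_germ Y Z \<psi>"
    using \<phi> \<psi> by (auto simp: biholo_germ_def)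
  from eventually_compose_filterlim[OF \<psi>'(2) hol_map_germ_filterlim[OF X Y h(1)]] \<phi>'(2)
  have "\<forall>\<^sub>F x in near X. (\<phi>' \<circ> \<psi>') ((\<psi> \<circ> \<phi>) x) = x"
    by eventually_elim simp
  moreover from eventually_compose_filterlim[OF \<phi>'(3) hol_map_germ_filterlim[OF Z Y \<psi>'(1)]] \<psi>'(3)
  have "\<forall>\<^sub>F z in near Z. (\<psi> \<circ> \<phi>) ((\<phi>' \<circ> \<psi>') z) = z"
    by eventually_elim simp
  ultimately show ?thesis
    unfolding biholo_germ_def
    using hol_map_germ_compose[OF X Y h] hol_map_germ_compose[OF Z Y \<psi>'(1) \<phi>'(1)] by blast
qed

lemma biholo_germ_id: "affine_germ X \<Longrightarrow> biholo_germ X X id"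
  unfolding biholo_germ_def using hol_map_germ_id by (intro conjI exI[of _ id]) auto

lemma biholo_germ_cong:
  assumes X: "affine_germ X" and Y: "affine_germ Y"
    and \<phi>: "biholo_germ X Y \<phi>" and eq: "\<forall>\<^sub>F x in near X. \<psi> x = \<phi> x"
  shows "biholo_germ X Y \<psi>"
proof -
  obtain \<phi>' where \<phi>': "hol_map_germ Y X \<phi>'" "\<forall>\<^sub>F x in near X. \<phi>' (\<phi> x) = x"
      "\<forall>\<^sub>F y in near Y. \<phi> (\<phi>' y) = y"
    using \<phi> by (auto simp: biholo_germ_def)
  from \<phi>'(2) eq have "\<forall>\<^sub>F x in near X. \<phi>' (\<psi> x) = x"
    by eventually_elim simp
  moreover from eventually_compose_filterlim[OF eq hol_map_germ_filterlim[OF Y X \<phi>'(1)]] \<phi>'(3)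
  have "\<forall>\<^sub>F y in near Y. \<psi> (\<phi>' y) = y"
    by eventually_elim simp
  moreover have "hol_map_germ X Y \<psi>"
    using \<phi> by (intro hol_map_germ_cong[OF X _ eq]) (simp add: biholo_germ_def)
  ultimately show ?thesis
    unfolding biholo_germ_def using \<phi>'(1) by blast
qed

lemma hol_at_continuous_on:
  assumes "finite A" "U \<subseteq> cspace A" "\<And>p. p \<in> U \<Longrightarrow> hol_at A p f"
  shows "continuous_on U f"
  unfolding continuous_on_def
proof (intro ballI)
  fix p assume p: "p \<in> U"
  have "at p within U \<le> inf (nhds p) (principal U)"
    unfolding at_within_def by (intro inf_mono) auto
  moreover have "(f \<longlongrightarrow> f p) (inf (nhds p) (principal U))"
    unfolding tendsto_iff
  proof (intro allI impI)
    fix e :: real assume "0 < e"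
    moreover have "p \<in> cspace A"
      using assms(2) p by blast
    ultimately obtain d where "0 < d" "\<And>x. x \<in> polydisc A p d \<Longrightarrow> cmod (f x - f p) < e"
      using hol_at_continuous[OF assms(1) _ assms(3)[OF p]] by blast
    then show "\<forall>\<^sub>F x in inf (nhds p) (principal U). dist (f x) (f p) < e"
      using assms p by (subst eventually_nhds_polydisc[of A]) (auto simp: dist_norm)
  qed
  ultimately show "(f \<longlongrightarrow> f p) (at p within U)"
    by (rule tendsto_mono)
qed

text \<open>Power series can be recentred, so the coordinate functions are holomorphic, hence
  continuous, at all points near the base point; \<phi> agrees with them there and is itself
  continuous on a neighbourhood.\<close>

lemma hol_map_germ_continuous:
  assumes X: "affine_germ X" and Y: "affine_germ Y" and \<phi>: "hol_map_germ X Y \<phi>"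
  obtains U where "nbhd X U" "continuous_on U \<phi>" "\<phi> ` U \<subseteq> pts Y"
proof -
  obtain F where F: "\<And>j. j \<in> coords Y \<Longrightarrow> hol_at (coords X) (base X) (F j)"
    "\<And>j. j \<in> coords Y \<Longrightarrow> \<forall>\<^sub>F x in near X. \<phi> x j = F j x"
    using \<phi> unfolding hol_map_germ_def by metis
  have "\<forall>\<^sub>F x in near X. \<phi> x j = F j x \<and> hol_at (coords X) x (F j)" if j: "j \<in> coords Y" for j
  proof -
    obtain d where "0 < d"
      "\<And>x. x \<in> polydisc (coords X) (base X) d \<Longrightarrow> hol_at (coords X) x (F j)"
      using hol_at_nearby[OF _ _ F(1)[OF j]] X by (auto simp: affine_germ_def)
    then have "\<forall>\<^sub>F x in near X. hol_at (coords X) x (F j)"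
      unfolding eventually_near[OF X] by blast
    with F(2)[OF j] show ?thesis by (rule eventually_conj)
  qed
  then have "\<forall>\<^sub>F x in near X. \<forall>j\<in>coords Y. \<phi> x j = F j x \<and> hol_at (coords X) x (F j)"
    using Y by (intro eventually_ball_finite) (auto simp: affine_germ_def)
  moreover have "\<forall>\<^sub>F x in near X. \<phi> x \<in> pts Y"
    using \<phi> by (simp add: hol_map_germ_def)
  ultimately have "\<forall>\<^sub>F x in near X. \<phi> x \<in> pts Y \<and>
      (\<forall>j\<in>coords Y. \<phi> x j = F j x \<and> hol_at (coords X) x (F j))"
    by (rule eventually_conj[rotated])
  then obtain U where U: "nbhd X U" "\<And>x. x \<in> U \<Longrightarrow> \<phi> x \<in> pts Y"
    "\<And>x j. x \<in> U \<Longrightarrow> j \<in> coords Y \<Longrightarrow> \<phi> x j = F j x"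
    "\<And>x j. x \<in> U \<Longrightarrow> j \<in> coords Y \<Longrightarrow> hol_at (coords X) x (F j)"
    by (rule eventually_near_obtain_nbhd[OF X]) blast
  have "continuous_on U (\<lambda>x. \<phi> x j)" for j
  proof (cases "j \<in> coords Y")
    case True
    have "continuous_on U (F j)"
      by (rule hol_at_continuous_on[of "coords X"])
        (use X nbhd_subset[OF U(1)] U(4) True in \<open>auto simp: affine_germ_def\<close>)
    then show ?thesis
      by (subst continuous_on_cong[OF refl U(3)[OF _ True]])
  next
    case False
    then have "\<phi> x j = 0" if "x \<in> U" for x
      using U(2)[OF that] Y by (auto simp: affine_germ_def cspace_def)
    then show ?thesis
      using continuous_on_cong[of U U "\<lambda>x. \<phi> x j" "\<lambda>x. 0"] by simp
  qed
  then have "continuous_on U \<phi>"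
    by (rule continuous_on_coordinatewise_then_product)
  with U that show thesis by blast
qed

section \<open>Uniqueness of coefficients and polynomial functions\<close>

text \<open>Zeros of a nonzero power series are isolated, those of the zero function are not. The
  constant coefficient is treated apart, because the isolation result starts from a nonzero
  coefficient of positive index.\<close>

lemma power_series_coeff_eq_0:
  fixes d :: "nat \<Rightarrow> complex"
  assumes r: "0 < r" and d: "\<And>t. cmod t < r \<Longrightarrow> (\<lambda>n. d n * t ^ n) sums 0"
  shows "d n = 0"
proof (rule ccontr)
  assume dn: "d n \<noteq> 0"
  have "(\<lambda>n. d n * 0 ^ n) sums 0"
    using d[of 0] r by simp
  then have "d 0 = 0"
    using powser_sums_zero[of d] sums_unique2 by blast
  with dn have "0 < n"
    by (metis gr0I)
  obtain s where s: "0 < s" "\<And>z::complex. z \<in> cball 0 s - {0} \<Longrightarrow> (0::complex) \<noteq> 0"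
    by (rule powser_0_nonzero[of r 0 d "\<lambda>_. 0" n]) (use r d dn \<open>0 < n\<close> in auto)
  then show False
    using s(2)[of "of_real s"] by simp
qed

text \<open>Induction on the number of variables: sorted by the exponent of one variable
  \<open>j\<close>, the series becomes a power series in \<open>t\<close> whose coefficients are
  series in the other variables, and these must all vanish.\<close>

lemma coeff_eq_0_if_series_eq_0:
  assumes "finite A" "0 < r"
    and "\<And>x. x \<in> cspace A \<Longrightarrow> (\<And>i. i \<in> A \<Longrightarrow> cmod (x i) < r) \<Longrightarrow>
      ((\<lambda>\<alpha>. c \<alpha> * monomial A \<alpha> x) has_sum 0) (multi_indices A)"
    and "\<alpha> \<in> multi_indices A"
  shows "c \<alpha> = 0"
  using assms(1,3,4)
proof (induction A arbitrary: c \<alpha> rule: finite_induct)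
  case empty
  have "((\<lambda>\<alpha>. c \<alpha> * monomial {} \<alpha> 0) has_sum 0) (multi_indices {})"
    by (rule empty(1)) (auto simp: cspace_def)
  moreover have "multi_indices {} = {0 :: 'a \<Rightarrow> nat}"
    by (auto simp: multi_indices_def fun_eq_iff)
  moreover have "monomial {} \<alpha> 0 = 1" for \<alpha> :: "'a \<Rightarrow> nat"
    by (simp add: monomial_def)
  ultimately have "0 = c 0"
    using has_sum_finite_iff[of "{0}" c] by simp
  moreover have "\<alpha> = 0"
    using empty(2) \<open>multi_indices {} = {0}\<close> by blast
  ultimately show ?case by (simp add: zero_fun_def)
next
  case (insert j B)
  define c' where "c' n \<beta> = c (\<beta>(j := n))" for n \<beta>
  have bij: "bij_betw (\<lambda>(n, \<beta>). \<beta>(j := n)) (UNIV \<times> multi_indices B) (multi_indices (insert j B))"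
  proof (rule bij_betwI[where g = "\<lambda>\<alpha>. (\<alpha> j, \<alpha>(j := 0))"])
    show "(\<lambda>(n, \<beta>). \<beta>(j := n)) \<in> UNIV \<times> multi_indices B \<rightarrow> multi_indices (insert j B)"
      by (auto simp: multi_indices_def)
    show "(\<lambda>\<alpha>. (\<alpha> j, \<alpha>(j := 0))) \<in> multi_indices (insert j B) \<rightarrow> UNIV \<times> multi_indices B"
      by (auto simp: multi_indices_def)
  qed (use insert(2) in \<open>auto simp: multi_indices_def fun_eq_iff\<close>)
  have "((\<lambda>\<beta>. c' n \<beta> * monomial B \<beta> y) has_sum 0) (multi_indices B)"
    if y: "y \<in> cspace B" "\<And>i. i \<in> B \<Longrightarrow> cmod (y i) < r" for n y
  proof -
    have sum: "((\<lambda>(n, \<beta>). c' n \<beta> * monomial B \<beta> y * t ^ n) has_sum 0) (UNIV \<times> multi_indices B)"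
      if t: "cmod t < r" for t
    proof -
      have m: "monomial (insert j B) (\<beta>(j := n)) (y(j := t)) = monomial B \<beta> y * t ^ n" for \<beta> n
      proof -
        have "(\<Prod>i\<in>B. (y(j := t)) i ^ (\<beta>(j := n)) i) = (\<Prod>i\<in>B. y i ^ \<beta> i)"
          using insert(2) by (intro prod.cong) auto
        then show ?thesis
          using insert(1,2) by (simp add: monomial_def mult.commute)
      qed
      have "((\<lambda>\<alpha>. c \<alpha> * monomial (insert j B) \<alpha> (y(j := t))) has_sum 0) (multi_indices (insert j B))"
        by (rule insert(4)) (use y t in \<open>auto simp: cspace_def\<close>)
      then show ?thesis
        unfolding has_sum_reindex_bij_betw[OF bij, symmetric]
        by (simp add: m c'_def case_prod_unfold mult.assoc)
    qed
    \<comment> \<open>A nonzero value of \<open>t\<close> is needed in order to divide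
      \<open>t ^ n\<close> out of the summability of the inner series.\<close>
    define t0 :: complex where "t0 = of_real (r / 2)"
    have t0: "cmod t0 < r" "t0 \<noteq> 0"
      using assms(2) by (auto simp: t0_def)
    have s: "(\<lambda>\<beta>. c' n \<beta> * monomial B \<beta> y) summable_on multi_indices B" for n
    proof -
      have "(\<lambda>\<beta>. c' n \<beta> * monomial B \<beta> y * t0 ^ n) summable_on multi_indices B"
        using summable_on_SigmaD1[OF has_sum_imp_summable[OF sum[OF t0(1)]], of n] by simp
      then show ?thesis
        using t0(2) by (simp add: summable_on_cmult_left')
    qed
    define d where "d n = (\<Sum>\<^sub>\<infinity>\<beta>\<in>multi_indices B. c' n \<beta> * monomial B \<beta> y)" for n
    have d: "((\<lambda>\<beta>. c' n \<beta> * monomial B \<beta> y) has_sum d n) (multi_indices B)" for n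
      unfolding d_def by (rule has_sum_infsum[OF s])
    have "(\<lambda>n. d n * t ^ n) sums 0" if t: "cmod t < r" for t
    proof (rule has_sum_imp_sums, rule has_sum_SigmaD[OF sum[OF t]])
      show "((\<lambda>\<beta>. (case (n, \<beta>) of (n, \<beta>) \<Rightarrow> c' n \<beta> * monomial B \<beta> y * t ^ n)) has_sum d n * t ^ n)
          (multi_indices B)" for n
        using has_sum_cmult_left[OF d[of n]] by simp
    qed
    then have "d n = 0"
      by (rule power_series_coeff_eq_0[OF assms(2)])
    then show ?thesis using d[of n] by simp
  qed
  then have "c' (\<alpha> j) (\<alpha>(j := 0)) = 0"
    by (rule insert.IH[of "c' (\<alpha> j)"]) (use insert(5) in \<open>auto simp: multi_indices_def\<close>)
  then show ?case by (simp add: c'_def)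
qed

lemma series_coeffs_unique:
  assumes "finite A" "0 < r"
    and "\<And>x. x \<in> cspace A \<Longrightarrow> (\<And>i. i \<in> A \<Longrightarrow> cmod (x i) < r) \<Longrightarrow>
      ((\<lambda>\<alpha>. c \<alpha> * monomial A \<alpha> x) has_sum f x) (multi_indices A)"
    and "\<And>x. x \<in> cspace A \<Longrightarrow> (\<And>i. i \<in> A \<Longrightarrow> cmod (x i) < r) \<Longrightarrow>
      ((\<lambda>\<alpha>. d \<alpha> * monomial A \<alpha> x) has_sum f x) (multi_indices A)"
    and "\<alpha> \<in> multi_indices A"
  shows "c \<alpha> = d \<alpha>"
proof -
  have "c \<alpha> - d \<alpha> = 0"
  proof (rule coeff_eq_0_if_series_eq_0[OF assms(1,2) _ assms(5), of "\<lambda>\<alpha>. c \<alpha> - d \<alpha>"])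
    fix x assume "x \<in> cspace A" "\<And>i. i \<in> A \<Longrightarrow> cmod (x i) < r"
    from has_sum_add[OF assms(3)[OF this] has_sum_uminusI[OF assms(4)[OF this]]]
    show "((\<lambda>\<alpha>. (c \<alpha> - d \<alpha>) * monomial A \<alpha> x) has_sum 0) (multi_indices A)"
      by (simp add: left_diff_distrib)
  qed
  then show ?thesis by simp
qed

section \<open>The ring of polynomial functions on a coordinate space\<close>

lemma poly_funsE:
  assumes "f \<in> poly_funs A"
  obtains F c where "finite F" "F \<subseteq> multi_indices A" "\<forall>\<alpha>. \<alpha> \<notin> F \<longrightarrow> c \<alpha> = 0"
    "\<And>x. f x = (\<Sum>\<alpha>\<in>F. c \<alpha> * monomial A \<alpha> x)"
proof -
  obtain F c where "finite F" "F \<subseteq> multi_indices A"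
    and f: "f = (\<lambda>x. \<Sum>\<alpha>\<in>F. c \<alpha> * monomial A \<alpha> x)"
    using assms by (auto simp: poly_funs_def)
  then show thesis
    using that[of F "\<lambda>\<alpha>. if \<alpha> \<in> F then c \<alpha> else 0"] by simp
qed

lemma poly_funs_series:
  assumes "f \<in> poly_funs A"
  obtains F c where "finite F" "F \<subseteq> multi_indices A" "\<forall>\<alpha>. \<alpha> \<notin> F \<longrightarrow> c \<alpha> = 0"
    "\<And>x. f x = (\<Sum>\<alpha>\<in>F. c \<alpha> * monomial A \<alpha> x)"
    "\<And>x. ((\<lambda>\<alpha>. c \<alpha> * monomial A \<alpha> x) has_sum f x) (multi_indices A)"
proof -
  obtain F c where F: "finite F" "F \<subseteq> multi_indices A" "\<forall>\<alpha>. \<alpha> \<notin> F \<longrightarrow> c \<alpha> = 0"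
    "\<And>x. f x = (\<Sum>\<alpha>\<in>F. c \<alpha> * monomial A \<alpha> x)"
    by (rule poly_funsE[OF assms]) (rule that)
  have "((\<lambda>\<alpha>. c \<alpha> * monomial A \<alpha> x) has_sum f x) (multi_indices A)" for x
    by (rule has_sum_finite_neutralI[OF F(1,2)]) (use F(3,4) in auto)
  with F that show thesis by blast
qed

lemma poly_funs_monomial:
  assumes "\<alpha> \<in> multi_indices A"
  shows "(\<lambda>x. k * monomial A \<alpha> x) \<in> poly_funs A"
  unfolding poly_funs_def using assms by (intro CollectI exI[of _ "{\<alpha>}"] exI[of _ "\<lambda>_. k"]) auto

lemma poly_funs_const: "(\<lambda>x. k) \<in> poly_funs A"
  using poly_funs_monomial[of 0 A k] by simp

lemma poly_funs_add:
  assumes "f \<in> poly_funs A" "g \<in> poly_funs A"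
  shows "(\<lambda>x. f x + g x) \<in> poly_funs A"
proof -
  obtain F c where F: "finite F" "F \<subseteq> multi_indices A" "\<forall>\<alpha>. \<alpha> \<notin> F \<longrightarrow> c \<alpha> = 0"
    "\<And>x. f x = (\<Sum>\<alpha>\<in>F. c \<alpha> * monomial A \<alpha> x)"
    by (rule poly_funsE[OF assms(1)]) (rule that)
  obtain G d where G: "finite G" "G \<subseteq> multi_indices A" "\<forall>\<alpha>. \<alpha> \<notin> G \<longrightarrow> d \<alpha> = 0"
    "\<And>x. g x = (\<Sum>\<alpha>\<in>G. d \<alpha> * monomial A \<alpha> x)"
    by (rule poly_funsE[OF assms(2)]) (rule that)
  have "f x + g x = (\<Sum>\<alpha>\<in>F \<union> G. (c \<alpha> + d \<alpha>) * monomial A \<alpha> x)" for x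
  proof -
    have "f x = (\<Sum>\<alpha>\<in>F \<union> G. c \<alpha> * monomial A \<alpha> x)"
      unfolding F(4) using F(1,3) G(1) by (intro sum.mono_neutral_left) auto
    moreover have "g x = (\<Sum>\<alpha>\<in>F \<union> G. d \<alpha> * monomial A \<alpha> x)"
      unfolding G(4) using F(1) G(1,3) by (intro sum.mono_neutral_left) auto
    ultimately show ?thesis by (simp add: sum.distrib distrib_right)
  qed
  then show ?thesis
    unfolding poly_funs_def using F(1,2) G(1,2)
    by (intro CollectI exI[of _ "F \<union> G"] exI[of _ "\<lambda>\<alpha>. c \<alpha> + d \<alpha>"]) auto
qed

lemma poly_funs_sum:
  "(\<And>i. i \<in> N \<Longrightarrow> f i \<in> poly_funs A) \<Longrightarrow> (\<lambda>x. \<Sum>i\<in>N. f i x) \<in> poly_funs A"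
  by (induction N rule: infinite_finite_induct) (simp_all add: poly_funs_const poly_funs_add)

lemma poly_funs_mult:
  assumes "f \<in> poly_funs A" "g \<in> poly_funs A"
  shows "(\<lambda>x. f x * g x) \<in> poly_funs A"
proof -
  obtain F c where F: "finite F" "F \<subseteq> multi_indices A" "\<forall>\<alpha>. \<alpha> \<notin> F \<longrightarrow> c \<alpha> = 0"
    "\<And>x. f x = (\<Sum>\<alpha>\<in>F. c \<alpha> * monomial A \<alpha> x)"
    by (rule poly_funsE[OF assms(1)]) (rule that)
  obtain G d where G: "finite G" "G \<subseteq> multi_indices A" "\<forall>\<alpha>. \<alpha> \<notin> G \<longrightarrow> d \<alpha> = 0"
    "\<And>x. g x = (\<Sum>\<alpha>\<in>G. d \<alpha> * monomial A \<alpha> x)"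
    by (rule poly_funsE[OF assms(2)]) (rule that)
  have "(\<lambda>x. \<Sum>\<alpha>\<in>F. \<Sum>\<beta>\<in>G. (c \<alpha> * d \<beta>) * monomial A (\<alpha> + \<beta>) x) \<in> poly_funs A"
    using F(2) G(2) by (intro poly_funs_sum poly_funs_monomial multi_indices_add) auto
  then show ?thesis
    by (simp add: F(4) G(4) sum_product monomial_add mult_ac)
qed

lemma poly_funs_cmult: "f \<in> poly_funs A \<Longrightarrow> (\<lambda>x. k * f x) \<in> poly_funs A"
  by (rule poly_funs_mult[OF poly_funs_const])

lemma poly_funs_diff: "f \<in> poly_funs A \<Longrightarrow> g \<in> poly_funs A \<Longrightarrow> (\<lambda>x. f x - g x) \<in> poly_funs A"
  using poly_funs_add[of f A "\<lambda>x. - 1 * g x"] poly_funs_cmult[of g A "- 1"] by simp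

lemma poly_funs_power: "f \<in> poly_funs A \<Longrightarrow> (\<lambda>x. f x ^ n) \<in> poly_funs A"
  by (induction n) (simp_all add: poly_funs_const poly_funs_mult)

lemma poly_funs_prod:
  "(\<And>i. i \<in> N \<Longrightarrow> f i \<in> poly_funs A) \<Longrightarrow> (\<lambda>x. \<Prod>i\<in>N. f i x) \<in> poly_funs A"
  by (induction N rule: infinite_finite_induct) (simp_all add: poly_funs_const poly_funs_mult)

lemma monomial_unit:
  assumes "finite A" "i \<in> A"
  shows "monomial A (\<lambda>j. if j = i then 1 else 0) x = x i"
proof -
  have "monomial A (\<lambda>j. if j = i then 1 else 0) x = (\<Prod>j\<in>A. if j = i then x j else 1)"
    unfolding monomial_def by (rule prod.cong) auto
  then show ?thesis using assms by simp
qed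

lemma poly_funs_coordinate:
  assumes "finite A" "i \<in> A"
  shows "(\<lambda>x. x i) \<in> poly_funs A"
  using poly_funs_monomial[of "\<lambda>j. if j = i then 1 else 0" A 1] monomial_unit[OF assms] assms
  by (simp add: multi_indices_def)

lemma poly_funs_compose:
  assumes "f \<in> poly_funs B" "\<And>b. b \<in> B \<Longrightarrow> (\<lambda>x. G x b) \<in> poly_funs A"
  shows "(\<lambda>x. f (G x)) \<in> poly_funs A"
proof -
  obtain F c where F: "finite F" "F \<subseteq> multi_indices B" "\<forall>\<alpha>. \<alpha> \<notin> F \<longrightarrow> c \<alpha> = 0"
    "\<And>x. f x = (\<Sum>\<alpha>\<in>F. c \<alpha> * monomial B \<alpha> x)"
    by (rule poly_funsE[OF assms(1)]) (rule that)
  show ?thesis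
    unfolding F(4) monomial_def
    by (intro poly_funs_sum poly_funs_cmult poly_funs_prod poly_funs_power assms(2))
qed

lemma poly_funs_hol_at:
  assumes "finite A" "p \<in> cspace A" "f \<in> poly_funs A"
  shows "hol_at A p f"
proof -
  obtain F c where F: "finite F" "F \<subseteq> multi_indices A" "\<forall>\<alpha>. \<alpha> \<notin> F \<longrightarrow> c \<alpha> = 0"
    "\<And>x. f x = (\<Sum>\<alpha>\<in>F. c \<alpha> * monomial A \<alpha> x)"
    by (rule poly_funsE[OF assms(3)]) (rule that)
  have "hol_at A p (\<lambda>x. \<Sum>\<alpha>\<in>F. c \<alpha> * monomial A \<alpha> x)"
    unfolding monomial_def using assms(1,2) F(1)
    by (intro hol_at_sum hol_at_mult hol_at_const hol_at_prod hol_at_power hol_at_coordinate)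
  then show ?thesis by (simp add: F(4)[abs_def])
qed

text \<open>Polynomials in one variable whose coefficients are polynomial functions of a parameter
  \<open>z\<close>, which will be the base point of a line. Dividing such families is what produces
  a quotient that is polynomial in all variables.\<close>

definition poly_family :: "'i set \<Rightarrow> (('i \<Rightarrow> complex) \<Rightarrow> complex poly) \<Rightarrow> bool"
  where "poly_family A P \<longleftrightarrow> (\<forall>n. (\<lambda>z. coeff (P z) n) \<in> poly_funs A)"

lemma poly_family_const: "poly_family A (\<lambda>z. p)"
  by (simp add: poly_family_def poly_funs_const)

lemma poly_family_add:
  "poly_family A P \<Longrightarrow> poly_family A Q \<Longrightarrow> poly_family A (\<lambda>z. P z + Q z)"
  by (simp add: poly_family_def poly_funs_add)

lemma poly_family_diff:
  "poly_family A P \<Longrightarrow> poly_family A Q \<Longrightarrow> poly_family A (\<lambda>z. P z - Q z)"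
  by (simp add: poly_family_def poly_funs_diff)

lemma poly_family_mult:
  "poly_family A P \<Longrightarrow> poly_family A Q \<Longrightarrow> poly_family A (\<lambda>z. P z * Q z)"
  unfolding poly_family_def coeff_mult by (intro allI poly_funs_sum poly_funs_mult) blast+

lemma poly_family_power: "poly_family A P \<Longrightarrow> poly_family A (\<lambda>z. P z ^ n)"
  by (induction n) (simp_all add: poly_family_const poly_family_mult)

lemma poly_family_prod:
  "(\<And>i. i \<in> N \<Longrightarrow> poly_family A (P i)) \<Longrightarrow> poly_family A (\<lambda>z. \<Prod>i\<in>N. P i z)"
  by (induction N rule: infinite_finite_induct) (simp_all add: poly_family_const poly_family_mult)

lemma poly_family_sum:
  "(\<And>i. i \<in> N \<Longrightarrow> poly_family A (P i)) \<Longrightarrow> poly_family A (\<lambda>z. \<Sum>i\<in>N. P i z)"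
  by (induction N rule: infinite_finite_induct) (simp_all add: poly_family_const poly_family_add)

lemma poly_family_linear:
  assumes "finite A" "i \<in> A"
  shows "poly_family A (\<lambda>z. [:z i, b:])"
  unfolding poly_family_def
proof
  fix n
  show "(\<lambda>z. coeff [:z i, b:] n) \<in> poly_funs A"
    using poly_funs_coordinate[OF assms] by (cases n) (auto simp: coeff_pCons intro: poly_funs_const)
qed

lemma coeff_mult_top:
  fixes p q :: "'a :: comm_semiring_1 poly"
  assumes "degree p \<le> m" "degree q \<le> n"
  shows "coeff (p * q) (m + n) = coeff p m * coeff q n"
proof -
  have "coeff (p * q) (m + n) = (\<Sum>i\<le>m + n. coeff p i * coeff q (m + n - i))"
    by (simp add: coeff_mult)
  also have "\<dots> = (\<Sum>i\<in>{m}. coeff p i * coeff q (m + n - i))"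
  proof (rule sum.mono_neutral_right)
    show "\<forall>i\<in>{..m + n} - {m}. coeff p i * coeff q (m + n - i) = 0"
    proof
      fix i assume "i \<in> {..m + n} - {m}"
      then have "i \<le> m + n" "m < i \<or> n < m + n - i" by auto
      then show "coeff p i * coeff q (m + n - i) = 0"
        using assms coeff_eq_0[of p i] coeff_eq_0[of q "m + n - i"] by auto
    qed
  qed auto
  finally show ?thesis by simp
qed

lemma coeff_prod_top:
  fixes p :: "'b \<Rightarrow> 'a :: comm_semiring_1 poly"
  assumes "finite N" "\<And>i. i \<in> N \<Longrightarrow> degree (p i) \<le> m i"
  shows "degree (\<Prod>i\<in>N. p i) \<le> (\<Sum>i\<in>N. m i) \<and>
    coeff (\<Prod>i\<in>N. p i) (\<Sum>i\<in>N. m i) = (\<Prod>i\<in>N. coeff (p i) (m i))"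
  using assms
proof (induction N rule: finite_induct)
  case (insert i N)
  then have IH: "degree (\<Prod>i\<in>N. p i) \<le> (\<Sum>i\<in>N. m i)"
    "coeff (\<Prod>i\<in>N. p i) (\<Sum>i\<in>N. m i) = (\<Prod>i\<in>N. coeff (p i) (m i))"
    by auto
  have d: "degree (p i) \<le> m i"
    using insert.prems by simp
  have "degree (p i * (\<Prod>i\<in>N. p i)) \<le> m i + (\<Sum>i\<in>N. m i)"
    by (rule order_trans[OF degree_mult_le add_mono[OF d IH(1)]])
  then show ?case
    using insert.hyps IH(2) coeff_mult_top[OF d IH(1)] by simp
qed simp

lemma coeff_linear_power_top:
  fixes a b :: "'a :: comm_semiring_1"
  shows "degree ([:a, b:] ^ n) \<le> n \<and> coeff ([:a, b:] ^ n) n = b ^ n"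
  using coeff_prod_top[of "{..<n}" "\<lambda>_. [:a, b:]" "\<lambda>_. 1"] by simp

text \<open>A monomial restricted to the line through \<open>z\<close> in direction
  \<open>b\<close>, kept as a polynomial in the line parameter so that degrees and leading
  coefficients can be read off.\<close>

definition line_monomial ::
  "'i set \<Rightarrow> ('i \<Rightarrow> nat) \<Rightarrow> ('i \<Rightarrow> complex) \<Rightarrow> ('i \<Rightarrow> complex) \<Rightarrow> complex poly"
  where "line_monomial A \<alpha> b z = (\<Prod>i\<in>A. [:z i, b i:] ^ \<alpha> i)"

lemma poly_line_monomial: "poly (line_monomial A \<alpha> b z) t = monomial A \<alpha> (\<lambda>i. z i + t * b i)"
  by (simp add: line_monomial_def monomial_def poly_prod poly_power)

lemma line_monomial_top:
  assumes "finite A"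
  shows "degree (line_monomial A \<alpha> b z) \<le> mdeg A \<alpha>"
    and "coeff (line_monomial A \<alpha> b z) (mdeg A \<alpha>) = monomial A \<alpha> b"
  using coeff_prod_top[OF assms, of "\<lambda>i. [:z i, b i:] ^ \<alpha> i" \<alpha>]
    coeff_linear_power_top[of "z _" "b _"]
  by (simp_all add: line_monomial_def mdeg_def monomial_def)

lemma poly_family_line_sum:
  assumes "finite A"
  shows "poly_family A (\<lambda>z. \<Sum>\<alpha>\<in>F. [:c \<alpha>:] * line_monomial A \<alpha> b z)"
  unfolding line_monomial_def using assms
  by (intro poly_family_sum poly_family_mult poly_family_const poly_family_prod poly_family_power
      poly_family_linear)

lemma poly_line_sum:
  "poly (\<Sum>\<alpha>\<in>F. [:c \<alpha>:] * line_monomial A \<alpha> b z) t =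
    (\<Sum>\<alpha>\<in>F. c \<alpha> * monomial A \<alpha> (\<lambda>i. z i + t * b i))"
  by (simp add: poly_sum poly_line_monomial)

lemma poly_funs_line:
  assumes "finite A" "f \<in> poly_funs A"
  obtains P where "poly_family A P" "\<And>z t. poly (P z) t = f (\<lambda>i. z i + t * b i)"
proof -
  obtain F c where F: "finite F" "F \<subseteq> multi_indices A" "\<forall>\<alpha>. \<alpha> \<notin> F \<longrightarrow> c \<alpha> = 0"
    "\<And>x. f x = (\<Sum>\<alpha>\<in>F. c \<alpha> * monomial A \<alpha> x)"
    by (rule poly_funsE[OF assms(2)]) (rule that)
  show thesis
    by (rule that[OF poly_family_line_sum[OF assms(1), where F = F and c = c and b = b]]) (simp only: poly_line_sum F(4))
qed

text \<open>
  In a direction where the leading form of \<open>g\<close> does not vanish, the restrictions of \<open>g\<close> to the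
  parallel lines all have the same degree and the same leading coefficient.
\<close>

lemma poly_funs_line_monic:
  assumes "finite A" "g \<in> poly_funs A" "g x \<noteq> 0"
  obtains b P e \<gamma> where "b \<in> cspace A" "poly_family A P"
    "\<And>z t. poly (P z) t = g (\<lambda>i. z i + t * b i)"
    "\<gamma> \<noteq> 0" "\<And>z. degree (P z) = e" "\<And>z. coeff (P z) e = \<gamma>"
proof -
  obtain F c where F: "finite F" "F \<subseteq> multi_indices A" "\<forall>\<alpha>. \<alpha> \<notin> F \<longrightarrow> c \<alpha> = 0"
    "\<And>x. g x = (\<Sum>\<alpha>\<in>F. c \<alpha> * monomial A \<alpha> x)"
    by (rule poly_funsE[OF assms(2)]) (rule that)
  define N where "N = {\<alpha>\<in>F. c \<alpha> \<noteq> 0}"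
  have "N \<noteq> {}"
  proof
    assume "N = {}"
    then have "g x = 0" using F(4) by (simp add: N_def)
    with assms(3) show False by simp
  qed
  define e where "e = Max (mdeg A ` N)"
  have fin: "finite N" using F(1) by (simp add: N_def)
  then have "e \<in> mdeg A ` N"
    unfolding e_def using \<open>N \<noteq> {}\<close> by (intro Max_in) auto
  then obtain \<alpha>0 where \<alpha>0: "\<alpha>0 \<in> N" "mdeg A \<alpha>0 = e" by auto
  have le_e: "mdeg A \<alpha> \<le> e" if "\<alpha> \<in> N" for \<alpha>
    unfolding e_def using fin that by simp
  define T where "T = {\<alpha>\<in>N. mdeg A \<alpha> = e}"
  \<comment> \<open>The leading form of \<open>g\<close>. It will be the coefficient of index
    \<open>e\<close> on every line of direction \<open>b\<close>, whatever the base point.\<close>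
  define top where "top b = (\<Sum>\<alpha>\<in>T. c \<alpha> * monomial A \<alpha> b)" for b
  have T: "finite T" "T \<subseteq> multi_indices A"
    using finite_subset[OF _ fin, of T] F(2) by (auto simp: T_def N_def)
  have "\<exists>b\<in>cspace A. top b \<noteq> 0"
  proof (rule ccontr)
    assume *: "\<not> (\<exists>b\<in>cspace A. top b \<noteq> 0)"
    have "(if \<alpha>0 \<in> T then c \<alpha>0 else 0) = 0"
    proof (rule coeff_eq_0_if_series_eq_0[OF assms(1) zero_less_one])
      show "((\<lambda>\<alpha>. (if \<alpha> \<in> T then c \<alpha> else 0) * monomial A \<alpha> b) has_sum 0) (multi_indices A)"
        if "b \<in> cspace A" for b
      proof (rule has_sum_finite_neutralI[OF T])
        show "0 = (\<Sum>\<alpha>\<in>T. (if \<alpha> \<in> T then c \<alpha> else 0) * monomial A \<alpha> b)"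
          using * that by (simp add: top_def)
      qed auto
      show "\<alpha>0 \<in> multi_indices A" using \<alpha>0 F(2) by (auto simp: N_def)
    qed
    then show False using \<alpha>0 by (simp add: T_def N_def)
  qed
  then obtain b where b: "b \<in> cspace A" "top b \<noteq> 0" by blast
  define P where "P z = (\<Sum>\<alpha>\<in>N. [:c \<alpha>:] * line_monomial A \<alpha> b z)" for z
  have deg: "degree (P z) \<le> e" for z
    unfolding P_def
  proof (rule degree_sum_le[OF fin])
    fix \<alpha> assume "\<alpha> \<in> N"
    then have "degree (line_monomial A \<alpha> b z) \<le> e"
      by (intro order_trans[OF line_monomial_top(1)[OF assms(1)] le_e])
    then show "degree ([:c \<alpha>:] * line_monomial A \<alpha> b z) \<le> e"
      using degree_smult_le[of "c \<alpha>" "line_monomial A \<alpha> b z"] by simp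
  qed
  have coeff: "coeff (P z) e = top b" for z
  proof -
    have "coeff (P z) e = (\<Sum>\<alpha>\<in>N. c \<alpha> * coeff (line_monomial A \<alpha> b z) e)"
      by (simp add: P_def coeff_sum)
    also have "\<dots> = (\<Sum>\<alpha>\<in>T. c \<alpha> * coeff (line_monomial A \<alpha> b z) e)"
    proof (rule sum.mono_neutral_right[OF fin])
      show "\<forall>\<alpha>\<in>N - T. c \<alpha> * coeff (line_monomial A \<alpha> b z) e = 0"
      proof
        fix \<alpha> assume "\<alpha> \<in> N - T"
        then have "mdeg A \<alpha> < e"
          using le_e by (force simp: T_def)
        then show "c \<alpha> * coeff (line_monomial A \<alpha> b z) e = 0"
          using line_monomial_top(1)[OF assms(1), of \<alpha> b z] by (simp add: coeff_eq_0)
      qed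
    qed (auto simp: T_def)
    also have "\<dots> = top b"
      unfolding top_def using line_monomial_top(2)[OF assms(1)]
      by (intro sum.cong) (auto simp: T_def)
    finally show ?thesis .
  qed
  show thesis
  proof (rule that)
    show "b \<in> cspace A" "top b \<noteq> 0"
      by (fact b)+
    show "poly_family A P"
      unfolding P_def by (rule poly_family_line_sum[OF assms(1)])
    show "degree (P z) = e" for z
      using deg[of z] le_degree[of "P z" e] coeff[of z] b(2) by simp
    show "coeff (P z) e = top b" for z
      by (rule coeff)
    have "g x = (\<Sum>\<alpha>\<in>N. c \<alpha> * monomial A \<alpha> x)" for x
      unfolding F(4) N_def using F(1) by (intro sum.mono_neutral_right) auto
    then show "poly (P z) t = g (\<lambda>i. z i + t * b i)" for z t
      by (simp only: P_def poly_line_sum)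
  qed
qed

lemma cspace_line: "a \<in> cspace A \<Longrightarrow> b \<in> cspace A \<Longrightarrow> (\<lambda>i. a i + t * b i) \<in> cspace A"
  by (simp add: cspace_def)

text \<open>On the line joining \<open>a\<close> and \<open>b\<close> both factors become
  polynomials in one variable, where there are no zero divisors, and the first is nonzero at the
  parameter of \<open>a\<close>.\<close>

lemma poly_funs_mult_eq_0:
  assumes A: "finite A" and f: "f \<in> poly_funs A" and g: "g \<in> poly_funs A"
    and 0: "\<And>x. x \<in> cspace A \<Longrightarrow> f x * g x = 0"
    and "a \<in> cspace A" "f a \<noteq> 0" "b \<in> cspace A"
  shows "g b = 0"
proof -
  define d where "d i = b i - a i" for i
  have d: "d \<in> cspace A"
    using assms(5,7) by (simp add: d_def cspace_def)
  obtain P where "poly_family A P" and P: "\<And>z t. poly (P z) t = f (\<lambda>i. z i + t * d i)"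
    using poly_funs_line[OF A f, of d] by blast
  obtain Q where "poly_family A Q" and Q: "\<And>z t. poly (Q z) t = g (\<lambda>i. z i + t * d i)"
    using poly_funs_line[OF A g, of d] by blast
  have "poly (P a * Q a) t = 0" for t
    using 0 cspace_line[OF assms(5) d] by (simp add: P Q)
  then have "P a * Q a = 0"
    using poly_all_0_iff_0 by blast
  moreover have "P a \<noteq> 0"
    using P[of a 0] assms(6) by auto
  ultimately have "poly (Q a) 1 = 0" by simp
  then show ?thesis
    by (simp add: Q[of a 1] d_def)
qed

text \<open>Long division by polynomials with a constant leading coefficient \<gamma>: each step
  divides by \<gamma> only, so the coefficients of the quotient remain polynomial in
  \<open>z\<close>. The induction runs over an index \<open>D\<close>, uniform in \<open>z\<close>,
  from which on all coefficients of the dividends vanish.\<close>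

lemma poly_family_div:
  assumes G: "poly_family A G" "\<And>z. degree (G z) = e" "\<And>z. coeff (G z) e = \<gamma>" "\<gamma> \<noteq> 0"
    and F: "poly_family A F" "\<And>z n. D \<le> n \<Longrightarrow> coeff (F z) n = 0"
  shows "poly_family A (\<lambda>z. F z div G z)"
  using F
proof (induction D arbitrary: F)
  case 0
  then have "F z = 0" for z by (simp add: poly_eq_iff)
  then show ?case by (simp add: poly_family_const)
next
  case (Suc D)
  have G0: "G z \<noteq> 0" for z
    using G(3)[of z] G(4) by auto
  show ?case
  proof (cases "D < e")
    case True
    have "degree (F z) \<le> D" for z
      using Suc.prems(2)[of _ z] by (intro degree_le) auto
    then have "degree (F z) < degree (G z)" for z
      using True G(2) le_less_trans by metis
    then have "F z div G z = 0" for z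
      by (rule div_poly_less)
    then show ?thesis by (simp add: poly_family_const)
  next
    case False
    \<comment> \<open>The leading term of the quotient; subtracting \<open>m z * G z\<close> removes
      the coefficient of index \<open>D\<close> for all \<open>z\<close> simultaneously.\<close>
    define m where "m z = monom (coeff (F z) D / \<gamma>) (D - e)" for z
    have mf: "poly_family A m"
      unfolding poly_family_def
    proof
      fix n
      have "(\<lambda>z. inverse \<gamma> * coeff (F z) D) \<in> poly_funs A"
        using Suc.prems(1) by (intro poly_funs_cmult) (simp add: poly_family_def)
      then show "(\<lambda>z. coeff (m z) n) \<in> poly_funs A"
        by (cases "D - e = n") (simp_all add: m_def divide_inverse mult.commute poly_funs_const)
    qed
    define F' where "F' z = F z - m z * G z" for z
    have "poly_family A (\<lambda>z. F' z div G z)"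
    proof (rule Suc.IH)
      show "poly_family A F'"
        unfolding F'_def using Suc.prems(1) mf G(1) by (intro poly_family_diff poly_family_mult)
      fix z n assume n: "D \<le> n"
      have degm: "degree (m z) \<le> D - e"
        by (simp add: m_def degree_monom_le)
      show "coeff (F' z) n = 0"
      proof (cases "n = D")
        case True
        have "coeff (m z * G z) ((D - e) + e) = coeff (m z) (D - e) * coeff (G z) e"
          by (rule coeff_mult_top[OF degm]) (simp add: G(2))
        then show ?thesis
          using False True G(3,4) by (simp add: F'_def m_def)
      next
        case False
        have "degree (m z * G z) \<le> D"
          using degree_mult_le[of "m z" "G z"] degm G(2)[of z] \<open>\<not> D < e\<close> by simp
        then have "coeff (m z * G z) n = 0"
          using n False by (intro coeff_eq_0) simp
        then show ?thesis
          using Suc.prems(2)[of n z] n False by (simp add: F'_def)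
      qed
    qed
    moreover have "F z div G z = m z + F' z div G z" for z
    proof -
      have "F z = F' z + m z * G z" by (simp add: F'_def)
      then show ?thesis using G0[of z] by (metis div_mult_self1)
    qed
    ultimately show ?thesis
      using mf by (simp add: poly_family_add)
  qed
qed

text \<open>The rational root argument: once the greatest common divisor is cancelled, the reduced
  denominator divides a power of the reduced numerator and is coprime to it, so it is a
  unit.\<close>

lemma poly_dvd_if_integral:
  fixes F G :: "complex poly"
  assumes G: "G \<noteq> 0" and eq: "F ^ d + (\<Sum>i<d. a i * F ^ i * G ^ (d - i)) = 0"
  shows "G dvd F"
proof -
  define D where "D = gcd F G"
  have "D \<noteq> 0" using G by (simp add: D_def)
  obtain F' G' where FG: "F = F' * D" "G = G' * D" "coprime F' G'"
    using gcd_coprime_exists[of F G] \<open>D \<noteq> 0\<close> unfolding D_def by blast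
  have "D ^ d * (F' ^ d + (\<Sum>i<d. a i * F' ^ i * G' ^ (d - i))) =
      F ^ d + (\<Sum>i<d. a i * F ^ i * G ^ (d - i))"
  proof -
    have "D ^ d * (a i * F' ^ i * G' ^ (d - i)) = a i * F ^ i * G ^ (d - i)" if "i < d" for i
    proof -
      have "D ^ d = D ^ i * D ^ (d - i)"
        using that by (simp flip: power_add)
      then show ?thesis by (simp add: FG power_mult_distrib mult_ac)
    qed
    then have "(\<Sum>i<d. D ^ d * (a i * F' ^ i * G' ^ (d - i))) = (\<Sum>i<d. a i * F ^ i * G ^ (d - i))"
      by (intro sum.cong) auto
    then show ?thesis
      by (simp only: distrib_left sum_distrib_left) (simp add: FG(1) power_mult_distrib mult.commute)
  qed
  then have "F' ^ d + (\<Sum>i<d. a i * F' ^ i * G' ^ (d - i)) = 0"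
    using eq \<open>D \<noteq> 0\<close> by simp
  then have "F' ^ d = - (\<Sum>i<d. a i * F' ^ i * G' ^ (d - i))"
    by (simp add: eq_neg_iff_add_eq_0)
  \<comment> \<open>Here \<open>i < d\<close> gives \<open>d - i > 0\<close>, so every summand
    contains a factor \<open>G'\<close>.\<close>
  moreover have "G' dvd (\<Sum>i<d. a i * F' ^ i * G' ^ (d - i))"
    by (intro dvd_sum dvd_mult dvd_power) auto
  ultimately have "G' dvd F' ^ d" by simp
  moreover have "coprime G' (F' ^ d)"
    using FG(3) by (simp add: coprime_commute)
  ultimately have "is_unit G'"
    using coprime_absorb_left by blast
  then show ?thesis
    unfolding FG(1,2) by (rule mult_dvd_mono[OF unit_imp_dvd dvd_refl])
qed

text \<open>The new coordinate \<open>j\<close> is handled by a threshold: from the largest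
  \<open>j\<close>-value of a basis for the remaining coordinates onwards that basis suffices, and
  each of the finitely many lower values defines a slice with a basis of its own.\<close>

lemma dickson:
  fixes T :: "('a \<Rightarrow> nat) set"
  assumes "finite A"
  shows "\<exists>B\<subseteq>T. finite B \<and> (\<forall>t\<in>T. \<exists>b\<in>B. \<forall>i\<in>A. b i \<le> t i)"
  using assms
proof (induction A arbitrary: T rule: finite_induct)
  case empty
  show ?case
  proof (cases "T = {}")
    case False
    then obtain t where "t \<in> T" by blast
    then show ?thesis by (intro exI[of _ "{t}"]) auto
  qed auto
next
  case (insert j A)
  obtain B where B: "B \<subseteq> T" "finite B" "\<And>t. t \<in> T \<Longrightarrow> \<exists>b\<in>B. \<forall>i\<in>A. b i \<le> t i"
    using insert.IH[of T] by blast
  define N where "N = Max (insert 0 ((\<lambda>b. b j) ` B))"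
  have N: "b j \<le> N" if "b \<in> B" for b
    using B(2) that by (simp add: N_def)
  have "\<forall>n. \<exists>C\<subseteq>{t\<in>T. t j = n}. finite C \<and> (\<forall>t\<in>{t\<in>T. t j = n}. \<exists>b\<in>C. \<forall>i\<in>A. b i \<le> t i)"
    using insert.IH by blast
  from choice[OF this] obtain C where C0: "\<forall>n. C n \<subseteq> {t\<in>T. t j = n} \<and> finite (C n) \<and>
      (\<forall>t\<in>{t\<in>T. t j = n}. \<exists>b\<in>C n. \<forall>i\<in>A. b i \<le> t i)" ..
  then have C: "\<And>n. C n \<subseteq> {t\<in>T. t j = n}" "\<And>n. finite (C n)"
    "\<And>n t. t \<in> T \<Longrightarrow> t j = n \<Longrightarrow> \<exists>b\<in>C n. \<forall>i\<in>A. b i \<le> t i"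
    by simp_all
  have "\<exists>b\<in>B \<union> (\<Union>n<N. C n). \<forall>i\<in>insert j A. b i \<le> t i" if t: "t \<in> T" for t
  proof (cases "t j < N")
    case True
    obtain b where b: "b \<in> C (t j)" "\<forall>i\<in>A. b i \<le> t i"
      using C(3)[OF t refl] by blast
    then have "b j = t j"
      using C(1) by blast
    moreover have "b \<in> B \<union> (\<Union>n<N. C n)"
      using b(1) True by blast
    ultimately show ?thesis using b(2) by (intro bexI[of _ b]) auto
  next
    case False
    obtain b where b: "b \<in> B" "\<forall>i\<in>A. b i \<le> t i"
      using B(3)[OF t] by blast
    then have "b j \<le> t j"
      using N[OF b(1)] False by simp
    with b show ?thesis by auto
  qed
  moreover have "B \<union> (\<Union>n<N. C n) \<subseteq> T"
    using B(1) C(1) by blast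
  ultimately show ?case
    using B(2) C(2) by (intro exI[of _ "B \<union> (\<Union>n<N. C n)"]) auto
qed

text \<open>In a direction where the restrictions of \<open>g\<close> have a constant leading
  coefficient, \<open>g\<close> divides \<open>f\<close> on every parallel line, by the one-variable
  case. The quotient depends polynomially on the base point of the line, and its value at parameter
  0 is the required function.\<close>

lemma poly_funs_integrally_closed:
  assumes A: "finite A" and f: "f \<in> poly_funs A" and g: "g \<in> poly_funs A" "x0 \<in> cspace A" "g x0 \<noteq> 0"
    and a: "\<And>i. i < d \<Longrightarrow> a i \<in> poly_funs A"
    and eq: "\<And>x. x \<in> cspace A \<Longrightarrow> f x ^ d + (\<Sum>i<d. a i x * f x ^ i * g x ^ (d - i)) = 0"
  obtains h where "h \<in> poly_funs A" "\<And>x. x \<in> cspace A \<Longrightarrow> f x = h x * g x"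
proof (rule poly_funs_line_monic[where g = g and x = x0, OF A g(1,3)])
  fix b G e \<gamma>
  assume b: "b \<in> cspace A" and G: "poly_family A G"
    "\<And>z t. poly (G z) t = g (\<lambda>i. z i + t * b i)"
    "\<gamma> \<noteq> 0" "\<And>z. degree (G z) = e" "\<And>z. coeff (G z) e = \<gamma>"
  obtain F' c where F': "finite F'" "F' \<subseteq> multi_indices A" "\<forall>\<alpha>. \<alpha> \<notin> F' \<longrightarrow> c \<alpha> = 0"
    "\<And>x. f x = (\<Sum>\<alpha>\<in>F'. c \<alpha> * monomial A \<alpha> x)"
    by (rule poly_funsE[OF f]) (rule that)
  define F where "F z = (\<Sum>\<alpha>\<in>F'. [:c \<alpha>:] * line_monomial A \<alpha> b z)" for z
  have Ff: "poly_family A F" and Fp: "poly (F z) t = f (\<lambda>i. z i + t * b i)" for z t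
    unfolding F_def F'(4) by (rule poly_family_line_sum[OF A], rule poly_line_sum)
  \<comment> \<open>\<open>Suc\<close> places \<open>D\<close> strictly beyond every degree that
    occurs; 0 serves an empty \<open>F'\<close>.\<close>
  define D where "D = Suc (Max (insert 0 (mdeg A ` F')))"
  have FD: "coeff (F z) n = 0" if "D \<le> n" for z n
  proof -
    have "coeff ([:c \<alpha>:] * line_monomial A \<alpha> b z) n = 0" if "\<alpha> \<in> F'" for \<alpha>
    proof -
      have "mdeg A \<alpha> \<le> Max (insert 0 (mdeg A ` F'))"
        using F'(1) that by simp
      then have "degree (line_monomial A \<alpha> b z) < n"
        using line_monomial_top(1)[OF A, of \<alpha> b z] \<open>D \<le> n\<close> by (simp add: D_def)
      then show ?thesis by (simp add: coeff_eq_0)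
    qed
    then show ?thesis
      unfolding F_def coeff_sum by (intro sum.neutral) blast
  qed
  have "\<exists>P. \<forall>z t. poly (P z) t = a i (\<lambda>j. z j + t * b j)" if "i < d" for i
  proof (rule poly_funs_line[OF A a[OF that], of b])
    fix P assume "\<And>z t. poly (P z) t = a i (\<lambda>j. z j + t * b j)"
    then show ?thesis by (intro exI[of _ P] allI)
  qed
  then have "\<forall>i\<in>{..<d}. \<exists>P. \<forall>z t. poly (P z) t = a i (\<lambda>j. z j + t * b j)"
    by simp
  from bchoice[OF this] obtain P
    where P: "\<forall>i\<in>{..<d}. \<forall>z t. poly (P i z) t = a i (\<lambda>j. z j + t * b j)" ..
  define Q where "Q z = F z div G z" for z
  have Qf: "poly_family A Q"
    unfolding Q_def by (rule poly_family_div[OF G(1,4,5,3) Ff FD])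
  have eqz: "F z = Q z * G z" if z: "z \<in> cspace A" for z
  proof -
    have "poly (F z ^ d + (\<Sum>i<d. P i z * F z ^ i * G z ^ (d - i))) t = 0" for t
      using eq[OF cspace_line[OF z b, of t]]
      by (simp add: poly_sum poly_power Fp G(2) P)
    then have "F z ^ d + (\<Sum>i<d. P i z * F z ^ i * G z ^ (d - i)) = 0"
      using poly_all_0_iff_0 by blast
    moreover have "G z \<noteq> 0"
      using G(3,5) by (metis coeff_0)
    ultimately have "G z dvd F z"
      by (intro poly_dvd_if_integral)
    then show ?thesis by (simp add: Q_def)
  qed
  have "(\<lambda>z. coeff (Q z) 0) \<in> poly_funs A"
    using Qf by (simp add: poly_family_def)
  moreover have "f z = coeff (Q z) 0 * g z" if z: "z \<in> cspace A" for z
    using eqz[OF z] Fp[of z 0] G(2)[of z 0] by (simp add: poly_0_coeff_0 coeff_mult_0)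
  ultimately show thesis by (rule that)
qed

section \<open>Monomial maps and their toric images\<close>

text \<open>The setting of a map given by finitely many nonconstant monomials. Nonzero exponents
  send 0 to 0 and force the degree to grow, which keeps the fibres of \<open>total\<close>
  finite.\<close>

locale monomial_map =
  fixes A :: "'a set" and B :: "'b set" and e :: "'b \<Rightarrow> 'a \<Rightarrow> nat"
  assumes finite_A: "finite A" and finite_B: "finite B"
    and exponent: "b \<in> B \<Longrightarrow> e b \<in> multi_indices A"
    and exponent_nonzero: "b \<in> B \<Longrightarrow> e b \<noteq> 0"
begin

definition total :: "('b \<Rightarrow> nat) \<Rightarrow> 'a \<Rightarrow> nat"
  where "total a = (\<lambda>i. \<Sum>b\<in>B. a b * e b i)"

definition mmap :: "('a \<Rightarrow> complex) \<Rightarrow> 'b \<Rightarrow> complex"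
  where "mmap z = (\<lambda>b. if b \<in> B then monomial A (e b) z else 0)"

text \<open>The zero set of the toric ideal, given by all of its binomials at once; finitely many of
  them are extracted later. In this form each point is a multiplicative function on the semigroup of
  exponents.\<close>

definition variety :: "('b \<Rightarrow> complex) set"
  where "variety = {y\<in>cspace B. \<forall>a\<in>multi_indices B. \<forall>a'\<in>multi_indices B.
    total a = total a' \<longrightarrow> monomial B a y = monomial B a' y}"

definition semigroup :: "('a \<Rightarrow> nat) set"
  where "semigroup = total ` multi_indices B"

text \<open>A semigroup element may have several decompositions into generators; one is fixed, and
  on the variety the choice is irrelevant. Outside \<open>semigroup\<close> the value is
  unspecified.\<close>

definition section_of :: "('a \<Rightarrow> nat) \<Rightarrow> 'b \<Rightarrow> nat"
  where "section_of \<alpha> = (SOME a. a \<in> multi_indices B \<and> total a = \<alpha>)"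

definition source :: "'a germ_space"
  where "source = \<lparr>coords = A, pts = cspace A, base = 0\<rparr>"

definition target :: "'b germ_space"
  where "target = \<lparr>coords = B, pts = variety, base = 0\<rparr>"

lemma total_add: "total (a + a') = total a + total a'"
  by (simp add: total_def fun_eq_iff sum.distrib distrib_right)

lemma total_in: "total a \<in> multi_indices A"
  using exponent by (auto simp: total_def multi_indices_def)

lemma mdeg_total: "mdeg A (total a) = (\<Sum>b\<in>B. a b * mdeg A (e b))"
  by (simp add: mdeg_def total_def sum.swap[of _ B] sum_distrib_left)

lemma mdeg_exponent: "b \<in> B \<Longrightarrow> 1 \<le> mdeg A (e b)"
  using mdeg_eq_0_iff[OF finite_A exponent] exponent_nonzero by (metis less_one not_le)

lemma mdeg_le_total: "mdeg B a \<le> mdeg A (total a)"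
  unfolding mdeg_total unfolding mdeg_def[of B]
  by (rule sum_mono) (use mdeg_exponent in \<open>metis mult.right_neutral mult_le_mono2\<close>)

lemma monomial_mmap: "monomial B a (mmap z) = monomial A (total a) z"
proof -
  have "monomial B a (mmap z) = (\<Prod>b\<in>B. \<Prod>i\<in>A. z i ^ (a b * e b i))"
    by (simp add: monomial_def mmap_def prod_power_distrib power_mult[symmetric] mult.commute)
  also have "\<dots> = (\<Prod>i\<in>A. \<Prod>b\<in>B. z i ^ (a b * e b i))"
    by (rule prod.swap)
  also have "\<dots> = monomial A (total a) z"
    by (simp add: monomial_def total_def power_sum)
  finally show ?thesis .
qed

lemma mmap_in_variety: "mmap z \<in> variety"
  by (auto simp: variety_def monomial_mmap) (simp add: mmap_def cspace_def)

lemma mmap_0: "mmap 0 = 0"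
  using monomial_zero_arg[OF finite_A exponent exponent_nonzero] by (auto simp: mmap_def fun_eq_iff)

lemma zero_in_variety: "0 \<in> variety"
  using mmap_in_variety[of 0] by (simp add: mmap_0)

lemma variety_subset: "variety \<subseteq> cspace B"
  by (auto simp: variety_def)

lemma section_of:
  assumes "\<alpha> \<in> semigroup"
  shows "section_of \<alpha> \<in> multi_indices B" "total (section_of \<alpha>) = \<alpha>"
  using someI_ex[of "\<lambda>a. a \<in> multi_indices B \<and> total a = \<alpha>"] assms
  unfolding section_of_def semigroup_def by auto

lemma total_in_semigroup: "a \<in> multi_indices B \<Longrightarrow> total a \<in> semigroup"
  by (simp add: semigroup_def)

lemma semigroup_subset: "semigroup \<subseteq> multi_indices A"
  using total_in by (auto simp: semigroup_def)

lemma monomial_section: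
  assumes "y \<in> variety" "a \<in> multi_indices B"
  shows "monomial B (section_of (total a)) y = monomial B a y"
proof -
  have "section_of (total a) \<in> multi_indices B" "total (section_of (total a)) = total a"
    using section_of[OF total_in_semigroup[OF assms(2)]] by simp_all
  then show ?thesis using assms unfolding variety_def by blast
qed

lemma affine_source: "affine_germ source"
  using finite_A by (simp add: affine_germ_def source_def cspace_def)

lemma affine_target: "affine_germ target"
  using finite_B variety_subset zero_in_variety by (simp add: affine_germ_def target_def)

lemma zero_in_cspace [simp]: "0 \<in> cspace N"
  by (simp add: cspace_def)

text \<open>Each generator contributes at least 1 to the degree, so a decomposition of \<alpha> has
  at most \<open>mdeg A \<alpha>\<close> factors.\<close>

lemma finite_fibre: "finite {a\<in>multi_indices B. total a = \<alpha>}"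
proof -
  have "a b \<le> mdeg A \<alpha>" if "a \<in> multi_indices B" "total a = \<alpha>" "b \<in> B" for a b
  proof -
    have "a b \<le> mdeg B a"
      unfolding mdeg_def using finite_B that(3) by (intro member_le_sum) auto
    then show ?thesis using mdeg_le_total[of a] that(2) by simp
  qed
  then have "{a\<in>multi_indices B. total a = \<alpha>} \<subseteq>
      {f. \<forall>x. (x \<in> B \<longrightarrow> f x \<in> {..mdeg A \<alpha>}) \<and> (x \<notin> B \<longrightarrow> f x = 0)}"
    by (auto simp: multi_indices_def)
  moreover have "finite {f. \<forall>x. (x \<in> B \<longrightarrow> f x \<in> {..mdeg A \<alpha>}) \<and> (x \<notin> B \<longrightarrow> f x = 0)}"
    by (rule finite_set_of_finite_funs[OF finite_B]) simp
  ultimately show ?thesis by (rule finite_subset)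
qed

lemma mmap_polydisc:
  assumes "0 \<le> t" "t \<le> 1" "z \<in> polydisc A 0 t"
  shows "mmap z \<in> polydisc B 0 t"
proof -
  have "cmod (monomial A (e b) z) \<le> t" if "b \<in> B" for b
  proof -
    have "cmod (monomial A (e b) z) \<le> t ^ mdeg A (e b)"
      by (rule cmod_monomial_le) (use assms(3) in \<open>simp add: polydisc_def\<close>)
    also have "\<dots> \<le> t ^ 1"
      by (rule power_decreasing) (use assms mdeg_exponent[OF that] in auto)
    finally show ?thesis by simp
  qed
  then show ?thesis
    by (auto simp: polydisc_def mmap_def cspace_def)
qed

text \<open>
  On the variety a power series can be regrouped along the fibres of the total exponent; the regrouped
  coefficients are those of the pullback under the monomial map.
\<close>

lemma series_eq_0_on_variety:
  assumes r: "0 < r" and s: "0 < s"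
    and g: "\<And>y. y \<in> polydisc B 0 r \<Longrightarrow>
      ((\<lambda>a. c a * monomial B a y) has_sum g y) (multi_indices B)"
    and 0: "\<And>z. z \<in> polydisc A 0 s \<Longrightarrow> g (mmap z) = 0"
    and y: "y \<in> variety" "y \<in> polydisc B 0 r"
  shows "g y = 0"
proof -
  let ?fib = "\<lambda>\<alpha>. {a\<in>multi_indices B. total a = \<alpha>}"
  define C where "C \<alpha> = (\<Sum>a\<in>?fib \<alpha>. c a)" for \<alpha>
  have bij: "bij_betw snd (Sigma semigroup ?fib) (multi_indices B)"
    by (rule bij_betwI[where g = "\<lambda>a. (total a, a)"]) (auto simp: semigroup_def)
  have sum: "((\<lambda>\<alpha>. C \<alpha> * monomial B (section_of \<alpha>) y) has_sum g y) semigroup"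
    if y: "y \<in> variety" "y \<in> polydisc B 0 r" for y
  proof -
    have "((\<lambda>p. c (snd p) * monomial B (snd p) y) has_sum g y) (Sigma semigroup ?fib)"
      using g[OF y(2)] by (subst has_sum_reindex_bij_betw[OF bij])
    then show ?thesis
    proof (rule has_sum_SigmaD)
      fix \<alpha> assume "\<alpha> \<in> semigroup"
      have "monomial B (snd (\<alpha>, a)) y = monomial B (section_of \<alpha>) y" if "a \<in> ?fib \<alpha>" for a
        using monomial_section[OF y(1), of a] that by auto
      then have "C \<alpha> * monomial B (section_of \<alpha>) y =
          (\<Sum>a\<in>?fib \<alpha>. c (snd (\<alpha>, a)) * monomial B (snd (\<alpha>, a)) y)"
        unfolding C_def sum_distrib_right by (intro sum.cong) auto
      then show "((\<lambda>a. c (snd (\<alpha>, a)) * monomial B (snd (\<alpha>, a)) y) has_sum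
          C \<alpha> * monomial B (section_of \<alpha>) y) (?fib \<alpha>)"
        by (intro has_sum_finiteI finite_fibre)
    qed
  qed
  \<comment> \<open>\<open>t \<le> 1\<close> makes \<open>mmap\<close> send the polydisc of radius
    \<open>t\<close> into the one of the same radius; the other two bounds put these points where
    the series converges and where the pullback vanishes.\<close>
  define t where "t = min 1 (min r s)"
  have t: "0 < t" "t \<le> 1" "t \<le> r" "t \<le> s"
    using r s by (auto simp: t_def)
  have C0: "C \<alpha> = 0" if \<alpha>: "\<alpha> \<in> semigroup" for \<alpha>
  proof -
    have "(if \<alpha> \<in> semigroup then C \<alpha> else 0) = 0"
    proof (rule coeff_eq_0_if_series_eq_0[OF finite_A t(1)])
      show "\<alpha> \<in> multi_indices A"
        using \<alpha> semigroup_subset by blast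
      fix z assume "z \<in> cspace A" "\<And>i. i \<in> A \<Longrightarrow> cmod (z i) < t"
      then have z: "z \<in> polydisc A 0 t"
        by (simp add: polydisc_def less_imp_le)
      have "mmap z \<in> polydisc B 0 r"
        using mmap_polydisc[OF _ t(2) z] t(1) polydisc_mono[OF t(3), of B 0] by auto
      from sum[OF mmap_in_variety this]
      have "((\<lambda>\<alpha>. C \<alpha> * monomial B (section_of \<alpha>) (mmap z)) has_sum 0) semigroup"
        using 0[of z] z polydisc_mono[OF t(4), of A 0] by auto
      also have "?this \<longleftrightarrow> ((\<lambda>\<alpha>. (if \<alpha> \<in> semigroup then C \<alpha> else 0) * monomial A \<alpha> z) has_sum 0)
          (multi_indices A)"
        by (rule has_sum_cong_neutral)
          (use semigroup_subset section_of(2) in \<open>auto simp: monomial_mmap\<close>)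
      finally show "((\<lambda>\<alpha>. (if \<alpha> \<in> semigroup then C \<alpha> else 0) * monomial A \<alpha> z) has_sum 0)
          (multi_indices A)" .
    qed
    then show ?thesis using \<alpha> by simp
  qed
  have "((\<lambda>\<alpha>. C \<alpha> * monomial B (section_of \<alpha>) y) has_sum 0) semigroup"
    by (rule has_sum_0) (simp add: C0)
  then show ?thesis
    using sum[OF y] has_sum_unique by blast
qed

text \<open>Injectivity of pullback on germs. It does not rest on \<open>mmap\<close> being onto
  near the base point: regrouping gives the vanishing at every nearby point of the variety.\<close>

lemma hol_eq_0_on_target:
  assumes g: "hol_at B 0 g" and 0: "\<forall>\<^sub>F z in near source. g (mmap z) = 0"
  shows "\<forall>\<^sub>F y in near target. g y = 0"
proof -
  obtain r M where r: "0 < r" "series_bound B 0 r M g"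
    using g hol_at_iff_series_bound[OF finite_B zero_in_cspace] by blast
  obtain c where c: "\<forall>y\<in>polydisc B 0 r.
      ((\<lambda>a. c a * monomial B a (y - 0)) has_sum g y) (multi_indices B)"
    using r(2) unfolding series_bound_def by blast
  obtain s where s: "0 < s" "\<And>z. z \<in> polydisc A 0 s \<Longrightarrow> g (mmap z) = 0"
    using 0 unfolding eventually_near[OF affine_source] by (auto simp: source_def polydisc_def)
  have "g y = 0" if "y \<in> variety" "y \<in> polydisc B 0 r" for y
    by (rule series_eq_0_on_variety[where g = g and c = c, OF r(1) s(1) _ s(2) that]) (use c in auto)
  then show ?thesis
    unfolding eventually_near[OF affine_target] using r(1) by (auto simp: target_def)
qed

lemma poly_mmap: "f \<in> poly_funs B \<Longrightarrow> (\<lambda>z. f (mmap z)) \<in> poly_funs A"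
proof (erule poly_funs_compose)
  show "(\<lambda>z. mmap z b) \<in> poly_funs A" if "b \<in> B" for b
    using poly_funs_monomial[OF exponent[OF that], of 1] that by (simp add: mmap_def)
qed

lemma poly_eq_0_on_variety:
  assumes f: "f \<in> poly_funs B" and 0: "\<And>z. z \<in> cspace A \<Longrightarrow> f (mmap z) = 0"
    and y: "y \<in> variety"
  shows "f y = 0"
proof -
  obtain F c where F: "finite F" "F \<subseteq> multi_indices B" "\<forall>\<alpha>. \<alpha> \<notin> F \<longrightarrow> c \<alpha> = 0"
    "\<And>x. f x = (\<Sum>\<alpha>\<in>F. c \<alpha> * monomial B \<alpha> x)"
    "\<And>x. ((\<lambda>\<alpha>. c \<alpha> * monomial B \<alpha> x) has_sum f x) (multi_indices B)"
    by (rule poly_funs_series[OF f]) (rule that)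
  \<comment> \<open>A polynomial is its own series at every radius, so the radius may be taken large
    enough to reach \<open>y\<close>; this makes the local vanishing criterion a global one.\<close>
  define r where "r = 1 + (\<Sum>b\<in>B. cmod (y b))"
  have "0 < r"
    unfolding r_def by (intro add_pos_nonneg sum_nonneg) auto
  have "cmod (y b) \<le> r" if "b \<in> B" for b
    using member_le_sum[OF that _ finite_B, of "\<lambda>b. cmod (y b)"] by (simp add: r_def)
  then have "y \<in> polydisc B 0 r"
    using y variety_subset by (auto simp: polydisc_def)
  show ?thesis
    by (rule series_eq_0_on_variety[where g = f, OF \<open>0 < r\<close> zero_less_one F(5) _ y \<open>y \<in> polydisc B 0 r\<close>])
      (use 0 in \<open>auto simp: polydisc_def\<close>)
qed

text \<open>Each exponent in the support is lifted to its chosen decomposition, which gives a series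
  in the generators with the same coefficients. The lift lowers degrees by at most a constant factor
  \<open>D\<close>, and passing to the radius \<open>R ^ D\<close> compensates for this in the
  convergence.\<close>

lemma hol_factor:
  assumes r: "0 < r" and c: "(\<lambda>\<alpha>. cmod (c \<alpha>) * r ^ mdeg A \<alpha>) summable_on multi_indices A"
    and f: "\<And>z. z \<in> polydisc A 0 r \<Longrightarrow>
      ((\<lambda>\<alpha>. c \<alpha> * monomial A \<alpha> z) has_sum f z) (multi_indices A)"
    and supp: "\<And>\<alpha>. \<alpha> \<in> multi_indices A \<Longrightarrow> \<alpha> \<notin> semigroup \<Longrightarrow> c \<alpha> = 0"
  obtains g where "hol_at B 0 g" "\<forall>\<^sub>F z in near source. g (mmap z) = f z"
proof -
  \<comment> \<open>Only chosen decompositions carry a coefficient, so \<open>total\<close>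
    restricts to a bijection of \<open>N\<close> with \<open>semigroup\<close>.\<close>
  define N where "N = {a\<in>multi_indices B. a = section_of (total a)}"
  have bij: "bij_betw total N semigroup"
    by (rule bij_betwI[where g = section_of]) (auto simp: N_def total_in_semigroup section_of)
  define d where "d a = (if a \<in> N then c (total a) else 0)" for a
  \<comment> \<open>Exceeds the degree of every generator; \<open>Suc\<close> ensures
    \<open>D \<ge> 1\<close> and hence \<open>R ^ D \<le> R\<close>.\<close>
  define D where "D = Suc (\<Sum>b\<in>B. mdeg A (e b))"
  have D: "mdeg A (total a) \<le> D * mdeg B a" for a
  proof -
    have "mdeg A (total a) \<le> (\<Sum>b\<in>B. a b * D)"
      unfolding mdeg_total D_def
      using member_le_sum[OF _ _ finite_B, of _ "\<lambda>b. mdeg A (e b)"]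
      by (intro sum_mono mult_le_mono2) (simp add: le_SucI)
    then show ?thesis by (simp add: mdeg_def sum_distrib_left mult.commute)
  qed
  define R where "R = min 1 r"
  define \<rho> where "\<rho> = R ^ D"
  have R: "0 < R" "R \<le> 1" "R \<le> r" and \<rho>: "0 < \<rho>" "\<rho> \<le> R"
    using r power_decreasing[of 1 D R] by (auto simp: R_def \<rho>_def D_def)
  have le: "cmod (d a) * \<rho> ^ mdeg B a \<le> cmod (c (total a)) * r ^ mdeg A (total a)" for a
  proof -
    have "\<rho> ^ mdeg B a = R ^ (D * mdeg B a)"
      by (simp add: \<rho>_def power_mult)
    also have "\<dots> \<le> R ^ mdeg A (total a)"
      using D R by (intro power_decreasing) auto
    also have "\<dots> \<le> r ^ mdeg A (total a)"
      using R by (intro power_mono) auto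
    finally show ?thesis
      using r by (auto simp: d_def intro: mult_left_mono)
  qed
  have "(\<lambda>\<alpha>. cmod (c \<alpha>) * r ^ mdeg A \<alpha>) summable_on semigroup"
    by (rule summable_on_subset_banach[OF c semigroup_subset])
  then have sN: "(\<lambda>a. cmod (c (total a)) * r ^ mdeg A (total a)) summable_on N"
    by (subst summable_on_reindex_bij_betw[OF bij])
  have "(\<lambda>a. cmod (d a) * \<rho> ^ mdeg B a) summable_on N"
    by (rule summable_on_comparison_test[OF sN le]) (use \<rho> in simp)
  also have "?this \<longleftrightarrow> (\<lambda>a. cmod (d a) * \<rho> ^ mdeg B a) summable_on multi_indices B"
    by (rule summable_on_cong_neutral) (auto simp: d_def N_def)
  finally have sd: "(\<lambda>a. cmod (d a) * \<rho> ^ mdeg B a) summable_on multi_indices B" .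
  define g where "g y = (\<Sum>\<^sub>\<infinity>a\<in>multi_indices B. d a * monomial B a y)" for y
  have g: "((\<lambda>a. d a * monomial B a y) has_sum g y) (multi_indices B)"
    if "y \<in> polydisc B 0 \<rho>" for y
  proof -
    have "(\<lambda>a. norm (d a * monomial B a y)) summable_on multi_indices B"
      by (rule Infinite_Sum.abs_summable_on_comparison_test'[OF sd])
        (use series_term_le[OF that] in simp)
    then show ?thesis
      unfolding g_def by (rule has_sum_infsum[OF abs_summable_summable])
  qed
  have "series_bound B 0 \<rho> (\<Sum>\<^sub>\<infinity>a\<in>multi_indices B. cmod (d a) * \<rho> ^ mdeg B a) g"
    unfolding series_bound_def using sd g by (intro exI[of _ d]) simp
  then have "hol_at B 0 g"
    by (rule hol_atI[OF finite_B zero_in_cspace \<rho>(1)])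
  moreover have "g (mmap z) = f z" if z: "z \<in> polydisc A 0 \<rho>" for z
  proof -
    have "z \<in> polydisc A 0 r"
      using z polydisc_mono[of \<rho> r A 0] \<rho> R by auto
    from f[OF this] have "((\<lambda>\<alpha>. c \<alpha> * monomial A \<alpha> z) has_sum f z) (multi_indices A)" .
    also have "?this \<longleftrightarrow> ((\<lambda>\<alpha>. c \<alpha> * monomial A \<alpha> z) has_sum f z) semigroup"
      by (rule has_sum_cong_neutral) (use supp semigroup_subset in auto)
    also have "\<dots> \<longleftrightarrow> ((\<lambda>a. c (total a) * monomial A (total a) z) has_sum f z) N"
      by (rule has_sum_reindex_bij_betw[OF bij, symmetric])
    also have "\<dots> \<longleftrightarrow> ((\<lambda>a. d a * monomial B a (mmap z)) has_sum f z) (multi_indices B)"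
      by (rule has_sum_cong_neutral) (auto simp: d_def N_def monomial_mmap)
    finally have "((\<lambda>a. d a * monomial B a (mmap z)) has_sum f z) (multi_indices B)" .
    moreover have "mmap z \<in> polydisc B 0 \<rho>"
      using mmap_polydisc[OF _ _ z] \<rho> R by auto
    ultimately show ?thesis
      using g has_sum_unique by blast
  qed
  then have "\<forall>\<^sub>F z in near source. g (mmap z) = f z"
    unfolding eventually_near[OF affine_source] using \<rho>(1) by (auto simp: source_def)
  ultimately show thesis by (rule that)
qed

lemma poly_factor:
  assumes "finite F" "F \<subseteq> semigroup"
  obtains g where "g \<in> poly_funs B" "\<And>z. g (mmap z) = (\<Sum>\<alpha>\<in>F. c \<alpha> * monomial A \<alpha> z)"
proof -
  have "(\<lambda>y. \<Sum>\<alpha>\<in>F. c \<alpha> * monomial B (section_of \<alpha>) y) \<in> poly_funs B"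
    by (intro poly_funs_sum poly_funs_monomial section_of) (use assms(2) in blast)
  moreover have "(\<Sum>\<alpha>\<in>F. c \<alpha> * monomial B (section_of \<alpha>) (mmap z)) =
      (\<Sum>\<alpha>\<in>F. c \<alpha> * monomial A \<alpha> z)" for z
    using assms(2) section_of(2) by (intro sum.cong) (auto simp: monomial_mmap)
  ultimately show thesis by (rule that)
qed

lemma hol_map_mmap: "hol_map_germ source target mmap"
  unfolding hol_map_germ_def
proof (intro conjI ballI)
  fix b assume "b \<in> coords target"
  then have b: "b \<in> B" by (simp add: target_def)
  have "hol_at A 0 (monomial A (e b))"
    using poly_funs_hol_at[OF finite_A zero_in_cspace poly_funs_monomial[OF exponent[OF b], of 1]]
    by simp
  then show "\<exists>F. hol_at (coords source) (base source) F \<and> (\<forall>\<^sub>F x in near source. mmap x b = F x)"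
    using b by (intro exI[of _ "monomial A (e b)"]) (simp add: source_def mmap_def)
qed (simp_all add: source_def target_def mmap_0 mmap_in_variety)

lemma hol_map_target_unique:
  assumes Y: "affine_germ Y" and G: "hol_map_germ target Y G" "hol_map_germ target Y G'"
    and eq: "\<forall>\<^sub>F z in near source. G (mmap z) = G' (mmap z)"
  shows "\<forall>\<^sub>F y in near target. G y = G' y"
proof -
  note lim = hol_map_germ_filterlim[OF affine_source affine_target hol_map_mmap]
  have "\<forall>\<^sub>F y in near target. G y j = G' y j" if j: "j \<in> coords Y" for j
  proof -
    obtain g where g: "hol_at B 0 g" "\<forall>\<^sub>F y in near target. G y j = g y"
      using G(1) j by (auto simp: hol_map_germ_def target_def)
    obtain g' where g': "hol_at B 0 g'" "\<forall>\<^sub>F y in near target. G' y j = g' y"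
      using G(2) j by (auto simp: hol_map_germ_def target_def)
    have "\<forall>\<^sub>F y in near target. g y - g' y = 0"
    proof (rule hol_eq_0_on_target)
      show "hol_at B 0 (\<lambda>y. g y - g' y)"
        by (rule hol_at_diff[OF finite_B zero_in_cspace g(1) g'(1)])
      from eventually_compose_filterlim[OF g(2) lim] eventually_compose_filterlim[OF g'(2) lim] eq
      show "\<forall>\<^sub>F z in near source. g (mmap z) - g' (mmap z) = 0"
        by eventually_elim simp
    qed
    with g(2) g'(2) show ?thesis
      by eventually_elim simp
  qed
  then have "\<forall>\<^sub>F y in near target. \<forall>j\<in>coords Y. G y j = G' y j"
    using Y by (intro eventually_ball_finite) (auto simp: affine_germ_def)
  moreover have "\<forall>\<^sub>F y in near target. G y \<in> pts Y" "\<forall>\<^sub>F y in near target. G' y \<in> pts Y"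
    using G by (simp_all add: hol_map_germ_def)
  ultimately show ?thesis
  proof eventually_elim
    case (elim y)
    have "G y j = G' y j" for j
    proof (cases "j \<in> coords Y")
      case False
      moreover have "G y \<in> cspace (coords Y)" "G' y \<in> cspace (coords Y)"
        using elim(2,3) Y by (auto simp: affine_germ_def)
      ultimately show ?thesis by (simp add: cspace_def)
    qed (use elim(1) in blast)
    then show ?case by (simp add: fun_eq_iff)
  qed
qed

text \<open>The coordinate functions are lifted one by one, so at first the lift is only known to
  take values in the coordinate space of \<open>Y\<close>. Each local equation of \<open>Y\<close>,
  composed with the lift, vanishes after pullback to the source, and injectivity of pullback gives
  its vanishing on the toric side.\<close>

lemma hol_map_factor:
  assumes Y: "analytic_germ Y" and F: "hol_map_germ source Y F"
    and fac: "\<And>j. j \<in> coords Y \<Longrightarrow>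
      \<exists>g. hol_at B 0 g \<and> (\<forall>\<^sub>F z in near source. g (mmap z) = F z j)"
  obtains G where "hol_map_germ target Y G" "\<forall>\<^sub>F z in near source. G (mmap z) = F z"
proof -
  have aY: "affine_germ Y"
    using Y by (rule analytic_imp_affine_germ)
  note lim = hol_map_germ_filterlim[OF affine_source affine_target hol_map_mmap]
  have "\<forall>j\<in>coords Y. \<exists>g. hol_at B 0 g \<and> (\<forall>\<^sub>F z in near source. g (mmap z) = F z j)"
    using fac by blast
  from bchoice[OF this] obtain g where g: "\<forall>j\<in>coords Y. hol_at B 0 (g j) \<and>
      (\<forall>\<^sub>F z in near source. g j (mmap z) = F z j)" ..
  define G where "G y = (\<lambda>j. if j \<in> coords Y then g j y else 0)" for y
  have "\<forall>\<^sub>F z in near source. \<forall>j\<in>coords Y. g j (mmap z) = F z j"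
    using g aY by (intro eventually_ball_finite) (auto simp: affine_germ_def)
  moreover have FY: "\<forall>\<^sub>F z in near source. F z \<in> pts Y"
    using F by (simp add: hol_map_germ_def)
  ultimately have eq: "\<forall>\<^sub>F z in near source. G (mmap z) = F z"
  proof eventually_elim
    case (elim z)
    then show ?case
      using aY by (auto simp: G_def affine_germ_def cspace_def fun_eq_iff)
  qed
  have "G (mmap (base source)) = F (base source)"
    by (rule eventually_near_base[OF affine_source eq])
  then have base: "G 0 = base Y"
    using F by (simp add: source_def mmap_0 hol_map_germ_def)
  \<comment> \<open>The coordinate space itself as a target germ, so that holomorphic functions can
    be pulled back along \<open>G\<close> before \<open>G\<close> is known to map into
    \<open>Y\<close>.\<close>
  define Y' where "Y' = \<lparr>coords = coords Y, pts = cspace (coords Y), base = base Y\<rparr>"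
  have aY': "affine_germ Y'"
    using aY by (auto simp: affine_germ_def Y'_def)
  have GY': "hol_map_germ target Y' G"
    unfolding hol_map_germ_def
  proof (intro conjI ballI)
    show "\<forall>\<^sub>F y in near target. G y \<in> pts Y'"
      by (simp add: G_def Y'_def cspace_def)
    fix j assume "j \<in> coords Y'"
    then show "\<exists>F. hol_at (coords target) (base target) F \<and> (\<forall>\<^sub>F y in near target. G y j = F y)"
      using g by (intro exI[of _ "g j"]) (simp add: Y'_def target_def G_def)
  qed (simp add: target_def base Y'_def)
  obtain U Fs where U: "openin (top_of_set (cspace (coords Y))) U" "base Y \<in> U" "finite Fs"
    "\<And>f p. f \<in> Fs \<Longrightarrow> p \<in> U \<Longrightarrow> hol_at (coords Y) p f"
    "pts Y \<inter> U = {x\<in>U. \<forall>f\<in>Fs. f x = 0}"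
    using Y unfolding analytic_germ_def by blast
  have nU: "nbhd Y' U"
    using U(1,2) by (simp add: nbhd_def Y'_def)
  have GU: "\<forall>\<^sub>F y in near target. G y \<in> U"
    using eventually_compose_filterlim[OF eventually_near_nbhd[OF nU]
        hol_map_germ_filterlim[OF affine_target aY' GY']] .
  have "\<forall>\<^sub>F y in near target. f (G y) = 0" if f: "f \<in> Fs" for f
  proof -
    have "hol_at (coords Y') (base Y') f"
      using U(4)[OF f U(2)] by (simp add: Y'_def)
    then obtain h where h: "hol_at (coords target) (base target) h"
      "\<forall>\<^sub>F y in near target. f (G y) = h y"
      by (rule hol_map_germ_pullback[OF affine_target aY' GY'])
    have "\<forall>\<^sub>F y in near target. h y = 0"
    proof (rule hol_eq_0_on_target)
      show "hol_at B 0 h"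
        using h(1) by (simp add: target_def)
      from eventually_compose_filterlim[OF h(2) lim] eq FY
        eventually_compose_filterlim[OF GU lim]
      show "\<forall>\<^sub>F z in near source. h (mmap z) = 0"
      proof eventually_elim
        case (elim z)
        then have "F z \<in> pts Y \<inter> U" by simp
        then have "f (F z) = 0" using U(5) f by blast
        with elim show ?case by simp
      qed
    qed
    with h(2) show ?thesis by eventually_elim simp
  qed
  then have "\<forall>\<^sub>F y in near target. \<forall>f\<in>Fs. f (G y) = 0"
    using U(3) by (intro eventually_ball_finite) auto
  with GU have GY: "\<forall>\<^sub>F y in near target. G y \<in> pts Y"
    by eventually_elim (use U(5) in blast)
  have "hol_map_germ target Y G"
    using GY' GY by (simp add: hol_map_germ_def Y'_def)
  then show thesis using eq by (rule that)
qed

text \<open>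
  By Dickson's lemma the relations between the exponents are generated by finitely many of them.
\<close>

lemma variety_equations:
  obtains P where "finite P" "P \<subseteq> poly_funs B" "variety = {y\<in>cspace B. \<forall>f\<in>P. f y = 0}"
proof -
  \<comment> \<open>Pairs of decompositions are encoded as multi-indices on two copies of
    \<open>B\<close>, to which Dickson's lemma applies; the zero pair is excluded because splitting
    it off would not lower the degree.\<close>
  define T where "T = {case_sum a a' | a a'. a \<in> multi_indices B \<and> a' \<in> multi_indices B \<and>
    total a = total a' \<and> a + a' \<noteq> 0}"
  obtain K where K: "K \<subseteq> T" "finite K"
    "\<And>t. t \<in> T \<Longrightarrow> \<exists>b\<in>K. \<forall>i\<in>Inl ` B \<union> Inr ` B. b i \<le> t i"
    using dickson[of "Inl ` B \<union> Inr ` B" T] finite_B by blast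
  define bin where "bin k y = monomial B (k \<circ> Inl) y - monomial B (k \<circ> Inr) y" for k y
  have TI: "k \<circ> Inl \<in> multi_indices B \<and> k \<circ> Inr \<in> multi_indices B \<and>
      total (k \<circ> Inl) = total (k \<circ> Inr) \<and> (k \<circ> Inl) + (k \<circ> Inr) \<noteq> 0" if "k \<in> T" for k
  proof -
    have "case_sum a a' \<circ> Inl = a" "case_sum a a' \<circ> Inr = a'" for a a' :: "'b \<Rightarrow> nat"
      by (simp_all add: fun_eq_iff)
    then show ?thesis using that by (auto simp: T_def)
  qed
  \<comment> \<open>A pair that dominates a pair in \<open>K\<close> has the relation of the latter
    as a factor; the remaining differences again have equal totals and a smaller degree.\<close>
  have K_imp: "monomial B a y = monomial B a' y"
    if y: "\<forall>k\<in>K. bin k y = 0" and a: "a \<in> multi_indices B" "a' \<in> multi_indices B" "total a = total a'"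
    for y a a'
    using a
  proof (induction "mdeg B a + mdeg B a'" arbitrary: a a' rule: less_induct)
    case less
    show ?case
    proof (cases "a + a' = 0")
      case True
      then have "a = 0" "a' = 0" by (auto simp: fun_eq_iff)
      then show ?thesis by simp
    next
      case False
      then have "case_sum a a' \<in> T"
        using less.prems by (auto simp: T_def)
      then obtain k where k0: "k \<in> K" "\<forall>i\<in>Inl ` B \<union> Inr ` B. k i \<le> case_sum a a' i"
        using K(3) by blast
      have k: "k \<in> K" "\<And>b. b \<in> B \<Longrightarrow> k (Inl b) \<le> a b" "\<And>b. b \<in> B \<Longrightarrow> k (Inr b) \<le> a' b"
        using k0 by (auto dest: bspec[of _ _ "Inl _"] bspec[of _ _ "Inr _"])
      define b where "b = k \<circ> Inl"
      define b' where "b' = k \<circ> Inr"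
      have b: "b \<in> multi_indices B" "b' \<in> multi_indices B" "total b = total b'" "b + b' \<noteq> 0"
        using TI[of k] K(1) k(1) by (auto simp: b_def b'_def)
      have "b i \<le> a i" "b' i \<le> a' i" for i
        using k(2,3)[of i] b(1,2) by (cases "i \<in> B"; simp add: b_def b'_def multi_indices_def)+
      then have split: "a = (a - b) + b" "a' = (a' - b') + b'"
        by (simp_all add: fun_eq_iff)
      have "total (a - b) + total b = total (a' - b') + total b'"
        using less.prems(3) split by (metis total_add)
      then have tot: "total (a - b) = total (a' - b')"
        using b(3) by simp
      have "mdeg B b + mdeg B b' \<noteq> 0"
        using b(4) mdeg_eq_0_iff[OF finite_B multi_indices_add[OF b(1,2)]] by (simp add: mdeg_add)
      then have "mdeg B (a - b) + mdeg B (a' - b') < mdeg B a + mdeg B a'"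
        using mdeg_add[of B "a - b" b] mdeg_add[of B "a' - b'" b'] split by simp
      then have IH: "monomial B (a - b) y = monomial B (a' - b') y"
        using less.hyps tot less.prems(1,2) multi_indices_diff by blast
      have "monomial B b y = monomial B b' y"
        using y k(1) by (auto simp: bin_def b_def b'_def)
      then show ?thesis
        using IH split monomial_add by metis
    qed
  qed
  show thesis
  proof (rule that)
    show "finite (bin ` K)" using K(2) by simp
    show "bin ` K \<subseteq> poly_funs B"
    proof safe
      fix k assume "k \<in> K"
      then have "k \<circ> Inl \<in> multi_indices B" "k \<circ> Inr \<in> multi_indices B"
        using TI K(1) by blast+
      from poly_funs_diff[OF poly_funs_monomial[OF this(1), of 1] poly_funs_monomial[OF this(2), of 1]]
      show "bin k \<in> poly_funs B" by (simp add: bin_def[abs_def])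
    qed
    show "variety = {y\<in>cspace B. \<forall>f\<in>bin ` K. f y = 0}"
    proof (intro equalityI subsetI)
      fix y assume y: "y \<in> variety"
      have "bin k y = 0" if "k \<in> K" for k
        using y TI[of k] K(1) that by (auto simp: variety_def bin_def)
      then show "y \<in> {y\<in>cspace B. \<forall>f\<in>bin ` K. f y = 0}"
        using y variety_subset by auto
    next
      fix y assume "y \<in> {y\<in>cspace B. \<forall>f\<in>bin ` K. f y = 0}"
      then have "y \<in> cspace B" and y: "\<forall>k\<in>K. bin k y = 0" by simp_all
      then show "y \<in> variety"
        unfolding variety_def using K_imp[OF y] by (intro CollectI conjI ballI impI)
    qed
  qed
qed

lemma algebraic_variety: "algebraic_set B variety"
proof -
  obtain P where "finite P" "P \<subseteq> poly_funs B" "variety = {y\<in>cspace B. \<forall>f\<in>P. f y = 0}"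
    by (rule variety_equations)
  then show ?thesis unfolding algebraic_set_def by blast
qed

lemma analytic_target: "analytic_germ target"
proof -
  obtain P where P: "finite P" "P \<subseteq> poly_funs B" "variety = {y\<in>cspace B. \<forall>f\<in>P. f y = 0}"
    by (rule variety_equations)
  have "hol_at B p f" if "f \<in> P" "p \<in> cspace B" for f p
    using poly_funs_hol_at[OF finite_B that(2)] P(2) that(1) by blast
  then show ?thesis
    unfolding analytic_germ_def using affine_target P(1,3)
    by (auto simp: target_def affine_germ_def intro!: exI[of _ "cspace B"] exI[of _ P])
qed

text \<open>Irreducibility comes from affine space: a polynomial that vanishes on one component but
  not on the whole variety pulls back to a nonzero function, and two nonzero polynomial functions on
  affine space cannot have product 0.\<close>

lemma irreducible_variety: "irreducible_variety B variety"
  unfolding irreducible_variety_def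
proof (intro conjI allI impI)
  show "variety \<noteq> {}" using zero_in_variety by blast
  fix V1 V2
  assume *: "algebraic_set B V1 \<and> algebraic_set B V2 \<and> variety = V1 \<union> V2"
  obtain P1 where P1: "P1 \<subseteq> poly_funs B" "V1 = {y\<in>cspace B. \<forall>f\<in>P1. f y = 0}"
    using * by (auto simp: algebraic_set_def)
  obtain P2 where P2: "P2 \<subseteq> poly_funs B" "V2 = {y\<in>cspace B. \<forall>f\<in>P2. f y = 0}"
    using * by (auto simp: algebraic_set_def)
  show "variety = V1 \<or> variety = V2"
  proof (rule ccontr)
    assume "\<not> ?thesis"
    then obtain y1 y2 where y: "y1 \<in> variety" "y1 \<notin> V1" "y2 \<in> variety" "y2 \<notin> V2"
      using * by blast
    obtain f1 where f1: "f1 \<in> P1" "f1 y1 \<noteq> 0"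
      using y(1,2) P1(2) variety_subset by blast
    obtain f2 where f2: "f2 \<in> P2" "f2 y2 \<noteq> 0"
      using y(3,4) P2(2) variety_subset by blast
    have p: "f1 \<in> poly_funs B" "f2 \<in> poly_funs B"
      using f1 f2 P1 P2 by auto
    have 0: "f1 (mmap z) * f2 (mmap z) = 0" for z
    proof -
      have "mmap z \<in> V1 \<union> V2" using mmap_in_variety * by blast
      then show ?thesis using f1(1) f2(1) P1(2) P2(2) by auto
    qed
    obtain z1 where z1: "z1 \<in> cspace A" "f1 (mmap z1) \<noteq> 0"
      using poly_eq_0_on_variety[OF p(1) _ y(1)] f1(2) by blast
    have "f2 (mmap z) = 0" if "z \<in> cspace A" for z
      by (rule poly_funs_mult_eq_0[where f = "\<lambda>z. f1 (mmap z)" and g = "\<lambda>z. f2 (mmap z)" and a = z1,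
            OF finite_A poly_mmap[OF p(1)] poly_mmap[OF p(2)] 0 z1 that])
    then have "f2 y2 = 0"
      by (rule poly_eq_0_on_variety[where f = f2, OF p(2) _ y(3)])
    with f2(2) show False by simp
  qed
qed (use finite_B algebraic_variety in auto)

end

section \<open>Invariant series and normality\<close>

lemma monomial_scale: "monomial A \<alpha> (\<lambda>i. u i * z i) = monomial A \<alpha> u * monomial A \<alpha> z"
  by (simp add: monomial_def power_mult_distrib prod.distrib)

lemma monomial_exp:
  "monomial A \<alpha> (\<lambda>i. exp (of_real t * w i)) = exp (of_real t * (\<Sum>i\<in>A. of_nat (\<alpha> i) * w i))"
proof (cases "finite A")
  case True
  have "exp (of_real t * w i) ^ \<alpha> i = exp (of_real t * (of_nat (\<alpha> i) * w i))" for i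
    by (simp add: exp_of_nat_mult[symmetric] mult_ac)
  then show ?thesis
    using True by (simp add: monomial_def exp_sum sum_distrib_left)
qed (simp add: monomial_def)

text \<open>The bound is uniform for times in the unit interval, so the whole path of scalings, and
  not only its end point, stays in the larger polydisc; lying on one local leaf requires
  this.\<close>

lemma exp_scale_polydisc:
  assumes A: "finite A" and "0 < r"
  obtains d where "0 < d" "d \<le> r"
    "\<And>t z. 0 \<le> t \<Longrightarrow> t \<le> 1 \<Longrightarrow> z \<in> polydisc A 0 d \<Longrightarrow>
      (\<lambda>i. exp (of_real t * w i) * z i) \<in> polydisc A 0 r"
proof -
  \<comment> \<open>Dominates the modulus of every scaling factor, since
    \<open>t * Re (w i) \<le> \<bar>Re (w i)\<bar>\<close>; the added 1 gives
    \<open>K \<ge> 1\<close>, hence \<open>r / K \<le> r\<close>.\<close>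
  define K where "K = (\<Sum>i\<in>A. exp \<bar>Re (w i)\<bar>) + 1"
  have K: "exp \<bar>Re (w i)\<bar> \<le> K" if "i \<in> A" for i
    using member_le_sum[OF that _ A, of "\<lambda>i. exp \<bar>Re (w i)\<bar>"] by (simp add: K_def)
  have K1: "1 \<le> K"
    unfolding K_def using sum_nonneg[of A "\<lambda>i. exp \<bar>Re (w i)\<bar>"] by simp
  have d: "0 < r / K" "r / K \<le> r"
    using assms(2) K1 by (auto simp: field_simps)
  have "(\<lambda>i. exp (of_real t * w i) * z i) \<in> polydisc A 0 r"
    if t: "0 \<le> t" "t \<le> 1" and z: "z \<in> polydisc A 0 (r / K)" for t z
  proof -
    have "cmod (exp (of_real t * w i) * z i) \<le> r" if i: "i \<in> A" for i
    proof -
      have "t * Re (w i) \<le> t * \<bar>Re (w i)\<bar>"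
        using t by (intro mult_left_mono) auto
      also have "\<dots> \<le> 1 * \<bar>Re (w i)\<bar>"
        using t by (intro mult_right_mono) auto
      finally have "exp (t * Re (w i)) \<le> K"
        using K[OF i] by (simp add: order_trans[OF _ K[OF i]])
      moreover have "cmod (z i) \<le> r / K"
        using z i by (simp add: polydisc_def)
      ultimately have "exp (t * Re (w i)) * cmod (z i) \<le> K * (r / K)"
        using K1 by (intro mult_mono) auto
      then show ?thesis
        using K1 by (simp add: norm_mult norm_exp_eq_Re)
    qed
    then show ?thesis using z by (simp add: polydisc_def cspace_def)
  qed
  then show thesis by (rule that[OF d])
qed

text \<open>The scaling multiplies the coefficient at \<alpha> by the exponential of
  \<open>t\<close> times the weight of \<alpha>; by uniqueness of coefficients this factor is 1
  wherever the coefficient is nonzero.\<close>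

lemma invariant_series_support:
  assumes A: "finite A" and r: "0 < r" and \<epsilon>: "0 < \<epsilon>"
    and f: "\<And>z. z \<in> polydisc A 0 r \<Longrightarrow>
      ((\<lambda>\<alpha>. c \<alpha> * monomial A \<alpha> z) has_sum f z) (multi_indices A)"
    and \<delta>: "0 < \<delta>" "\<delta> \<le> r"
    and inv: "\<And>t z. 0 < t \<Longrightarrow> t \<le> \<epsilon> \<Longrightarrow> z \<in> polydisc A 0 \<delta> \<Longrightarrow>
      (\<lambda>i. exp (of_real t * w i) * z i) \<in> polydisc A 0 r \<and>
      f (\<lambda>i. exp (of_real t * w i) * z i) = f z"
    and \<alpha>: "\<alpha> \<in> multi_indices A" "(\<Sum>i\<in>A. of_nat (\<alpha> i) * w i) \<noteq> 0"
  shows "c \<alpha> = 0"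
proof -
  define \<mu> where "\<mu> \<beta> = (\<Sum>i\<in>A. of_nat (\<beta> i) * w i)" for \<beta>
  \<comment> \<open>With this \<open>t\<close> the exponent is nonzero of modulus at most 1, below
    the period 2 pi of the exponential, so its exponential differs from 1.\<close>
  define t where "t = min \<epsilon> (1 / cmod (\<mu> \<alpha>))"
  have \<mu>0: "\<mu> \<alpha> \<noteq> 0" using \<alpha>(2) by (simp add: \<mu>_def)
  have t: "0 < t" "t \<le> \<epsilon>" "t \<le> 1 / cmod (\<mu> \<alpha>)"
    using \<epsilon> \<mu>0 by (auto simp: t_def)
  have "c \<alpha> * exp (of_real t * \<mu> \<alpha>) = c \<alpha>"
  proof (rule series_coeffs_unique[OF A \<delta>(1) _ _ \<alpha>(1), where f = f])
    fix z assume "z \<in> cspace A" "\<And>i. i \<in> A \<Longrightarrow> cmod (z i) < \<delta>"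
    then have z: "z \<in> polydisc A 0 \<delta>"
      by (simp add: polydisc_def less_imp_le)
    then show "((\<lambda>\<alpha>. c \<alpha> * monomial A \<alpha> z) has_sum f z) (multi_indices A)"
      using f polydisc_mono[OF \<delta>(2), of A 0] by blast
    from f[of "\<lambda>i. exp (of_real t * w i) * z i"] inv[OF t(1,2) z]
    show "((\<lambda>\<beta>. c \<beta> * exp (of_real t * \<mu> \<beta>) * monomial A \<beta> z) has_sum f z) (multi_indices A)"
      by (simp add: monomial_scale monomial_exp \<mu>_def mult.assoc)
  qed
  moreover have "exp (of_real t * \<mu> \<alpha>) \<noteq> 1"
  proof
    assume "exp (of_real t * \<mu> \<alpha>) = 1"
    then obtain n :: int where n: "Re (of_real t * \<mu> \<alpha>) = 0" "Im (of_real t * \<mu> \<alpha>) = of_int (2 * n) * pi"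
      unfolding exp_eq_1 by auto
    have "cmod (of_real t * \<mu> \<alpha>) \<le> 1"
      using t(1,3) \<mu>0 by (simp add: norm_mult field_simps)
    then have "\<bar>Im (of_real t * \<mu> \<alpha>)\<bar> \<le> 1"
      using abs_Im_le_cmod order_trans by blast
    then have le: "\<bar>real_of_int n\<bar> * (2 * pi) \<le> 1"
      unfolding n(2) by (simp add: abs_mult)
    have "n = 0"
    proof (rule ccontr)
      assume "n \<noteq> 0"
      then have "1 \<le> \<bar>real_of_int n\<bar>" by linarith
      then have "1 * (2 * pi) \<le> \<bar>real_of_int n\<bar> * (2 * pi)"
        by (intro mult_right_mono) auto
      then show False using le pi_gt3 by linarith
    qed
    then have "of_real t * \<mu> \<alpha> = 0"
      using n by (simp add: complex_eq_iff)
    then show False using t(1) \<mu>0 by simp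
  qed
  ultimately show ?thesis by simp
qed

context monomial_map
begin

text \<open>An integral quotient of functions on the variety pulls back to a polynomial
  \<open>h\<close>, as affine space is integrally closed. Since \<open>f\<close> and
  \<open>g\<close> pull back to functions invariant under the scalings, so is \<open>h\<close>, and
  the saturation \<open>sat\<close> turns invariance into factorization through
  \<open>mmap\<close>.\<close>

lemma normal_variety:
  fixes W :: "('a \<Rightarrow> complex) set"
  assumes sat: "semigroup = {\<alpha>\<in>multi_indices A. \<forall>w\<in>W. (\<Sum>i\<in>A. of_nat (\<alpha> i) * w i) = 0}"
  shows "normal_variety B variety"
  unfolding normal_variety_def
proof (intro conjI ballI allI impI irreducible_variety; (elim conjE)?)
  fix f g :: "('b \<Rightarrow> complex) \<Rightarrow> complex" and d :: nat and a
  assume f: "f \<in> poly_funs B" and g: "g \<in> poly_funs B" "\<exists>x\<in>variety. g x \<noteq> 0"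
    and a: "\<forall>i<d. a i \<in> poly_funs B"
    and eq: "\<forall>x\<in>variety. f x ^ d + (\<Sum>i<d. a i x * f x ^ i * g x ^ (d - i)) = 0"
  obtain x0 where x0: "x0 \<in> cspace A" "g (mmap x0) \<noteq> 0"
    using g(2) poly_eq_0_on_variety[OF g(1)] by blast
  have "\<exists>h\<in>poly_funs A. \<forall>z\<in>cspace A. f (mmap z) = h z * g (mmap z)"
  proof (rule poly_funs_integrally_closed[where g = "\<lambda>z. g (mmap z)" and f = "\<lambda>z. f (mmap z)"
        and a = "\<lambda>i z. a i (mmap z)" and d = d, OF finite_A poly_mmap[OF f] poly_mmap[OF g(1)] x0])
    show "(\<lambda>z. a i (mmap z)) \<in> poly_funs A" if "i < d" for i
      using a that by (intro poly_mmap) simp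
    show "f (mmap z) ^ d + (\<Sum>i<d. a i (mmap z) * f (mmap z) ^ i * g (mmap z) ^ (d - i)) = 0" for z
      using eq mmap_in_variety by blast
    fix h assume "h \<in> poly_funs A" "\<And>z. z \<in> cspace A \<Longrightarrow> f (mmap z) = h z * g (mmap z)"
    then show ?thesis by (intro bexI[of _ h]) auto
  qed
  then obtain h where h: "h \<in> poly_funs A" "\<And>z. z \<in> cspace A \<Longrightarrow> f (mmap z) = h z * g (mmap z)"
    by metis
  obtain F c where F: "finite F" "F \<subseteq> multi_indices A" "\<forall>\<alpha>. \<alpha> \<notin> F \<longrightarrow> c \<alpha> = 0"
    "\<And>x. h x = (\<Sum>\<alpha>\<in>F. c \<alpha> * monomial A \<alpha> x)"
    "\<And>x. ((\<lambda>\<alpha>. c \<alpha> * monomial A \<alpha> x) has_sum h x) (multi_indices A)"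
    by (rule poly_funs_series[OF h(1)]) (rule that)
  have c0: "c \<alpha> = 0" if \<alpha>: "\<alpha> \<in> multi_indices A" "\<alpha> \<notin> semigroup" for \<alpha>
  proof -
    obtain w where w: "w \<in> W" "(\<Sum>i\<in>A. of_nat (\<alpha> i) * w i) \<noteq> 0"
      using \<alpha> sat by blast
    define act where "act t z = (\<lambda>i. exp (of_real t * w i) * z i)" for t :: real and z
    have act_mmap: "mmap (act t z) = mmap z" for t z
    proof -
      have "monomial A (e b) (act t z) = monomial A (e b) z" if "b \<in> B" for b
      proof -
        \<comment> \<open>Each generating exponent is its own one-term decomposition, hence lies in
          the semigroup and is annihilated by \<open>w\<close>.\<close>
        have "total (\<lambda>c. if c = b then 1 else 0) = e b"
          using finite_B that by (simp add: total_def fun_eq_iff if_distrib[of "\<lambda>x. x * _"] cong: if_cong)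
        moreover have "(\<lambda>c. if c = b then 1 else 0) \<in> multi_indices B"
          using that by (auto simp: multi_indices_def)
        ultimately have "e b \<in> semigroup"
          unfolding semigroup_def by (metis imageI)
        then have "(\<Sum>i\<in>A. of_nat (e b i) * w i) = 0"
          using sat w(1) by blast
        then show ?thesis
          by (simp add: act_def monomial_scale monomial_exp)
      qed
      then show ?thesis by (simp add: mmap_def fun_eq_iff)
    qed
    have act_in: "act t z \<in> cspace A" if "z \<in> cspace A" for t z
      using that by (simp add: act_def cspace_def)
    have inv: "h (act t z) = h z" if z: "z \<in> cspace A" for t z
    proof -
      have "(\<lambda>z. h (act t z)) \<in> poly_funs A"
        by (rule poly_funs_compose[OF h(1)])
          (use finite_A in \<open>auto simp: act_def intro: poly_funs_cmult poly_funs_coordinate\<close>)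
      then have p: "(\<lambda>z. h (act t z) - h z) \<in> poly_funs A"
        by (rule poly_funs_diff[OF _ h(1)])
      \<comment> \<open>Invariance of \<open>h\<close> is visible at first only after multiplication
        by the invariant function \<open>g\<close>, which is then cancelled because polynomial
        functions have no zero divisors.\<close>
      have 0: "g (mmap z) * (h (act t z) - h z) = 0" if "z \<in> cspace A" for z
        using h(2)[OF that] h(2)[OF act_in[OF that], of t] by (auto simp: act_mmap algebra_simps)
      have "h (act t z) - h z = 0"
        by (rule poly_funs_mult_eq_0[where f = "\<lambda>z. g (mmap z)" and g = "\<lambda>z. h (act t z) - h z"
              and a = x0, OF finite_A poly_mmap[OF g(1)] p 0 x0 z])
      then show ?thesis by simp
    qed
    obtain d where d: "0 < d" "d \<le> 1"
      "\<And>t z. 0 \<le> t \<Longrightarrow> t \<le> 1 \<Longrightarrow> z \<in> polydisc A 0 d \<Longrightarrow>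
        (\<lambda>i. exp (of_real t * w i) * z i) \<in> polydisc A 0 1"
      by (rule exp_scale_polydisc[OF finite_A zero_less_one]) (rule that)
    show ?thesis
    proof (rule invariant_series_support[OF finite_A zero_less_one zero_less_one F(5) d(1,2) _ \<alpha>(1) w(2)])
      fix t :: real and z assume t: "0 < t" "t \<le> 1" and z: "z \<in> polydisc A 0 d"
      then have "(\<lambda>i. exp (of_real t * w i) * z i) \<in> polydisc A 0 1"
        by (intro d(3)) auto
      moreover have "h (\<lambda>i. exp (of_real t * w i) * z i) = h z"
        using inv[of z t] z by (simp add: act_def polydisc_def)
      ultimately show "(\<lambda>i. exp (of_real t * w i) * z i) \<in> polydisc A 0 1 \<and>
          h (\<lambda>i. exp (of_real t * w i) * z i) = h z" ..
    qed
  qed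
  define N where "N = {\<alpha>\<in>F. c \<alpha> \<noteq> 0}"
  have "finite N" "N \<subseteq> semigroup"
    using F(1,2) c0 by (auto simp: N_def)
  then obtain k where k: "k \<in> poly_funs B" "\<And>z. k (mmap z) = (\<Sum>\<alpha>\<in>N. c \<alpha> * monomial A \<alpha> z)"
    by (rule poly_factor[where c = c]) (rule that)
  have kh: "k (mmap z) = h z" for z
    unfolding k(2) F(4) N_def using F(1) by (intro sum.mono_neutral_left) auto
  have "f x - k x * g x = 0" if x: "x \<in> variety" for x
  proof (rule poly_eq_0_on_variety[where f = "\<lambda>x. f x - k x * g x", OF _ _ x])
    show "(\<lambda>x. f x - k x * g x) \<in> poly_funs B"
      by (intro poly_funs_diff poly_funs_mult f g(1) k(1))
  qed (simp add: kh h(2))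
  then show "\<exists>h\<in>poly_funs B. \<forall>x\<in>variety. f x = h x * g x"
    using k(1) by (intro bexI[of _ k]) auto
qed

end

section \<open>The torus of a monomial map\<close>

text \<open>A basis over the integers, given as a sequence of length \<open>l\<close> so that it can
  index the coordinates of a torus.\<close>

definition subgroup_basis :: "('a \<Rightarrow> int) set \<Rightarrow> nat \<Rightarrow> (nat \<Rightarrow> 'a \<Rightarrow> int) \<Rightarrow> bool"
  where "subgroup_basis L l \<beta> \<longleftrightarrow>
    (\<forall>k<l. \<beta> k \<in> L) \<and> (\<forall>x\<in>L. \<exists>n. x = (\<lambda>i. \<Sum>k<l. n k * \<beta> k i)) \<and>
    (\<forall>n. (\<forall>i. (\<Sum>k<l. n k * \<beta> k i) = 0) \<longrightarrow> (\<forall>k<l. n k = 0))"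

text \<open>The values at one coordinate \<open>j\<close> form a cyclic group; an element with the
  least positive value is adjoined to a basis of the elements vanishing at \<open>j\<close>.\<close>

lemma ex_subgroup_basis:
  fixes L :: "('a \<Rightarrow> int) set"
  assumes "finite A" and "\<And>x i. x \<in> L \<Longrightarrow> i \<notin> A \<Longrightarrow> x i = 0"
    and "(\<lambda>_. 0) \<in> L" and "\<And>x y. x \<in> L \<Longrightarrow> y \<in> L \<Longrightarrow> (\<lambda>i. x i - y i) \<in> L"
  shows "\<exists>l \<beta>. subgroup_basis L l \<beta>"
  using assms
proof (induction A arbitrary: L rule: finite_induct)
  case empty
  then have "x = (\<lambda>_. 0)" if "x \<in> L" for x
    using that by (auto simp: fun_eq_iff)
  then show ?case
    by (intro exI[of _ 0] exI) (auto simp: subgroup_basis_def)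
next
  case (insert j A)
  have diff: "(\<lambda>i. x i - y i) \<in> L" if "x \<in> L" "y \<in> L" for x y
    using insert.prems(3)[OF that] .
  have neg: "(\<lambda>i. - x i) \<in> L" if "x \<in> L" for x
    using diff[OF insert.prems(2) that] by simp
  have add: "(\<lambda>i. x i + y i) \<in> L" if "x \<in> L" "y \<in> L" for x y
    using diff[OF that(1) neg[OF that(2)]] by simp
  have nat_mult: "(\<lambda>i. int n * x i) \<in> L" if "x \<in> L" for x n
  proof (induction n)
    case (Suc n)
    show ?case using add[OF that Suc] by (simp add: distrib_right)
  qed (use insert.prems(2) in simp)
  have mult: "(\<lambda>i. m * x i) \<in> L" if "x \<in> L" for x m
  proof (cases "0 \<le> m")
    case True
    then show ?thesis using nat_mult[OF that, of "nat m"] by simp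
  next
    case False
    then show ?thesis using neg[OF nat_mult[OF that, of "nat (- m)"]] by simp
  qed
  define L0 where "L0 = {x\<in>L. x j = 0}"
  have "\<exists>l \<beta>. subgroup_basis L0 l \<beta>"
  proof (rule insert.IH)
    show "x i = 0" if "x \<in> L0" "i \<notin> A" for x i
      using that insert.prems(1)[of x i] by (cases "i = j") (auto simp: L0_def)
  qed (use insert.prems(2) diff in \<open>auto simp: L0_def\<close>)
  then obtain l \<beta> where lb: "subgroup_basis L0 l \<beta>" by blast
  have \<beta>: "\<And>k. k < l \<Longrightarrow> \<beta> k \<in> L0"
    "\<And>x. x \<in> L0 \<Longrightarrow> \<exists>n. x = (\<lambda>i. \<Sum>k<l. n k * \<beta> k i)"
    "\<And>n. (\<forall>i. (\<Sum>k<l. n k * \<beta> k i) = 0) \<Longrightarrow> (\<forall>k<l. n k = 0)"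
    using lb unfolding subgroup_basis_def by simp_all
  show ?case
  proof (cases "L = L0")
    case True
    then show ?thesis using lb by blast
  next
    case False
    then obtain x0 where x0: "x0 \<in> L" "x0 j \<noteq> 0"
      by (auto simp: L0_def)
    define P where "P d \<longleftrightarrow> 0 < d \<and> (\<exists>x\<in>L. x j = int d)" for d :: nat
    have "P (nat \<bar>x0 j\<bar>)"
      using x0 neg[OF x0(1)] by (cases "0 \<le> x0 j") (auto simp: P_def intro: bexI[of _ x0])
    then have Pd: "P (LEAST d. P d)" by (rule LeastI)
    define d where "d = (LEAST d. P d)"
    obtain b where b: "b \<in> L" "b j = int d" "0 < d"
      using Pd by (auto simp: P_def d_def)
    \<comment> \<open>Division with remainder: a nonzero remainder at \<open>j\<close> would be a
      positive value below the minimum \<open>d\<close>.\<close>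
    have red: "(\<lambda>i. x i - (x j div int d) * b i) \<in> L0" if x: "x \<in> L" for x
    proof -
      let ?y = "\<lambda>i. x i - (x j div int d) * b i"
      have y: "?y \<in> L" by (rule diff[OF x mult[OF b(1)]])
      have yj: "?y j = x j mod int d"
        by (simp add: b(2) minus_div_mult_eq_mod)
      have "\<not> P (nat (x j mod int d))"
      proof
        assume "P (nat (x j mod int d))"
        then have "d \<le> nat (x j mod int d)"
          unfolding d_def by (rule Least_le)
        then have "int d \<le> x j mod int d"
          using b(3) by (simp add: le_nat_iff)
        moreover have "x j mod int d < int d"
          by (rule pos_mod_bound) (use b(3) in simp)
        ultimately show False by simp
      qed
      moreover have "?y j = int (nat (x j mod int d))"
        using yj b(3) by simp
      ultimately have "?y j = 0"
        using y unfolding P_def by (metis of_nat_0 neq0_conv)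
      then show ?thesis using y by (simp add: L0_def)
    qed
    define \<beta>' where "\<beta>' = \<beta>(l := b)"
    have sum': "(\<Sum>k<Suc l. n k * \<beta>' k i) = (\<Sum>k<l. n k * \<beta> k i) + n l * b i" for n i
      by (simp add: \<beta>'_def)
    show ?thesis
      unfolding subgroup_basis_def
    proof (intro exI[of _ "Suc l"] exI[of _ \<beta>'] conjI allI impI ballI)
      show "\<beta>' k \<in> L" if "k < Suc l" for k
        using that b(1) \<beta>(1) by (auto simp: \<beta>'_def L0_def less_Suc_eq)
      fix x assume "x \<in> L"
      from \<beta>(2)[OF red[OF this]] obtain n
        where "(\<lambda>i. x i - (x j div int d) * b i) = (\<lambda>i. \<Sum>k<l. n k * \<beta> k i)" ..
      then have n: "x i - (x j div int d) * b i = (\<Sum>k<l. n k * \<beta> k i)" for i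
        by meson
      have "x i = (\<Sum>k<Suc l. (n(l := x j div int d)) k * \<beta>' k i)" for i
        unfolding sum' using n[of i] by simp
      then have "x = (\<lambda>i. \<Sum>k<Suc l. (n(l := x j div int d)) k * \<beta>' k i)"
        by (rule ext)
      then show "\<exists>n. x = (\<lambda>i. \<Sum>k<Suc l. n k * \<beta>' k i)"
        by (intro exI[of _ "n(l := x j div int d)"])
    next
      fix n k assume 0: "\<forall>i. (\<Sum>k<Suc l. n k * \<beta>' k i) = 0" and k: "k < Suc l"
      have "(\<Sum>k<l. n k * \<beta> k j) = 0"
        using \<beta>(1) by (intro sum.neutral) (auto simp: L0_def)
      then have nl: "n l = 0"
        using 0[rule_format, of j] b(2,3) unfolding sum' by simp
      then have "\<forall>i. (\<Sum>k<l. n k * \<beta> k i) = 0"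
        using 0 unfolding sum' by simp
      then show "n k = 0"
        using \<beta>(3) nl k by (auto simp: less_Suc_eq)
    qed
  qed
qed

lemma power_int_eq_divide:
  fixes x :: "'a :: field"
  shows "x powi q = x ^ nat q / x ^ nat (- q)"
proof (cases "0 \<le> q")
  case True
  then show ?thesis by (simp add: power_int_def)
next
  case False
  then show ?thesis by (simp add: power_int_def power_inverse divide_inverse)
qed

lemma power_int_sum:
  fixes x :: "'a :: field"
  assumes "x \<noteq> 0"
  shows "(\<Prod>b\<in>B. x powi f b) = x powi (\<Sum>b\<in>B. f b)"
  using assms by (induction B rule: infinite_finite_induct) (auto simp: power_int_add)

lemma power_int_prod:
  fixes x :: "'b \<Rightarrow> 'a :: field"
  shows "(\<Prod>b\<in>B. x b) powi n = (\<Prod>b\<in>B. x b powi n)"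
  by (induction B rule: infinite_finite_induct) (auto simp: power_int_mult_distrib)

context monomial_map
begin

lemma exponent_outside: "b \<in> B \<Longrightarrow> i \<notin> A \<Longrightarrow> e b i = 0"
  using exponent by (auto simp: multi_indices_def)

text \<open>Moving the negative exponents to the other side turns an integer relation into one
  between two decompositions with equal totals, which the points of the variety respect.\<close>

lemma integer_relation:
  assumes y: "y \<in> variety" "\<And>b. b \<in> B \<Longrightarrow> y b \<noteq> 0"
    and q: "\<And>i. (\<Sum>b\<in>B. q b * int (e b i)) = 0"
  shows "(\<Prod>b\<in>B. y b powi q b) = 1"
proof -
  define a where "a b = (if b \<in> B then nat (q b) else 0)" for b
  define a' where "a' b = (if b \<in> B then nat (- q b) else 0)" for b
  have "int (total a i) - int (total a' i) = 0" for i
  proof -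
    have "int (total a i) - int (total a' i) = (\<Sum>b\<in>B. (int (a b) - int (a' b)) * int (e b i))"
      by (simp add: total_def sum_subtractf left_diff_distrib)
    also have "\<dots> = (\<Sum>b\<in>B. q b * int (e b i))"
      by (intro sum.cong) (auto simp: a_def a'_def)
    finally show ?thesis using q by simp
  qed
  then have "total a = total a'"
    by (simp add: fun_eq_iff)
  moreover have "a \<in> multi_indices B" "a' \<in> multi_indices B"
    by (auto simp: a_def a'_def multi_indices_def)
  ultimately have eq: "monomial B a y = monomial B a' y"
    using y(1) unfolding variety_def by blast
  have "y b powi q b = y b ^ a b / y b ^ a' b" if "b \<in> B" for b
    using that power_int_eq_divide[of "y b" "q b"] by (simp add: a_def a'_def)
  then have "(\<Prod>b\<in>B. y b powi q b) = monomial B a y / monomial B a' y"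
    by (simp add: monomial_def prod_dividef)
  also have "\<dots> = 1"
    using eq y(2) finite_B by (simp add: monomial_def)
  finally show ?thesis .
qed

text \<open>The torus has the lattice spanned by the exponents as its character group. With a basis
  \<beta> of this lattice, \<open>N\<close> writes the exponents through \<beta> and
  \<open>M\<close> writes \<beta> through the exponents; these two matrices give the embedding and
  its inverse.\<close>

lemma affine_toric_variety: "affine_toric_variety B variety"
proof -
  define L where "L = {x. \<exists>q. x = (\<lambda>i. \<Sum>b\<in>B. q b * int (e b i))}"
  have "\<exists>l \<beta>. subgroup_basis L l \<beta>"
  proof (rule ex_subgroup_basis[OF finite_A])
    show "x i = 0" if "x \<in> L" "i \<notin> A" for x i
      using that exponent_outside by (auto simp: L_def)
    show "(\<lambda>_. 0) \<in> L"
      unfolding L_def by (intro CollectI exI[of _ "\<lambda>_. 0"]) simp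
    fix x y assume "x \<in> L" "y \<in> L"
    then obtain q q' where "x = (\<lambda>i. \<Sum>b\<in>B. q b * int (e b i))" "y = (\<lambda>i. \<Sum>b\<in>B. q' b * int (e b i))"
      by (auto simp: L_def)
    then show "(\<lambda>i. x i - y i) \<in> L"
      unfolding L_def
      by (intro CollectI exI[of _ "\<lambda>b. q b - q' b"]) (simp add: sum_subtractf left_diff_distrib)
  qed
  then obtain l \<beta> where lb: "subgroup_basis L l \<beta>" by blast
  have \<beta>: "\<And>k. k < l \<Longrightarrow> \<beta> k \<in> L" "\<And>x. x \<in> L \<Longrightarrow> \<exists>n. x = (\<lambda>i. \<Sum>k<l. n k * \<beta> k i)"
    "\<And>n k. (\<And>i. (\<Sum>k<l. n k * \<beta> k i) = 0) \<Longrightarrow> k < l \<Longrightarrow> n k = 0"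
    using lb unfolding subgroup_basis_def by simp_all
  have "\<forall>b\<in>B. \<exists>n. \<forall>i. int (e b i) = (\<Sum>k<l. n k * \<beta> k i)"
  proof
    fix b assume b: "b \<in> B"
    have "(\<lambda>i. int (e b i)) \<in> L"
      unfolding L_def using finite_B b
      by (intro CollectI exI[of _ "\<lambda>c. if c = b then 1 else 0"])
        (simp add: fun_eq_iff if_distrib[of "\<lambda>x. x * _"] cong: if_cong)
    from \<beta>(2)[OF this] obtain n where "(\<lambda>i. int (e b i)) = (\<lambda>i. \<Sum>k<l. n k * \<beta> k i)" ..
    then show "\<exists>n. \<forall>i. int (e b i) = (\<Sum>k<l. n k * \<beta> k i)"
      by (intro exI[of _ n] allI) (rule fun_cong)
  qed
  from bchoice[OF this] obtain N where N0: "\<forall>b\<in>B. \<forall>i. int (e b i) = (\<Sum>k<l. N b k * \<beta> k i)" ..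
  then have N: "(\<Sum>k<l. N b k * \<beta> k i) = int (e b i)" if "b \<in> B" for b i
    using that by simp
  have "\<forall>k\<in>{..<l}. \<exists>q. \<forall>i. \<beta> k i = (\<Sum>b\<in>B. q b * int (e b i))"
  proof
    fix k assume "k \<in> {..<l}"
    then have "\<beta> k \<in> L" using \<beta>(1) by simp
    then obtain q where "\<beta> k = (\<lambda>i. \<Sum>b\<in>B. q b * int (e b i))"
      unfolding L_def by blast
    then show "\<exists>q. \<forall>i. \<beta> k i = (\<Sum>b\<in>B. q b * int (e b i))"
      by (intro exI[of _ q] allI) (rule fun_cong)
  qed
  from bchoice[OF this] obtain M where M0: "\<forall>k\<in>{..<l}. \<forall>i. \<beta> k i = (\<Sum>b\<in>B. M k b * int (e b i))" ..
  then have M: "(\<Sum>b\<in>B. M k b * int (e b i)) = \<beta> k i" if "k < l" for k i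
    using that by simp
  have swap: "(\<Sum>k<l. (\<Sum>b\<in>B. q b * N b k) * \<beta> k i) = (\<Sum>b\<in>B. q b * int (e b i))" for q i
  proof -
    have "(\<Sum>k<l. (\<Sum>b\<in>B. q b * N b k) * \<beta> k i) = (\<Sum>b\<in>B. \<Sum>k<l. q b * (N b k * \<beta> k i))"
      unfolding sum_distrib_right by (subst sum.swap) (simp add: mult.assoc)
    also have "\<dots> = (\<Sum>b\<in>B. q b * int (e b i))"
      by (intro sum.cong) (simp_all add: sum_distrib_left[symmetric] N)
    finally show ?thesis .
  qed
  \<comment> \<open>This product of the matrices is the identity by independence of the basis. The
    opposite product is so only modulo relations between the exponents, which hold on the
    variety.\<close>
  have MN: "(\<Sum>b\<in>B. M k b * N b k') = (if k' = k then 1 else 0)" if k: "k < l" "k' < l" for k k'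
  proof -
    have "(\<Sum>b\<in>B. M k b * N b k') - (if k' = k then 1 else 0) = 0"
    proof (rule \<beta>(3)[OF _ k(2), of "\<lambda>k'. (\<Sum>b\<in>B. M k b * N b k') - (if k' = k then 1 else 0)"])
      fix i
      have "(\<Sum>k'<l. (if k' = k then 1 else 0) * \<beta> k' i) = \<beta> k i"
        using k(1) by (simp add: if_distrib[of "\<lambda>x. x * _"] cong: if_cong)
      then show "(\<Sum>k'<l. ((\<Sum>b\<in>B. M k b * N b k') - (if k' = k then 1 else 0)) * \<beta> k' i) = 0"
        by (simp add: left_diff_distrib sum_subtractf swap M[OF k(1)])
    qed
    then show ?thesis by simp
  qed
  define \<iota> where "\<iota> t b = (if b \<in> B then \<Prod>k<l. t k powi N b k else (0::complex))" for t b
  define act where "act t x b = (if b \<in> B then \<iota> t b * x b else (0::complex))" for t x b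
  have nz: "t k \<noteq> 0" if "t \<in> torus l" "k < l" for t k
    using that by (simp add: torus_def)
  have \<iota>_nz: "\<iota> t b \<noteq> 0" if "t \<in> torus l" "b \<in> B" for t b
    using that nz by (auto simp: \<iota>_def power_int_eq_0_iff)
  have \<iota>_powi: "(\<Prod>b\<in>B. \<iota> t b powi q b) = (\<Prod>k<l. t k powi (\<Sum>b\<in>B. q b * N b k))"
    if t: "t \<in> torus l" for t and q :: "'b \<Rightarrow> int"
  proof -
    have "(\<Prod>b\<in>B. \<iota> t b powi q b) = (\<Prod>b\<in>B. \<Prod>k<l. t k powi (q b * N b k))"
      by (intro prod.cong) (simp_all add: \<iota>_def power_int_prod power_int_mult[symmetric] mult.commute)
    also have "\<dots> = (\<Prod>k<l. \<Prod>b\<in>B. t k powi (q b * N b k))"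
      by (rule prod.swap)
    also have "\<dots> = (\<Prod>k<l. t k powi (\<Sum>b\<in>B. q b * N b k))"
      by (intro prod.cong refl power_int_sum nz[OF t]) simp
    finally show ?thesis .
  qed
  have \<iota>_mon: "monomial B a (\<iota> t) = (\<Prod>k<l. t k powi (\<Sum>b\<in>B. int (a b) * N b k))"
    if t: "t \<in> torus l" for t a
    using \<iota>_powi[OF t, of "\<lambda>b. int (a b)"] by (simp add: monomial_def)
  have \<iota>_in: "\<iota> t \<in> variety" if t: "t \<in> torus l" for t
    unfolding variety_def
  proof (intro CollectI conjI ballI impI)
    show "\<iota> t \<in> cspace B" by (simp add: \<iota>_def cspace_def)
    fix a a' assume "total a = total a'"
    then have tot: "(\<Sum>b\<in>B. int (a b) * int (e b i)) = (\<Sum>b\<in>B. int (a' b) * int (e b i))" for i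
      unfolding total_def fun_eq_iff by (metis (mono_tags, lifting) of_nat_mult of_nat_sum sum.cong)
    have "(\<Sum>b\<in>B. int (a b) * N b k) = (\<Sum>b\<in>B. int (a' b) * N b k)" if k: "k < l" for k
    proof -
      have "(\<Sum>b\<in>B. int (a b) * N b k) - (\<Sum>b\<in>B. int (a' b) * N b k) = 0"
        by (rule \<beta>(3)[OF _ k, of "\<lambda>k. (\<Sum>b\<in>B. int (a b) * N b k) - (\<Sum>b\<in>B. int (a' b) * N b k)"])
          (simp add: left_diff_distrib sum_subtractf swap tot)
      then show ?thesis by simp
    qed
    then show "monomial B a (\<iota> t) = monomial B a' (\<iota> t)"
      unfolding \<iota>_mon[OF t] by (intro prod.cong) auto
  qed
  have regular_\<iota>: "torus_regular l B (\<lambda>t x. \<iota> t b)" if b: "b \<in> B" for b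
    unfolding torus_regular_def using b
    by (intro exI[of _ "{N b}"] exI[of _ "\<lambda>_ _. 1"]) (simp add: \<iota>_def poly_funs_const)
  have regular_act: "torus_regular l B (\<lambda>t x. act t x b)" if b: "b \<in> B" for b
    unfolding torus_regular_def using b poly_funs_coordinate[OF finite_B b]
    by (intro exI[of _ "{N b}"] exI[of _ "\<lambda>_ x. x b"]) (simp add: \<iota>_def act_def)
  \<comment> \<open>The complement of the torus is the locus where some coordinate vanishes, given
    by the single equation that the product of all coordinates is 0.\<close>
  have image: "\<iota> ` torus l = variety - {y\<in>cspace B. \<forall>f\<in>{\<lambda>y. \<Prod>b\<in>B. y b}. f y = 0}"
  proof (intro equalityI subsetI)
    fix y assume "y \<in> \<iota> ` torus l"
    then obtain t where t: "t \<in> torus l" "y = \<iota> t" by blast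
    then have "(\<Prod>b\<in>B. y b) \<noteq> 0" using \<iota>_nz finite_B by simp
    then show "y \<in> variety - {y\<in>cspace B. \<forall>f\<in>{\<lambda>y. \<Prod>b\<in>B. y b}. f y = 0}"
      using \<iota>_in[OF t(1)] t(2) by simp
  next
    fix y assume y: "y \<in> variety - {y\<in>cspace B. \<forall>f\<in>{\<lambda>y. \<Prod>b\<in>B. y b}. f y = 0}"
    then have yV: "y \<in> variety" and ynz: "\<And>b. b \<in> B \<Longrightarrow> y b \<noteq> 0"
      using variety_subset finite_B by auto
    \<comment> \<open>The characters \<beta> evaluated at \<open>y\<close> by means of
      \<open>M\<close>; the value 1 beyond \<open>l\<close> is the convention of
      \<open>torus\<close>.\<close>
    define t where "t k = (if k < l then \<Prod>b\<in>B. y b powi M k b else 1)" for k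
    have "t \<in> torus l"
      using ynz finite_B by (auto simp: torus_def t_def power_int_eq_0_iff)
    moreover have "\<iota> t = y"
    proof
      fix b
      show "\<iota> t b = y b"
      proof (cases "b \<in> B")
        case True
        define q where "q c = (\<Sum>k<l. N b k * M k c)" for c
        have "\<iota> t b = (\<Prod>k<l. \<Prod>c\<in>B. y c powi (N b k * M k c))"
          using True by (simp add: \<iota>_def t_def power_int_prod power_int_mult[symmetric] mult.commute)
        also have "\<dots> = (\<Prod>c\<in>B. \<Prod>k<l. y c powi (N b k * M k c))"
          by (rule prod.swap)
        also have "\<dots> = (\<Prod>c\<in>B. y c powi q c)"
          unfolding q_def by (intro prod.cong refl power_int_sum ynz)
        finally have 1: "\<iota> t b = (\<Prod>c\<in>B. y c powi q c)" .
        \<comment> \<open>\<open>q\<close> and the unit vector at \<open>b\<close> both represent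
          the exponent \<open>e b\<close>, so their difference is an integer relation, which
          \<open>y\<close> satisfies.\<close>
        have "(\<Prod>c\<in>B. y c powi (q c - (if c = b then 1 else 0))) = 1"
        proof (rule integer_relation[OF yV ynz])
          fix i
          have "(\<Sum>c\<in>B. q c * int (e c i)) = (\<Sum>k<l. N b k * (\<Sum>c\<in>B. M k c * int (e c i)))"
            unfolding q_def sum_distrib_right sum_distrib_left
            by (subst sum.swap) (simp add: mult.assoc)
          also have "\<dots> = int (e b i)"
            using N[OF True, of i] M by simp
          finally have "(\<Sum>c\<in>B. q c * int (e c i)) = int (e b i)" .
          moreover have "(\<Sum>c\<in>B. (if c = b then 1 else 0) * int (e c i)) = int (e b i)"
            using True finite_B by (simp add: if_distrib[of "\<lambda>x. x * _"] cong: if_cong)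
          ultimately show "(\<Sum>c\<in>B. (q c - (if c = b then 1 else 0)) * int (e c i)) = 0"
            by (simp add: left_diff_distrib sum_subtractf)
        qed
        moreover have "(\<Prod>c\<in>B. y c powi (q c - (if c = b then 1 else 0))) =
            (\<Prod>c\<in>B. y c powi q c) / (\<Prod>c\<in>B. if c = b then y c else 1)"
          unfolding prod_dividef[symmetric]
          by (intro prod.cong refl) (auto simp: power_int_diff ynz)
        moreover have "(\<Prod>c\<in>B. if c = b then y c else 1) = y b"
          using True finite_B by simp
        ultimately show ?thesis
          using 1 ynz[OF True] by simp
      next
        case False
        then show ?thesis
          using yV variety_subset by (auto simp: \<iota>_def cspace_def)
      qed
    qed
    ultimately show "y \<in> \<iota> ` torus l" by blast
  qed
  have open_image: "\<exists>Z. algebraic_set B Z \<and> \<iota> ` torus l = variety - Z"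
  proof (intro exI conjI)
    have "(\<lambda>y. \<Prod>b\<in>B. y b) \<in> poly_funs B"
      by (intro poly_funs_prod poly_funs_coordinate finite_B)
    then show "algebraic_set B {y\<in>cspace B. \<forall>f\<in>{\<lambda>y. \<Prod>b\<in>B. y b}. f y = 0}"
      unfolding algebraic_set_def by (intro exI[of _ "{\<lambda>y. \<Prod>b\<in>B. y b}"]) simp
  qed (rule image)
  have inverse: "\<exists>f\<in>poly_funs B. \<exists>g\<in>poly_funs B. g (\<iota> s) \<noteq> 0 \<and>
      (\<forall>t\<in>torus l. g (\<iota> t) \<noteq> 0 \<longrightarrow> t k = f (\<iota> t) / g (\<iota> t))"
    if s: "s \<in> torus l" and k: "k < l" for s k
  proof -
    \<comment> \<open>The negative exponents of the character go into the denominator, which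
      vanishes nowhere on the torus, so one pair of polynomials serves at every point.\<close>
    let ?f = "\<lambda>y. \<Prod>b\<in>B. y b ^ nat (M k b)" and ?g = "\<lambda>y. \<Prod>b\<in>B. y b ^ nat (- M k b)"
    have fg: "?f \<in> poly_funs B" "?g \<in> poly_funs B"
      by (intro poly_funs_prod poly_funs_power poly_funs_coordinate finite_B; assumption)+
    have g0: "?g (\<iota> s) \<noteq> 0"
      using \<iota>_nz[OF s] finite_B by simp
    have quot: "t k = ?f (\<iota> t) / ?g (\<iota> t)" if t: "t \<in> torus l" for t
    proof -
    have "?f (\<iota> t) / ?g (\<iota> t) = (\<Prod>b\<in>B. \<iota> t b powi M k b)"
      unfolding prod_dividef[symmetric]
      by (intro prod.cong refl) (simp add: power_int_eq_divide)
    also have "\<dots> = (\<Prod>k'<l. t k' powi (if k' = k then 1 else 0))"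
      unfolding \<iota>_powi[OF t] using MN[OF k] by (intro prod.cong) auto
    also have "\<dots> = (\<Prod>k'<l. if k' = k then t k' else 1)"
      by (intro prod.cong) auto
    also have "\<dots> = t k"
      using k by simp
    finally show ?thesis by simp
    qed
    show ?thesis
      by (rule bexI[of _ ?f], rule bexI[of _ ?g]) (use fg g0 quot in blast)+
  qed
  have act_in: "act t x \<in> variety" if t: "t \<in> torus l" and x: "x \<in> variety" for t x
  proof -
    have mon: "monomial B a (act t x) = monomial B a (\<iota> t) * monomial B a x" for a
      by (simp add: monomial_def act_def power_mult_distrib prod.distrib)
    show ?thesis
      unfolding variety_def
    proof (intro CollectI conjI ballI impI)
      show "act t x \<in> cspace B"
        by (simp add: act_def cspace_def)
      fix a a' assume "a \<in> multi_indices B" "a' \<in> multi_indices B" "total a = total a'"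
      then have "monomial B a (\<iota> t) = monomial B a' (\<iota> t)" "monomial B a x = monomial B a' x"
        using \<iota>_in[OF t] x unfolding variety_def by blast+
      then show "monomial B a (act t x) = monomial B a' (act t x)"
        unfolding mon by simp
    qed
  qed
  have \<iota>_mult: "\<iota> (s * t) b = \<iota> s b * \<iota> t b" for s t b
    by (simp add: \<iota>_def power_int_mult_distrib prod.distrib)
  have act_1: "act 1 x = x" if "x \<in> variety" for x
    using that variety_subset by (auto simp: act_def \<iota>_def cspace_def fun_eq_iff)
  have act_mult: "act (s * t) x = act s (act t x)" for s t x
    by (simp add: act_def \<iota>_mult fun_eq_iff)
  have act_\<iota>: "act s (\<iota> t) = \<iota> (s * t)" for s t
    unfolding fun_eq_iff \<iota>_mult by (simp add: act_def) (simp add: \<iota>_def)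
  show ?thesis
    unfolding affine_toric_variety_def
  proof (intro conjI irreducible_variety exI[of _ l] exI[of _ \<iota>] exI[of _ act] ballI allI impI)
  qed (use regular_\<iota> open_image inverse regular_act act_in act_1 act_mult act_\<iota> in auto)
qed

end

section \<open>Resonances and the toric envelope\<close>

text \<open>Unit exponents on the factor with the zero foliation make the identity there part of one
  monomial map, so that the product with the toric map needs no separate treatment.\<close>

definition resonance_exponent :: "nat + ('n \<Rightarrow> nat) \<Rightarrow> nat + 'n \<Rightarrow> nat"
  where "resonance_exponent b =
    (case b of Inl i \<Rightarrow> (\<lambda>j. if j = Inl i then 1 else 0) | Inr \<alpha> \<Rightarrow> case_sum (\<lambda>_. 0) \<alpha>)"

text \<open>The weights on all coordinates of the model, with 0 on the factor carrying the zero
  foliation. They put the action into the diagonal form to which the invariance criterion for series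
  applies.\<close>

definition weight :: "('n::finite \<Rightarrow> complex^'k) \<Rightarrow> complex^'k \<Rightarrow> nat + 'n \<Rightarrow> complex"
  where "weight \<Lambda> v = case_sum (\<lambda>_. 0) (\<lambda>j. pairing (\<Lambda> j) v)"

lemma transverse_act_weight: "transverse_act \<Lambda> v z = (\<lambda>i. exp (weight \<Lambda> v i) * z i)"
  by (auto simp: transverse_act_def weight_def fun_eq_iff split: sum.splits)

lemma monomial_case_sum:
  assumes "finite M" "finite N"
  shows "monomial (Inl ` M \<union> Inr ` N) a y = monomial M (a \<circ> Inl) (y \<circ> Inl) * monomial N (a \<circ> Inr) (y \<circ> Inr)"
  using assms unfolding monomial_def
  by (subst prod.union_disjoint) (auto simp: prod.reindex)

section \<open>Generators of the resonances and the points of their spectrum\<close>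

context
  fixes \<Lambda> :: "'n::finite \<Rightarrow> complex^'k" and I :: "'n set"
begin

lemma resonances_0: "0 \<in> resonances \<Lambda> I"
  by (simp add: resonances_def)

lemma resonances_add:
  "\<alpha> \<in> resonances \<Lambda> I \<Longrightarrow> \<beta> \<in> resonances \<Lambda> I \<Longrightarrow> \<alpha> + \<beta> \<in> resonances \<Lambda> I"
  by (auto simp: resonances_def multi_indices_add distrib_right sum.distrib)

text \<open>Resonances are cut out by linear equations, so a difference that stays nonnegative is
  again one. General submonoids lack this property, and the finiteness of the set of indecomposables
  rests on it.\<close>

lemma resonances_diff:
  assumes "\<alpha> \<in> resonances \<Lambda> I" "\<beta> \<in> resonances \<Lambda> I" "\<alpha> \<le> \<beta>"
  shows "\<beta> - \<alpha> \<in> resonances \<Lambda> I"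
proof -
  have "of_nat ((\<beta> - \<alpha>) j) = (of_nat (\<beta> j) - of_nat (\<alpha> j) :: complex)" for j
    using assms(3) by (simp add: le_fun_def of_nat_diff)
  then show ?thesis
    using assms(1,2) by (auto simp: resonances_def multi_indices_diff left_diff_distrib sum_subtractf)
qed

lemma hilbert_basis_resonances: "hilbert_basis (resonances \<Lambda> I) \<subseteq> resonances \<Lambda> I"
  by (auto simp: hilbert_basis_def)

text \<open>An indecomposable element dominates an element of a Dickson basis of the nonzero
  resonances; the difference is a resonance and therefore 0, so the indecomposables lie in that
  finite basis.\<close>

lemma finite_hilbert_basis: "finite (hilbert_basis (resonances \<Lambda> I))"
proof -
  obtain K where K: "K \<subseteq> resonances \<Lambda> I - {0}" "finite K"
    "\<And>t. t \<in> resonances \<Lambda> I - {0} \<Longrightarrow> \<exists>b\<in>K. \<forall>i\<in>UNIV. b i \<le> t i"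
    using dickson[of "UNIV :: 'n set" "resonances \<Lambda> I - {0}"] by auto
  have "h \<in> K" if h: "h \<in> hilbert_basis (resonances \<Lambda> I)" for h
  proof -
    have h': "h \<in> resonances \<Lambda> I" "h \<noteq> 0"
      using h by (auto simp: hilbert_basis_def)
    then obtain b where b: "b \<in> K" "b \<le> h"
      using K(3)[of h] by (auto simp: le_fun_def)
    have "h = b + (h - b)"
      using b(2) by (simp add: fun_eq_iff le_fun_def)
    moreover have "h - b \<in> resonances \<Lambda> I" "b \<in> resonances \<Lambda> I" "b \<noteq> 0"
      using resonances_diff h'(1) b K(1) by auto
    ultimately have "h - b = 0"
      using h unfolding hilbert_basis_def by blast
    then have "h = b"
      using \<open>h = b + (h - b)\<close> by simp
    then show ?thesis using b(1) by simp
  qed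
  then have "hilbert_basis (resonances \<Lambda> I) \<subseteq> K" by (rule subsetI)
  then show ?thesis
    using K(2) by (rule finite_subset)
qed

definition combination :: "(('n \<Rightarrow> nat) \<Rightarrow> nat) \<Rightarrow> 'n \<Rightarrow> nat"
  where "combination a = (\<lambda>j. \<Sum>h\<in>hilbert_basis (resonances \<Lambda> I). a h * h j)"

lemma combination_add: "combination (a + a') = combination a + combination a'"
  by (simp add: combination_def fun_eq_iff distrib_right sum.distrib)

lemma combination_0: "combination 0 = 0"
  by (simp add: combination_def fun_eq_iff)

lemma combination_unit:
  assumes "h \<in> hilbert_basis (resonances \<Lambda> I)"
  shows "combination (\<lambda>g. if g = h then 1 else 0) = h"
  using assms finite_hilbert_basis
  by (intro ext) (simp add: combination_def if_distrib[of "\<lambda>x. x * _"] cong: if_cong)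

lemma combination_resonances: "combination a \<in> resonances \<Lambda> I"
proof -
  have "(\<lambda>j. \<Sum>h\<in>N. a h * h j) \<in> resonances \<Lambda> I"
    if "finite N" "N \<subseteq> hilbert_basis (resonances \<Lambda> I)" for N
    using that
  proof (induction N rule: finite_induct)
    case empty
    then show ?case using resonances_0 by (simp add: zero_fun_def)
  next
    case (insert h N)
    have mult: "(\<lambda>j. n * h j) \<in> resonances \<Lambda> I" for n
    proof (induction n)
      case 0
      then show ?case using resonances_0 by (simp add: zero_fun_def)
    next
      case (Suc n)
      have "h \<in> resonances \<Lambda> I" using insert.prems hilbert_basis_resonances by blast
      from resonances_add[OF this Suc] show ?case by (simp add: plus_fun_def)
    qed
    have "(\<lambda>j. \<Sum>h\<in>N. a h * h j) \<in> resonances \<Lambda> I"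
      using insert by simp
    from resonances_add[OF mult[of "a h"] this] show ?case
      using insert.hyps by (simp add: plus_fun_def)
  qed
  from this[OF finite_hilbert_basis] show ?thesis by (simp add: combination_def)
qed

text \<open>A decomposable element splits into two nonzero ones of smaller total degree, so the
  induction ends at indecomposables or at 0.\<close>

lemma resonances_combination:
  assumes "\<alpha> \<in> resonances \<Lambda> I"
  shows "\<exists>a\<in>multi_indices (hilbert_basis (resonances \<Lambda> I)). combination a = \<alpha>"
  using assms
proof (induction "mdeg UNIV \<alpha>" arbitrary: \<alpha> rule: less_induct)
  case less
  show ?case
  proof (cases "\<alpha> = 0")
    case True
    then show ?thesis using combination_0 by (intro bexI[of _ 0]) auto
  next
    case \<alpha>0: False
    show ?thesis
    proof (cases "\<alpha> \<in> hilbert_basis (resonances \<Lambda> I)")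
      case True
      then show ?thesis
        using combination_unit[OF True]
        by (intro bexI[of _ "\<lambda>g. if g = \<alpha> then 1 else 0"]) (auto simp: multi_indices_def)
    next
      case False
      then obtain \<beta> \<gamma> where *: "\<beta> \<in> resonances \<Lambda> I" "\<gamma> \<in> resonances \<Lambda> I" "\<beta> \<noteq> 0" "\<gamma> \<noteq> 0" "\<alpha> = \<beta> + \<gamma>"
        using less.prems \<alpha>0 unfolding hilbert_basis_def by blast
      have "mdeg UNIV \<beta> \<noteq> 0" "mdeg UNIV \<gamma> \<noteq> 0"
        using *(3,4) mdeg_eq_0_iff[of "UNIV :: 'n set"] by (auto simp: multi_indices_def)
      then have "mdeg UNIV \<beta> < mdeg UNIV \<alpha>" "mdeg UNIV \<gamma> < mdeg UNIV \<alpha>"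
        using *(5) by (simp_all add: mdeg_add)
      then obtain a b where ab: "a \<in> multi_indices (hilbert_basis (resonances \<Lambda> I))" "combination a = \<beta>"
        "b \<in> multi_indices (hilbert_basis (resonances \<Lambda> I))" "combination b = \<gamma>"
        using less.hyps *(1,2) by metis
      then show ?thesis
        using *(5) by (intro bexI[of _ "a + b"]) (auto simp: combination_add multi_indices_add)
    qed
  qed
qed

text \<open>The values of a homomorphism at monomials are multiplicative in the exponent, so the
  coordinates of a point satisfy every binomial relation. Conversely the relations make the value at
  a resonance independent of its decomposition, and linear extension gives a homomorphism.\<close>

lemma spec_an_relations:
  "spec_an (resonances \<Lambda> I) = {u\<in>cspace (hilbert_basis (resonances \<Lambda> I)).
    \<forall>a\<in>multi_indices (hilbert_basis (resonances \<Lambda> I)).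
    \<forall>a'\<in>multi_indices (hilbert_basis (resonances \<Lambda> I)). combination a = combination a' \<longrightarrow>
      monomial (hilbert_basis (resonances \<Lambda> I)) a u = monomial (hilbert_basis (resonances \<Lambda> I)) a' u}"
    (is "?spec = ?rel")
proof (intro equalityI subsetI)
  let ?R = "resonances \<Lambda> I" and ?H = "hilbert_basis (resonances \<Lambda> I)"
  fix u assume "u \<in> ?spec"
  then obtain \<phi> where \<phi>: "\<phi> \<in> spec_points ?R"
    and u: "u = (\<lambda>\<alpha>. if \<alpha> \<in> ?H then \<phi> (Poly_Mapping.single \<alpha> 1) else 0)"
    by (auto simp: spec_an_def)
  define ev where "ev \<alpha> = \<phi> (Poly_Mapping.single \<alpha> 1)" for \<alpha>
  have ev0: "ev 0 = 1"
    using \<phi> by (simp add: ev_def spec_points_def)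
  have evadd: "ev (\<alpha> + \<beta>) = ev \<alpha> * ev \<beta>" if "\<alpha> \<in> ?R" "\<beta> \<in> ?R" for \<alpha> \<beta>
  proof -
    have "Poly_Mapping.single \<alpha> 1 \<in> monoid_algebra ?R" "Poly_Mapping.single \<beta> 1 \<in> monoid_algebra ?R"
      using that by (simp_all add: monoid_algebra_def)
    then have "\<phi> (Poly_Mapping.single \<alpha> 1 * Poly_Mapping.single \<beta> 1) = ev \<alpha> * ev \<beta>"
      using \<phi> unfolding spec_points_def ev_def by blast
    then show ?thesis by (simp add: mult_single ev_def)
  qed
  have pow: "(\<lambda>j. n * h j) \<in> ?R \<and> ev (\<lambda>j. n * h j) = ev h ^ n" if "h \<in> ?R" for h n
  proof (induction n)
    case 0
    then show ?case using resonances_0 ev0 by (simp add: zero_fun_def)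
  next
    case (Suc n)
    then show ?case
      using resonances_add[OF that, of "\<lambda>j. n * h j"] evadd[OF that, of "\<lambda>j. n * h j"]
      by (simp add: plus_fun_def)
  qed
  have "(\<lambda>j. \<Sum>h\<in>N. a h * h j) \<in> ?R \<and> ev (\<lambda>j. \<Sum>h\<in>N. a h * h j) = (\<Prod>h\<in>N. ev h ^ a h)"
    if "finite N" "N \<subseteq> ?R" for a N
    using that
  proof (induction N rule: finite_induct)
    case empty
    then show ?case using resonances_0 ev0 by (simp add: zero_fun_def)
  next
    case (insert h N)
    then have "h \<in> ?R" by simp
    then show ?case
      using insert pow[of h "a h"] resonances_add[of "\<lambda>j. a h * h j" "\<lambda>j. \<Sum>h\<in>N. a h * h j"]
        evadd[of "\<lambda>j. a h * h j" "\<lambda>j. \<Sum>h\<in>N. a h * h j"]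
      by (simp add: plus_fun_def)
  qed
  from this[OF finite_hilbert_basis hilbert_basis_resonances]
  have "monomial ?H a u = ev (combination a)" for a
    by (simp add: monomial_def u ev_def combination_def)
  then show "u \<in> ?rel"
    by (simp add: u cspace_def)
next
  let ?R = "resonances \<Lambda> I" and ?H = "hilbert_basis (resonances \<Lambda> I)"
  fix u assume u: "u \<in> ?rel"
  have u_rel: "monomial ?H a u = monomial ?H a' u"
    if "a \<in> multi_indices ?H" "a' \<in> multi_indices ?H" "combination a = combination a'" for a a'
    using u that by blast
  have "\<forall>\<alpha>\<in>?R. \<exists>a. a \<in> multi_indices ?H \<and> combination a = \<alpha>"
    using resonances_combination by blast
  from bchoice[OF this] obtain s
    where s: "\<forall>\<alpha>\<in>?R. s \<alpha> \<in> multi_indices ?H \<and> combination (s \<alpha>) = \<alpha>" ..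
  define ev where "ev \<alpha> = monomial ?H (s \<alpha>) u" for \<alpha>
  \<comment> \<open>The choice \<open>s\<close> drops out: any decomposition of the same resonance
    gives the same value, by the relations at \<open>u\<close>.\<close>
  have evcomb: "ev (combination a) = monomial ?H a u" if "a \<in> multi_indices ?H" for a
    unfolding ev_def using s combination_resonances[of a] that by (intro u_rel) auto
  have ev0: "ev 0 = 1"
    using evcomb[of 0] by (simp add: combination_0)
  have evadd: "ev (\<alpha> + \<beta>) = ev \<alpha> * ev \<beta>" if "\<alpha> \<in> ?R" "\<beta> \<in> ?R" for \<alpha> \<beta>
    using evcomb[of "s \<alpha> + s \<beta>"] s that
    by (simp add: combination_add multi_indices_add monomial_add ev_def)
  define \<phi> where "\<phi> p = (\<Sum>\<alpha>\<in>Poly_Mapping.keys p. Poly_Mapping.lookup p \<alpha> * ev \<alpha>)" for p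
  have \<phi>_eq: "\<phi> p = (\<Sum>\<alpha>\<in>K. Poly_Mapping.lookup p \<alpha> * ev \<alpha>)"
    if "finite K" "Poly_Mapping.keys p \<subseteq> K" for p K
    unfolding \<phi>_def using that by (intro sum.mono_neutral_left) (auto simp: in_keys_iff)
  have \<phi>_add: "\<phi> (p + q) = \<phi> p + \<phi> q" for p q
  proof -
    let ?K = "Poly_Mapping.keys p \<union> Poly_Mapping.keys q"
    have "Poly_Mapping.keys (p + q) \<subseteq> ?K" by (rule keys_add)
    then show ?thesis
      using \<phi>_eq[of ?K p] \<phi>_eq[of ?K q] \<phi>_eq[of ?K "p + q"]
      by (simp add: lookup_add distrib_right sum.distrib)
  qed
  have \<phi>_sum: "\<phi> (\<Sum>i\<in>N. p i) = (\<Sum>i\<in>N. \<phi> (p i))" if "finite N" for N :: "('n \<Rightarrow> nat) set" and p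
    using that by (induction N rule: finite_induct) (simp_all add: \<phi>_add, simp add: \<phi>_def)
  have \<phi>_single: "\<phi> (Poly_Mapping.single \<alpha> c) = c * ev \<alpha>" for \<alpha> c
    using \<phi>_eq[of "{\<alpha>}" "Poly_Mapping.single \<alpha> c"] by (simp split: if_splits)
  have expand: "p = (\<Sum>\<alpha>\<in>Poly_Mapping.keys p. Poly_Mapping.single \<alpha> (Poly_Mapping.lookup p \<alpha>))"
    for p :: "('n \<Rightarrow> nat) \<Rightarrow>\<^sub>0 complex"
  proof (rule poly_mapping_eqI)
    fix \<beta>
    show "Poly_Mapping.lookup p \<beta> = Poly_Mapping.lookup
        (\<Sum>\<alpha>\<in>Poly_Mapping.keys p. Poly_Mapping.single \<alpha> (Poly_Mapping.lookup p \<alpha>)) \<beta>"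
      by (auto simp: lookup_sum lookup_single when_def in_keys_iff)
  qed
  have \<phi>_mult: "\<phi> (p * q) = \<phi> p * \<phi> q" if p: "p \<in> monoid_algebra ?R" and q: "q \<in> monoid_algebra ?R" for p q
  proof -
    have "p * q = (\<Sum>\<alpha>\<in>Poly_Mapping.keys p. \<Sum>\<beta>\<in>Poly_Mapping.keys q.
        Poly_Mapping.single (\<alpha> + \<beta>) (Poly_Mapping.lookup p \<alpha> * Poly_Mapping.lookup q \<beta>))"
      by (subst expand[of p], subst expand[of q]) (simp add: sum_product mult_single)
    then have "\<phi> (p * q) = (\<Sum>\<alpha>\<in>Poly_Mapping.keys p. \<Sum>\<beta>\<in>Poly_Mapping.keys q.
        (Poly_Mapping.lookup p \<alpha> * Poly_Mapping.lookup q \<beta>) * ev (\<alpha> + \<beta>))"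
      by (simp add: \<phi>_sum \<phi>_single)
    also have "\<dots> = (\<Sum>\<alpha>\<in>Poly_Mapping.keys p. \<Sum>\<beta>\<in>Poly_Mapping.keys q.
        (Poly_Mapping.lookup p \<alpha> * ev \<alpha>) * (Poly_Mapping.lookup q \<beta> * ev \<beta>))"
    proof (intro sum.cong refl)
      fix \<alpha> \<beta> assume "\<alpha> \<in> Poly_Mapping.keys p" "\<beta> \<in> Poly_Mapping.keys q"
      then have "\<alpha> \<in> ?R" "\<beta> \<in> ?R" using p q by (auto simp: monoid_algebra_def)
      from evadd[OF this] show "(Poly_Mapping.lookup p \<alpha> * Poly_Mapping.lookup q \<beta>) * ev (\<alpha> + \<beta>) =
          (Poly_Mapping.lookup p \<alpha> * ev \<alpha>) * (Poly_Mapping.lookup q \<beta> * ev \<beta>)"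
        by (simp add: mult_ac)
    qed
    also have "\<dots> = \<phi> p * \<phi> q"
      by (simp add: \<phi>_def sum_product)
    finally show ?thesis .
  qed
  have "\<phi> \<in> spec_points ?R"
    unfolding spec_points_def
  proof (intro CollectI conjI ballI allI)
    show "\<phi> 1 = 1"
      using \<phi>_single[of 0 1] ev0 by simp
    show "\<phi> (Poly_Mapping.single 0 c * p) = c * \<phi> p" if "p \<in> monoid_algebra ?R" for c p
    proof -
      have "Poly_Mapping.single 0 c \<in> monoid_algebra ?R"
        using resonances_0 by (simp add: monoid_algebra_def)
      from \<phi>_mult[OF this that] show ?thesis by (simp add: \<phi>_single ev0)
    qed
  qed (use \<phi>_add \<phi>_mult in auto)
  moreover have "u = (\<lambda>\<alpha>. if \<alpha> \<in> ?H then \<phi> (Poly_Mapping.single \<alpha> 1) else 0)"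
  proof
    fix h
    show "u h = (if h \<in> ?H then \<phi> (Poly_Mapping.single h 1) else 0)"
    proof (cases "h \<in> ?H")
      case True
      have "ev h = monomial ?H (\<lambda>g. if g = h then 1 else 0) u"
        using evcomb[of "\<lambda>g. if g = h then 1 else 0"] True combination_unit[OF True]
        by (simp add: multi_indices_def)
      then show ?thesis
        using True monomial_unit[OF finite_hilbert_basis True] by (simp add: \<phi>_single)
    next
      case False
      then show ?thesis using u by (simp add: cspace_def)
    qed
  qed
  ultimately show "u \<in> ?spec"
    unfolding spec_an_def by blast
qed

end

text \<open>The support is arbitrary here, so that the results can be instantiated at both of the
  supports between which a germ maps.\<close>

locale transverse =
  fixes \<Lambda> :: "'n::finite \<Rightarrow> complex^'k" and I :: "'n set"
begin

abbreviation model_coords :: "(nat + 'n) set"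
  where "model_coords \<equiv> Inl ` {..<codim_supp \<Lambda> I} \<union> Inr ` (- I)"

abbreviation envelope_coords :: "(nat + ('n \<Rightarrow> nat)) set"
  where "envelope_coords \<equiv> Inl ` {..<codim_supp \<Lambda> I} \<union> Inr ` hilbert_basis (resonances \<Lambda> I)"

sublocale monomial_map model_coords envelope_coords resonance_exponent
proof
  show "finite model_coords" "finite envelope_coords"
    using finite_hilbert_basis by auto
  fix b assume b: "b \<in> envelope_coords"
  show "resonance_exponent b \<in> multi_indices model_coords"
  proof (cases b)
    case (Inr h)
    then have "h \<in> multi_indices (- I)"
      using b hilbert_basis_resonances[of \<Lambda> I] by (auto simp: resonances_def)
    then show ?thesis
      using Inr by (auto simp: resonance_exponent_def multi_indices_def split: sum.splits)
  qed (use b in \<open>auto simp: resonance_exponent_def multi_indices_def\<close>)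
  show "resonance_exponent b \<noteq> 0"
  proof (cases b)
    case (Inl i)
    then have "resonance_exponent b (Inl i) \<noteq> 0" by (simp add: resonance_exponent_def)
    then show ?thesis by (metis zero_fun_apply)
  next
    case (Inr h)
    then have "h \<noteq> 0" using b by (auto simp: hilbert_basis_def)
    then obtain j where "h j \<noteq> 0" by (auto simp: fun_eq_iff)
    then have "resonance_exponent b (Inr j) \<noteq> 0" using Inr by (simp add: resonance_exponent_def)
    then show ?thesis by (metis zero_fun_apply)
  qed
qed

lemma total_case_sum:
  "total a = case_sum (\<lambda>i. if i < codim_supp \<Lambda> I then a (Inl i) else 0) (combination \<Lambda> I (a \<circ> Inr))"
proof
  fix j
  have "total a j = (\<Sum>i<codim_supp \<Lambda> I. a (Inl i) * resonance_exponent (Inl i) j) +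
      (\<Sum>h\<in>hilbert_basis (resonances \<Lambda> I). a (Inr h) * resonance_exponent (Inr h) j)"
    unfolding total_def using finite_hilbert_basis[of \<Lambda> I]
    by (subst sum.union_disjoint) (auto simp: sum.reindex)
  also have "\<dots> = case_sum (\<lambda>i. if i < codim_supp \<Lambda> I then a (Inl i) else 0) (combination \<Lambda> I (a \<circ> Inr)) j"
    by (cases j) (auto simp: resonance_exponent_def combination_def if_distrib[of "\<lambda>x. _ * x"] cong: if_cong)
  finally show "total a j = \<dots>" .
qed

text \<open>Saturation: the multi-indices solving the weight equations are exactly the sums of the
  generators. The factor with the zero foliation has weights 0 and unit exponents, so it adds
  neither an equation nor an obstruction.\<close>

lemma semigroup_eq: "semigroup = {\<alpha>\<in>multi_indices model_coords.
    \<forall>w\<in>weight \<Lambda> ` isotropy_alg \<Lambda> I. (\<Sum>i\<in>model_coords. of_nat (\<alpha> i) * w i) = 0}"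
proof -
  have sum: "(\<Sum>i\<in>model_coords. of_nat (\<alpha> i) * weight \<Lambda> v i) =
      (\<Sum>j\<in>- I. of_nat (\<alpha> (Inr j)) * pairing (\<Lambda> j) v)" for \<alpha> v
    by (subst sum.union_disjoint) (auto simp: sum.reindex weight_def)
  have iff: "\<alpha> \<circ> Inr \<in> resonances \<Lambda> I \<longleftrightarrow>
      (\<forall>w\<in>weight \<Lambda> ` isotropy_alg \<Lambda> I. (\<Sum>i\<in>model_coords. of_nat (\<alpha> i) * w i) = 0)"
    if "\<alpha> \<in> multi_indices model_coords" for \<alpha>
    using that by (auto simp: sum resonances_def multi_indices_def)
  show ?thesis
  proof (intro equalityI subsetI)
    fix \<alpha> assume \<alpha>: "\<alpha> \<in> semigroup"
    then obtain a where "\<alpha> = total a" by (auto simp: semigroup_def)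
    then have "\<alpha> \<circ> Inr = combination \<Lambda> I (a \<circ> Inr)"
      by (simp add: total_case_sum fun_eq_iff)
    then show "\<alpha> \<in> {\<alpha>\<in>multi_indices model_coords.
        \<forall>w\<in>weight \<Lambda> ` isotropy_alg \<Lambda> I. (\<Sum>i\<in>model_coords. of_nat (\<alpha> i) * w i) = 0}"
      using \<alpha> semigroup_subset iff[of \<alpha>] combination_resonances[of \<Lambda> I "a \<circ> Inr"] by auto
  next
    fix \<alpha> assume "\<alpha> \<in> {\<alpha>\<in>multi_indices model_coords.
        \<forall>w\<in>weight \<Lambda> ` isotropy_alg \<Lambda> I. (\<Sum>i\<in>model_coords. of_nat (\<alpha> i) * w i) = 0}"
    then have \<alpha>: "\<alpha> \<in> multi_indices model_coords" "\<alpha> \<circ> Inr \<in> resonances \<Lambda> I"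
      using iff[of \<alpha>] by auto
    obtain a where a: "a \<in> multi_indices (hilbert_basis (resonances \<Lambda> I))" "combination \<Lambda> I a = \<alpha> \<circ> Inr"
      using resonances_combination[OF \<alpha>(2)] by blast
    define a' where "a' = case_sum (\<lambda>i. \<alpha> (Inl i)) a"
    have "a' \<circ> Inr = a" by (simp add: a'_def fun_eq_iff)
    have "total a' i = \<alpha> i" for i
      using \<alpha>(1) a(2) \<open>a' \<circ> Inr = a\<close>
      by (cases i) (auto simp: total_case_sum a'_def multi_indices_def)
    moreover have "a' i = 0" if i: "i \<notin> envelope_coords" for i
    proof (cases i)
      case (Inl k)
      then have "Inl k \<notin> model_coords" using i by auto
      then show ?thesis
        using Inl \<alpha>(1) by (simp add: a'_def multi_indices_def)
    next
      case (Inr h)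
      then have "h \<notin> hilbert_basis (resonances \<Lambda> I)" using i by auto
      then show ?thesis
        using Inr a(1) by (simp add: a'_def multi_indices_def)
    qed
    then have "a' \<in> multi_indices envelope_coords"
      by (simp add: multi_indices_def)
    ultimately show "\<alpha> \<in> semigroup"
      unfolding semigroup_def by (metis ext imageI)
  qed
qed

lemma source_eq: "source = transverse_model \<Lambda> I"
  by (simp add: source_def transverse_model_def)

text \<open>The two maps may differ off the coordinate space, as \<open>envelope_map\<close> copies
  all coordinates \<open>Inl i\<close>, also those with
  \<open>i \<ge> codim_supp \<Lambda> I\<close>.\<close>

lemma mmap_eq: "z \<in> cspace model_coords \<Longrightarrow> mmap z = envelope_map \<Lambda> I z"
proof
  fix b assume z: "z \<in> cspace model_coords"
  show "mmap z b = envelope_map \<Lambda> I z b"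
  proof (cases b)
    case (Inl i)
    show ?thesis
    proof (cases "i < codim_supp \<Lambda> I")
      case True
      then have "monomial model_coords (resonance_exponent (Inl i)) z = z (Inl i)"
        using monomial_unit[OF finite_A, of "Inl i" z] by (simp add: resonance_exponent_def)
      then show ?thesis using Inl True by (simp add: mmap_def envelope_map_def)
    next
      case False
      then show ?thesis using Inl z by (auto simp: mmap_def envelope_map_def cspace_def)
    qed
  next
    case (Inr h)
    have "resonance_exponent (Inr h) \<circ> Inl = (0 :: nat \<Rightarrow> nat)" "resonance_exponent (Inr h) \<circ> Inr = h"
      by (simp_all add: resonance_exponent_def fun_eq_iff)
    then have "monomial model_coords (resonance_exponent (Inr h)) z = monomial (- I) h (z \<circ> Inr)"
      by (subst monomial_case_sum) auto
    then show ?thesis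
      using Inr by (auto simp: mmap_def envelope_map_def toric_map_def o_def)
  qed
qed

text \<open>Equal totals force equal exponents at the coordinates \<open>Inl i\<close>, so these are
  unconstrained and the relations left are exactly those of the spectrum.\<close>

lemma variety_eq: "variety = {case_sum x u | x u. x \<in> cspace {..<codim_supp \<Lambda> I} \<and> u \<in> spec_an (resonances \<Lambda> I)}"
proof (intro equalityI subsetI)
  let ?H = "hilbert_basis (resonances \<Lambda> I)"
  note mon = monomial_case_sum[OF finite_lessThan finite_hilbert_basis]
  fix y assume y: "y \<in> variety"
  have cs: "y \<circ> Inl \<in> cspace {..<codim_supp \<Lambda> I}" "y \<circ> Inr \<in> cspace ?H"
    using y variety_subset by (auto simp: cspace_def)
  have m: "monomial ?H a (y \<circ> Inr) = monomial ?H a' (y \<circ> Inr)"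
    if a: "a \<in> multi_indices ?H" "a' \<in> multi_indices ?H" "combination \<Lambda> I a = combination \<Lambda> I a'" for a a'
  proof -
    define b where "b c = (case_sum (\<lambda>_. 0) c :: nat + ('n \<Rightarrow> nat) \<Rightarrow> nat)" for c
    have b: "b c \<circ> Inl = 0" "b c \<circ> Inr = c" "b c (Inl i) = 0" for c i
      by (simp_all add: b_def fun_eq_iff)
    have "b a \<in> multi_indices envelope_coords" "b a' \<in> multi_indices envelope_coords"
      using a(1,2) by (auto simp: b_def multi_indices_def split: sum.splits)
    moreover have "total (b a) = total (b a')"
      unfolding total_case_sum b a(3) by (rule refl)
    ultimately have "monomial envelope_coords (b a) y = monomial envelope_coords (b a') y"
      using y unfolding variety_def by blast
    then show ?thesis unfolding mon b by simp
  qed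
  have "y \<circ> Inr \<in> spec_an (resonances \<Lambda> I)"
    unfolding spec_an_relations using cs(2) m by (intro CollectI conjI ballI impI)
  moreover have "y = case_sum (y \<circ> Inl) (y \<circ> Inr)"
    by (simp add: fun_eq_iff split: sum.splits)
  moreover note cs(1)
  ultimately show "y \<in> {case_sum x u | x u. x \<in> cspace {..<codim_supp \<Lambda> I} \<and> u \<in> spec_an (resonances \<Lambda> I)}"
    by blast
next
  let ?H = "hilbert_basis (resonances \<Lambda> I)"
  note mon = monomial_case_sum[OF finite_lessThan finite_hilbert_basis]
  fix y assume "y \<in> {case_sum x u | x u. x \<in> cspace {..<codim_supp \<Lambda> I} \<and> u \<in> spec_an (resonances \<Lambda> I)}"
  then obtain x u where y: "y = case_sum x u" "x \<in> cspace {..<codim_supp \<Lambda> I}" "u \<in> spec_an (resonances \<Lambda> I)"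
    by blast
  have yo: "y \<circ> Inl = x" "y \<circ> Inr = u"
    by (simp_all add: y(1) fun_eq_iff)
  have u: "u \<in> cspace ?H" "\<And>a a'. a \<in> multi_indices ?H \<Longrightarrow> a' \<in> multi_indices ?H \<Longrightarrow>
      combination \<Lambda> I a = combination \<Lambda> I a' \<Longrightarrow> monomial ?H a u = monomial ?H a' u"
    using y(3) unfolding spec_an_relations by blast+
  show "y \<in> variety"
    unfolding variety_def
  proof (intro CollectI conjI ballI impI)
    show "y \<in> cspace envelope_coords"
      using y(2) u(1) by (auto simp: y(1) cspace_def split: sum.splits)
    fix a a' assume a: "a \<in> multi_indices envelope_coords" "a' \<in> multi_indices envelope_coords" "total a = total a'"
    have l: "a (Inl i) = a' (Inl i)" if "i < codim_supp \<Lambda> I" for i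
      using fun_cong[OF a(3), of "Inl i"] that by (simp add: total_case_sum)
    have "combination \<Lambda> I (a \<circ> Inr) = combination \<Lambda> I (a' \<circ> Inr)"
      using fun_cong[OF a(3), of "Inr _"] by (intro ext) (simp add: total_case_sum)
    then have "monomial ?H (a \<circ> Inr) u = monomial ?H (a' \<circ> Inr) u"
      by (rule u(2)[rotated 2]) (use a(1,2) in \<open>auto simp: multi_indices_def\<close>)
    moreover have "monomial {..<codim_supp \<Lambda> I} (a \<circ> Inl) x = monomial {..<codim_supp \<Lambda> I} (a' \<circ> Inl) x"
      unfolding monomial_def using l by (intro prod.cong) auto
    ultimately show "monomial envelope_coords a y = monomial envelope_coords a' y"
      unfolding mon yo by simp
  qed
qed

lemma target_eq: "target = toric_envelope \<Lambda> I"
proof -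
  have "toric_map \<Lambda> I 0 \<alpha> = 0" for \<alpha>
    using monomial_zero_arg[of "- I" \<alpha>] by (auto simp: toric_map_def hilbert_basis_def resonances_def)
  then have "case_sum 0 (toric_map \<Lambda> I 0) = (0 :: nat + ('n \<Rightarrow> nat) \<Rightarrow> complex)"
    by (simp add: fun_eq_iff split: sum.splits)
  then show ?thesis
    by (simp add: target_def toric_envelope_def variety_eq)
qed

lemma toric_envelope_normal: "normal_variety envelope_coords (pts (toric_envelope \<Lambda> I))"
  using normal_variety[OF semigroup_eq] unfolding target_eq[symmetric] by (simp add: target_def)

lemma toric_envelope_toric: "affine_toric_variety envelope_coords (pts (toric_envelope \<Lambda> I))"
  using affine_toric_variety unfolding target_eq[symmetric] by (simp add: target_def)

end

section \<open>Local leaves and first integrals\<close>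

lemma topspace_quotient_topology: "topspace (quotient_topology T q) = q ` topspace T"
proof (rule subset_antisym)
  show "topspace (quotient_topology T q) \<subseteq> q ` topspace T"
    using openin_quotient_topology[of T q] openin_topspace by blast
  have "{x \<in> topspace T. q x \<in> q ` topspace T} = topspace T" by blast
  then have "openin (quotient_topology T q) (q ` topspace T)"
    by (simp add: openin_quotient_topology)
  then show "q ` topspace T \<subseteq> topspace (quotient_topology T q)"
    by (rule openin_subset)
qed

lemma continuous_map_quotient_topology: "continuous_map T (quotient_topology T q) q"
  unfolding continuous_map_def by (auto simp: topspace_quotient_topology openin_quotient_topology)

lemma pairing_scaleR: "pairing l (x *\<^sub>R v) = of_real x * pairing l v"
  unfolding pairing_def by (simp add: sum_distrib_left) (simp add: scaleR_conv_of_real mult_ac)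

lemma pairing_add: "pairing l (u + v) = pairing l u + pairing l v"
  by (simp add: pairing_def distrib_left sum.distrib)

lemma pairing_0 [simp]: "pairing l 0 = 0"
  by (simp add: pairing_def)

lemma pairing_minus: "pairing l (- v) = - pairing l v"
  by (simp add: pairing_def sum_negf)

lemma isotropy_alg_scaleR: "v \<in> isotropy_alg \<Lambda> I \<Longrightarrow> x *\<^sub>R v \<in> isotropy_alg \<Lambda> I"
  by (simp add: isotropy_alg_def pairing_scaleR)

lemma isotropy_alg_add: "u \<in> isotropy_alg \<Lambda> I \<Longrightarrow> v \<in> isotropy_alg \<Lambda> I \<Longrightarrow> u + v \<in> isotropy_alg \<Lambda> I"
  by (simp add: isotropy_alg_def pairing_add)

lemma isotropy_alg_minus: "v \<in> isotropy_alg \<Lambda> I \<Longrightarrow> - v \<in> isotropy_alg \<Lambda> I"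
  by (simp add: isotropy_alg_def pairing_minus)

lemma isotropy_alg_0: "0 \<in> isotropy_alg \<Lambda> I"
  by (simp add: isotropy_alg_def)

lemma weight_scaleR: "weight \<Lambda> (x *\<^sub>R v) i = of_real x * weight \<Lambda> v i"
  by (simp add: weight_def pairing_scaleR split: sum.splits)

lemma transverse_act_0 [simp]: "transverse_act \<Lambda> 0 z = z"
  by (auto simp: transverse_act_def fun_eq_iff split: sum.splits)

lemma transverse_act_add: "transverse_act \<Lambda> u (transverse_act \<Lambda> v z) = transverse_act \<Lambda> (u + v) z"
  by (auto simp: transverse_act_def fun_eq_iff pairing_add exp_add mult.assoc split: sum.splits)

text \<open>The leaf topology is the quotient topology of the orbit map, so connected sets of
  parameters have connected images, whether or not the leaf is embedded.\<close>

lemma local_leaf_path: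
  assumes "C \<subseteq> isotropy_alg \<Lambda> I" "connected C" "0 \<in> C" "v \<in> C"
    and "\<And>u. u \<in> C \<Longrightarrow> transverse_act \<Lambda> u z \<in> U"
  shows "transverse_act \<Lambda> v z \<in> local_leaf \<Lambda> I U z"
proof -
  let ?q = "\<lambda>u. transverse_act \<Lambda> u z"
  have "connectedin (top_of_set (isotropy_alg \<Lambda> I)) C"
    using assms(1,2) by (simp add: connectedin_subtopology)
  then have "connectedin (leaf_topology \<Lambda> I z) (?q ` C)"
    unfolding leaf_topology_def
    by (rule connectedin_continuous_map_image[OF continuous_map_quotient_topology])
  then have "connectedin (subtopology (leaf_topology \<Lambda> I z) U) (?q ` C)"
    using assms(5) by (auto simp: connectedin_subtopology)
  moreover have "z \<in> ?q ` C"
    using assms(3) by (metis imageI transverse_act_0)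
  ultimately show ?thesis
    unfolding local_leaf_def connected_component_of_def using assms(4) by blast
qed

lemma local_leafE:
  assumes "z' \<in> local_leaf \<Lambda> I U z"
  obtains v where "v \<in> isotropy_alg \<Lambda> I" "z' = transverse_act \<Lambda> v z" "z' \<in> U"
proof -
  have "z' \<in> topspace (subtopology (leaf_topology \<Lambda> I z) U)"
    using assms connected_component_of_subset_topspace unfolding local_leaf_def by fastforce
  then have "z' \<in> U" "z' \<in> (\<lambda>v. transverse_act \<Lambda> v z) ` isotropy_alg \<Lambda> I"
    by (simp_all add: leaf_topology_def topspace_quotient_topology)
  then show thesis using that by blast
qed

lemma local_leaf_subset: "local_leaf \<Lambda> I U z \<subseteq> U"
  by (auto elim: local_leafE)

lemma local_leaf_refl: "z \<in> U \<Longrightarrow> z \<in> local_leaf \<Lambda> I U z"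
  using local_leaf_path[of "{0}" \<Lambda> I 0 z U] by (simp add: isotropy_alg_0)

lemma local_leaf_mono:
  assumes "U' \<subseteq> U"
  shows "local_leaf \<Lambda> I U' z \<subseteq> local_leaf \<Lambda> I U z"
  using assms unfolding local_leaf_def connected_component_of_def connectedin_subtopology by blast

text \<open>Moving the base point along the orbit translates the parameter space, and translations
  are homeomorphisms; hence the leaf topology belongs to the orbit. This makes the local leaves in
  \<open>U\<close> a partition.\<close>

lemma leaf_topology_act:
  assumes "v \<in> isotropy_alg \<Lambda> I"
  shows "leaf_topology \<Lambda> I (transverse_act \<Lambda> v z) = leaf_topology \<Lambda> I z"
proof -
  let ?h = "isotropy_alg \<Lambda> I"
  have sub: "openin (leaf_topology \<Lambda> I (transverse_act \<Lambda> v z)) V"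
    if v: "v \<in> ?h" and V: "openin (leaf_topology \<Lambda> I z) V" for v z V
  proof -
    have V': "V \<subseteq> (\<lambda>u. transverse_act \<Lambda> u z) ` ?h"
      "openin (top_of_set ?h) {u\<in>?h. transverse_act \<Lambda> u z \<in> V}"
      using V by (simp_all add: leaf_topology_def openin_quotient_topology)
    have "openin (top_of_set ?h) (?h \<inter> (\<lambda>u. u + v) -` {u\<in>?h. transverse_act \<Lambda> u z \<in> V})"
      by (rule continuous_openin_preimage[OF _ _ V'(2)])
        (use v isotropy_alg_add in \<open>auto intro!: continuous_intros\<close>)
    also have "?h \<inter> (\<lambda>u. u + v) -` {u\<in>?h. transverse_act \<Lambda> u z \<in> V} =
        {u\<in>?h. transverse_act \<Lambda> u (transverse_act \<Lambda> v z) \<in> V}"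
      using v isotropy_alg_add by (auto simp: transverse_act_add)
    finally have "openin (top_of_set ?h) {u\<in>?h. transverse_act \<Lambda> u (transverse_act \<Lambda> v z) \<in> V}" .
    moreover have "V \<subseteq> (\<lambda>u. transverse_act \<Lambda> u (transverse_act \<Lambda> v z)) ` ?h"
    proof
      fix y assume "y \<in> V"
      then obtain u where u: "u \<in> ?h" "y = transverse_act \<Lambda> u z" using V'(1) by blast
      have "u + - v \<in> ?h" using u(1) v isotropy_alg_add isotropy_alg_minus by blast
      moreover have "y = transverse_act \<Lambda> (u + - v) (transverse_act \<Lambda> v z)"
        by (simp add: transverse_act_add u(2))
      ultimately show "y \<in> (\<lambda>u. transverse_act \<Lambda> u (transverse_act \<Lambda> v z)) ` ?h" by blast
    qed
    ultimately show ?thesis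
      by (simp add: leaf_topology_def openin_quotient_topology)
  qed
  have "openin (leaf_topology \<Lambda> I z) V"
    if "openin (leaf_topology \<Lambda> I (transverse_act \<Lambda> v z)) V" for V
    using sub[OF isotropy_alg_minus[OF assms] that] by (simp add: transverse_act_add)
  then show ?thesis
    unfolding topology_eq using sub[OF assms] by blast
qed

lemma local_leaf_eq:
  assumes "z' \<in> local_leaf \<Lambda> I U z"
  shows "local_leaf \<Lambda> I U z' = local_leaf \<Lambda> I U z"
proof -
  obtain v where "v \<in> isotropy_alg \<Lambda> I" "z' = transverse_act \<Lambda> v z"
    by (rule local_leafE[OF assms])
  then have "leaf_topology \<Lambda> I z' = leaf_topology \<Lambda> I z"
    by (simp add: leaf_topology_act)
  then show ?thesis
    using assms unfolding local_leaf_def by (simp add: connected_component_of_equiv)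
qed

lemma envelope_map_act:
  assumes v: "v \<in> isotropy_alg \<Lambda> I"
  shows "envelope_map \<Lambda> I (transverse_act \<Lambda> v z) = envelope_map \<Lambda> I z"
proof -
  have "monomial (- I) \<alpha> (\<lambda>j. exp (pairing (\<Lambda> j) v) * z (Inr j)) = monomial (- I) \<alpha> (\<lambda>j. z (Inr j))"
    if "\<alpha> \<in> hilbert_basis (resonances \<Lambda> I)" for \<alpha>
  proof -
    have "(\<Sum>j\<in>- I. of_nat (\<alpha> j) * pairing (\<Lambda> j) v) = 0"
      using that hilbert_basis_resonances[of \<Lambda> I] v by (auto simp: resonances_def)
    then show ?thesis
      using monomial_exp[of "- I" \<alpha> 1 "\<lambda>j. pairing (\<Lambda> j) v"] by (simp add: monomial_scale)
  qed
  then have "toric_map \<Lambda> I (\<lambda>j. exp (pairing (\<Lambda> j) v) * z (Inr j)) = toric_map \<Lambda> I (\<lambda>j. z (Inr j))"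
    by (simp add: toric_map_def fun_eq_iff)
  then show ?thesis
    by (simp add: envelope_map_def transverse_act_def)
qed

lemma envelope_map_local_leaf:
  "z' \<in> local_leaf \<Lambda> I U z \<Longrightarrow> envelope_map \<Lambda> I z' = envelope_map \<Lambda> I z"
  by (elim local_leafE) (simp add: envelope_map_act)

text \<open>A vector \<open>x\<close> outside the span of the weights in \<open>I\<close> is
  separated from it by a linear functional, which is the pairing with some \<open>v\<close>. As all
  weights together span, not all of them can vanish on \<open>v\<close>.\<close>

lemma singular_direction:
  fixes \<Lambda> :: "'n::finite \<Rightarrow> complex^'k" and I :: "'n set"
  assumes span: "vec.span (range \<Lambda>) = UNIV" and sing: "singular_support \<Lambda> I"
  obtains v j where "v \<in> isotropy_alg \<Lambda> I" "j \<notin> I" "pairing (\<Lambda> j) v \<noteq> 0"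
proof -
  have "vec.dim (vec.span (\<Lambda> ` I)) < CARD('k)"
    using sing by (simp add: singular_support_def rank_supp_def)
  then have "vec.span (\<Lambda> ` I) \<noteq> UNIV"
    using vec_dim_card by (metis less_irrefl)
  then obtain x where x: "x \<notin> vec.span (\<Lambda> ` I)" by blast
  obtain T where T: "T \<subseteq> \<Lambda> ` I" "vec.independent T" "\<Lambda> ` I \<subseteq> vec.span T"
    using vec.maximal_independent_subset by blast
  have "x \<notin> vec.span T"
    using x vec.span_mono[OF T(1)] by blast
  then have "vec.independent (insert x T)"
    by (rule vec.independent_insertI[OF _ T(2)])
  then obtain g where g: "Vector_Spaces.linear (*s) (*s) g"
    "\<forall>y\<in>insert x T. g y = (if y = x then 1 else (0 :: complex^'k))"
    using vec.linear_independent_extend[of "insert x T" "\<lambda>y. if y = x then 1 else 0"] by blast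
  \<comment> \<open>\<open>g\<close> sends \<open>x\<close> to the vector with all entries 1, so
    each of its components is a functional with value 1 at \<open>x\<close>; the row
    \<open>undefined\<close> is an arbitrary choice among them.\<close>
  define v where "v = matrix g $ undefined"
  have pv: "pairing y v = g y $ undefined" for y
    using matrix_works[OF g(1), of y]
    by (simp add: pairing_def v_def matrix_vector_mult_def vec_eq_iff mult.commute)
  have "g y = 0" if "y \<in> T" for y
    using g(2) that \<open>x \<notin> vec.span T\<close> vec.span_base by auto
  then have g0: "g y = 0" if "y \<in> vec.span T" for y
    using vec.linear_eq_0_on_span[OF g(1)] that by blast
  have v: "v \<in> isotropy_alg \<Lambda> I"
    using g0 T(3) by (auto simp: isotropy_alg_def pv)
  have "\<exists>j. pairing (\<Lambda> j) v \<noteq> 0"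
  proof (rule ccontr)
    assume *: "\<not> ?thesis"
    have "pairing x v = 0"
    proof (rule vec.span_induct[of x "range \<Lambda>" "\<lambda>y. pairing y v = 0"])
      show "x \<in> vec.span (range \<Lambda>)" using span by simp
      show "vec.subspace {y. pairing y v = 0}"
        by (auto simp: vec.subspace_def pairing_def distrib_right sum.distrib
            mult.assoc sum_distrib_left[symmetric])
    qed (use * in auto)
    then show False using g(2) by (simp add: pv)
  qed
  then obtain j where j: "pairing (\<Lambda> j) v \<noteq> 0" by blast
  then have "j \<notin> I" using v by (auto simp: isotropy_alg_def)
  with v j show thesis by (intro that)
qed

section \<open>Non-separated leaves, first integrals and the universal property\<close>

context transverse
begin

lemma nbhd_polydisc:
  assumes "nbhd (transverse_model \<Lambda> I) U"
  obtains r where "0 < r" "polydisc model_coords 0 r \<subseteq> U"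
proof -
  have "openin (top_of_set (cspace model_coords)) U" "0 \<in> U"
    using assms by (simp_all add: nbhd_def transverse_model_def)
  then obtain r where "0 < r" "cspace model_coords \<inter> polydisc model_coords 0 r \<subseteq> U"
    unfolding openin_iff_polydisc[OF finite_A order_refl] by blast
  moreover have "cspace model_coords \<inter> polydisc model_coords 0 r = polydisc model_coords 0 r"
    by (auto simp: polydisc_def)
  ultimately show thesis using that by simp
qed

lemma local_leaf_scaled:
  assumes "v \<in> isotropy_alg \<Lambda> I" "0 \<le> t"
    and "\<And>s. 0 \<le> s \<Longrightarrow> s \<le> t \<Longrightarrow> transverse_act \<Lambda> (s *\<^sub>R v) z \<in> U"
  shows "transverse_act \<Lambda> (t *\<^sub>R v) z \<in> local_leaf \<Lambda> I U z"
proof (rule local_leaf_path[where C = "(\<lambda>s. s *\<^sub>R v) ` {0..t}"])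
  show "connected ((\<lambda>s. s *\<^sub>R v) ` {0..t})"
    by (intro connected_continuous_image continuous_intros) simp
  show "0 \<in> (\<lambda>s. s *\<^sub>R v) ` {0..t}"
    using assms(2) by (intro image_eqI[of _ _ 0]) auto
qed (use assms isotropy_alg_scaleR in auto)

text \<open>The complex multiple \<open>u x\<close> of \<open>v\<close> has weight \<open>x\<close>
  at \<open>j\<close> and moves a point of the axis by the real factor \<open>exp x\<close>. For
  \<open>x \<le> 0\<close> the point never leaves the polydisc, so the points of the axis with
  positive real coordinate up to \<open>r\<close> lie on one local leaf.\<close>

lemma punctured_disc_leaf:
  assumes "v \<in> isotropy_alg \<Lambda> I" "j \<notin> I" "pairing (\<Lambda> j) v \<noteq> 0"
    and "polydisc model_coords 0 r \<subseteq> U" "0 < s" "s \<le> r"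
  shows "(\<lambda>i. if i = Inr j then of_real s else 0) \<in>
    local_leaf \<Lambda> I U (\<lambda>i. if i = Inr j then of_real r else 0)"
proof -
  define \<mu> where "\<mu> = pairing (\<Lambda> j) v"
  define p where "p s = (\<lambda>i :: nat + 'n. if i = Inr j then complex_of_real s else 0)" for s
  define u where "u x = (\<chi> a. (complex_of_real x / \<mu>) * v $ a)" for x :: real
  have pu: "pairing l (u x) = (complex_of_real x / \<mu>) * pairing l v" for l x
    unfolding pairing_def u_def sum_distrib_left by (simp add: mult_ac)
  have u_in: "u x \<in> isotropy_alg \<Lambda> I" for x
    using assms(1) by (simp add: isotropy_alg_def pu)
  have act: "transverse_act \<Lambda> (u x) (p r) = p (exp x * r)" for x
  proof -
    have "pairing (\<Lambda> j) (u x) = complex_of_real x"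
      using assms(3) by (simp add: pu \<mu>_def)
    then show ?thesis
      by (auto simp: transverse_act_def p_def fun_eq_iff exp_of_real split: sum.splits)
  qed
  have r: "0 < r" using assms(5,6) by simp
  have pU: "p t \<in> U" if "0 < t" "t \<le> r" for t
  proof -
    have "p t \<in> polydisc model_coords 0 r"
      using that assms(2) by (auto simp: p_def polydisc_def cspace_def)
    then show ?thesis using assms(4) by blast
  qed
  have "transverse_act \<Lambda> (u (ln (s / r))) (p r) \<in> local_leaf \<Lambda> I U (p r)"
  proof (rule local_leaf_path[where C = "u ` {ln (s / r)..0}"])
    show "connected (u ` {ln (s / r)..0})"
      unfolding u_def using assms(3)
      by (intro connected_continuous_image continuous_intros) (auto simp: \<mu>_def)
    have "ln (s / r) \<le> 0" using assms(5,6) r by simp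
    moreover have "u 0 = 0" by (simp add: u_def vec_eq_iff)
    ultimately show "0 \<in> u ` {ln (s / r)..0}" "u (ln (s / r)) \<in> u ` {ln (s / r)..0}"
      by (auto intro: image_eqI[of _ u 0])
    fix w assume "w \<in> u ` {ln (s / r)..0}"
    then obtain x where x: "w = u x" "x \<le> 0" by auto
    have "exp x * r \<le> 1 * r" using x(2) r by (intro mult_right_mono) auto
    then show "transverse_act \<Lambda> w (p r) \<in> U"
      unfolding x(1) act using r by (intro pU) auto
  qed (use u_in in auto)
  moreover have "exp (ln (s / r)) * r = s"
    using assms(5) r by simp
  ultimately show ?thesis
    unfolding act by (simp add: p_def)
qed

lemma local_leaf_0: "local_leaf \<Lambda> I U 0 \<subseteq> {0}"
proof
  fix z assume "z \<in> local_leaf \<Lambda> I U 0"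
  then obtain v where "z = transverse_act \<Lambda> v 0" by (rule local_leafE)
  then show "z \<in> {0}" by (simp add: transverse_act_weight fun_eq_iff)
qed

text \<open>An open set of the quotient that contains the leaf of 0 has a neighbourhood of 0 as
  preimage. This meets the leaf accumulating at 0, so the open set contains that leaf too and cannot
  separate the two.\<close>

lemma not_t1_local_leaf_space:
  assumes v: "v \<in> isotropy_alg \<Lambda> I" "j \<notin> I" "pairing (\<Lambda> j) v \<noteq> 0"
    and U: "nbhd (transverse_model \<Lambda> I) U"
  shows "\<not> t1_space (local_leaf_space \<Lambda> I U)"
proof
  assume t1: "t1_space (local_leaf_space \<Lambda> I U)"
  define p where "p s = (\<lambda>i :: nat + 'n. if i = Inr j then complex_of_real s else 0)" for s
  obtain r where r: "0 < r" "polydisc model_coords 0 r \<subseteq> U"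
    by (rule nbhd_polydisc[OF U])
  have pd: "p t \<in> polydisc model_coords 0 r'" if "0 < t" "t \<le> r'" for t r'
    using that v(2) by (auto simp: p_def polydisc_def cspace_def)
  have oU: "openin (top_of_set (cspace model_coords)) U" and U0: "0 \<in> U"
    using U by (simp_all add: nbhd_def transverse_model_def)
  have pr: "p r \<in> U" using pd[of r r] r by auto
  have "p r \<noteq> 0"
    using r(1) by (auto simp: p_def fun_eq_iff)
  then have ne: "local_leaf \<Lambda> I U 0 \<noteq> local_leaf \<Lambda> I U (p r)"
    using local_leaf_refl[OF pr] local_leaf_0 by blast
  have top: "topspace (local_leaf_space \<Lambda> I U) = local_leaf \<Lambda> I U ` U"
    by (simp add: local_leaf_space_def topspace_quotient_topology)
  obtain V where V: "openin (local_leaf_space \<Lambda> I U) V" "local_leaf \<Lambda> I U 0 \<in> V" "local_leaf \<Lambda> I U (p r) \<notin> V"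
    using t1 ne U0 pr unfolding t1_space_def top by blast
  have "openin (top_of_set U) {z\<in>U. local_leaf \<Lambda> I U z \<in> V}"
    using V(1) by (simp add: local_leaf_space_def openin_quotient_topology)
  then have "openin (top_of_set (cspace model_coords)) {z\<in>U. local_leaf \<Lambda> I U z \<in> V}"
    using oU openin_trans by blast
  moreover have "0 \<in> {z\<in>U. local_leaf \<Lambda> I U z \<in> V}"
    using U0 V(2) by simp
  ultimately obtain d where d: "0 < d" "cspace model_coords \<inter> polydisc model_coords 0 d \<subseteq> {z\<in>U. local_leaf \<Lambda> I U z \<in> V}"
    unfolding openin_iff_polydisc[OF finite_A order_refl] by blast
  define s where "s = min d r"
  have s: "0 < s" "s \<le> d" "s \<le> r" using d r by (auto simp: s_def)
  have "p s \<in> polydisc model_coords 0 d" by (rule pd[OF s(1,2)])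
  then have "local_leaf \<Lambda> I U (p s) \<in> V"
    using d(2) by (auto simp: polydisc_def)
  moreover have "p s \<in> local_leaf \<Lambda> I U (p r)"
    unfolding p_def by (rule punctured_disc_leaf[OF v r(2) s(1,3)])
  ultimately show False
    using V(3) local_leaf_eq by metis
qed

lemma no_analytic_quotient:
  assumes v: "v \<in> isotropy_alg \<Lambda> I" "j \<notin> I" "pairing (\<Lambda> j) v \<noteq> 0"
    and Y: "analytic_germ Y" and F: "hol_map_germ (transverse_model \<Lambda> I) Y F"
    and U: "nbhd (transverse_model \<Lambda> I) U"
    and fib: "\<And>z. z \<in> U \<Longrightarrow> {z'\<in>U. F z' = F z} = local_leaf \<Lambda> I U z"
  shows False
proof -
  define p where "p s = (\<lambda>i :: nat + 'n. if i = Inr j then complex_of_real s else 0)" for s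
  have aX: "affine_germ (transverse_model \<Lambda> I)"
    using affine_source by (simp add: source_eq)
  have aY: "affine_germ Y" using Y by (rule analytic_imp_affine_germ)
  have "\<forall>\<^sub>F z in near (transverse_model \<Lambda> I). F z \<in> pts Y"
    using F by (simp add: hol_map_germ_def)
  then obtain W where W: "nbhd (transverse_model \<Lambda> I) W" "\<And>z. z \<in> W \<Longrightarrow> F z \<in> pts Y"
    using eventually_near_obtain_nbhd[OF aX] by blast
  obtain r where r: "0 < r" "polydisc model_coords 0 r \<subseteq> U \<inter> W"
    by (rule nbhd_polydisc[OF nbhd_Int[OF U W(1)]])
  have pd: "p t \<in> polydisc model_coords 0 r'" if "0 < t" "t \<le> r'" for t r'
    using that v(2) by (auto simp: p_def polydisc_def cspace_def)
  have prU: "p r \<in> U" and prW: "p r \<in> W" using pd[of r r] r by auto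
  have Fp: "F (p s) = F (p r)" if "0 < s" "s \<le> r" for s
  proof -
    have "p s \<in> local_leaf \<Lambda> I U (p r)"
      unfolding p_def by (rule punctured_disc_leaf[OF v _ that]) (use r(2) in blast)
    then show ?thesis using fib[OF prU] by blast
  qed
  \<comment> \<open>\<open>F\<close> takes the value \<open>F (p r)\<close> at points of the axis
    arbitrarily close to 0, where it tends to \<open>base Y\<close>; a coordinate in which the two
    differed would give a separating polydisc.\<close>
  have "F (p r) = base Y"
  proof (rule ccontr)
    assume "F (p r) \<noteq> base Y"
    then obtain k where k: "F (p r) k \<noteq> base Y k" by (auto simp: fun_eq_iff)
    have "F (p r) \<in> cspace (coords Y)" "base Y \<in> cspace (coords Y)"
      using W(2)[OF prW] aY by (auto simp: affine_germ_def)
    then have "k \<in> coords Y" using k by (cases "k \<in> coords Y") (auto simp: cspace_def)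
    then have "F (p r) \<notin> polydisc (coords Y) (base Y) (cmod (F (p r) k - base Y k) / 2)"
      using k by (auto simp: polydisc_def intro!: bexI[of _ k])
    then have "\<forall>\<^sub>F y in near Y. y \<noteq> F (p r)"
      unfolding eventually_near[OF aY] using k
      by (intro exI[of _ "cmod (F (p r) k - base Y k) / 2"]) auto
    then have "\<forall>\<^sub>F z in near (transverse_model \<Lambda> I). F z \<noteq> F (p r)"
      using hol_map_germ_filterlim[OF aX aY F] by (rule eventually_compose_filterlim)
    then obtain d where d: "0 < d" "\<And>z. z \<in> pts (transverse_model \<Lambda> I) \<inter>
        polydisc (coords (transverse_model \<Lambda> I)) (base (transverse_model \<Lambda> I)) d \<Longrightarrow> F z \<noteq> F (p r)"
      unfolding eventually_near[OF aX] by blast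
    define s where "s = min d r"
    have s: "0 < s" "s \<le> d" "s \<le> r" using d r by (auto simp: s_def)
    have "F (p s) \<noteq> F (p r)"
      by (rule d(2)) (use pd[OF s(1,2)] in \<open>auto simp: transverse_model_def polydisc_def\<close>)
    then show False using Fp[OF s(1,3)] by simp
  qed
  moreover have "F 0 = base Y"
    using F by (simp add: hol_map_germ_def transverse_model_def)
  moreover have "0 \<in> U"
    using U by (simp add: nbhd_def transverse_model_def)
  ultimately have "p r \<in> local_leaf \<Lambda> I U 0"
    using fib[of 0] prU by auto
  then have "p r = 0" using local_leaf_0 by blast
  then have "p r (Inr j) = 0" by simp
  then show False
    using r(1) by (simp add: p_def)
qed

text \<open>Local leaves shrink with the neighbourhood, so constancy on them is inherited; a map may
  then be replaced by one that agrees with it only on \<open>W\<close>.\<close>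

lemma const_on_leaves_small:
  assumes F: "const_on_leaves \<Lambda> I F" and W: "nbhd (transverse_model \<Lambda> I) W"
  obtains U where "nbhd (transverse_model \<Lambda> I) U" "U \<subseteq> W"
    "\<And>z z'. z \<in> U \<Longrightarrow> z' \<in> local_leaf \<Lambda> I U z \<Longrightarrow> F z' = F z"
proof -
  obtain U where U: "nbhd (transverse_model \<Lambda> I) U"
    "\<And>z z'. z \<in> U \<Longrightarrow> z' \<in> local_leaf \<Lambda> I U z \<Longrightarrow> F z' = F z"
    using F unfolding const_on_leaves_def by blast
  show thesis
  proof (rule that[OF nbhd_Int[OF U(1) W]])
    show "U \<inter> W \<subseteq> W" by blast
    show "F z' = F z" if "z \<in> U \<inter> W" "z' \<in> local_leaf \<Lambda> I (U \<inter> W) z" for z z'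
      using U(2)[of z z'] that local_leaf_mono[of "U \<inter> W" U] by blast
  qed
qed

lemma first_integral_factor:
  assumes f: "hol_at model_coords 0 f" and const: "const_on_leaves \<Lambda> I f"
  obtains g where "hol_at envelope_coords 0 g" "\<forall>\<^sub>F z in near source. g (mmap z) = f z"
proof -
  obtain U where U: "nbhd (transverse_model \<Lambda> I) U"
    "\<And>z z'. z \<in> U \<Longrightarrow> z' \<in> local_leaf \<Lambda> I U z \<Longrightarrow> f z' = f z"
    using const unfolding const_on_leaves_def by blast
  obtain r0 where r0: "0 < r0" "polydisc model_coords 0 r0 \<subseteq> U"
    by (rule nbhd_polydisc[OF U(1)])
  obtain r1 M where r1: "0 < r1" "series_bound model_coords 0 r1 M f"
    using f unfolding hol_at_iff_series_bound[OF finite_A zero_in_cspace] by blast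
  define r where "r = min r0 r1"
  have r: "0 < r" "r \<le> r0" "r \<le> r1" using r0(1) r1(1) by (auto simp: r_def)
  have rU: "polydisc model_coords 0 r \<subseteq> U"
    using polydisc_mono[OF r(2)] r0(2) by blast
  have "series_bound model_coords 0 r M f"
    by (rule series_bound_mono[OF r1(2)]) (use r in auto)
  then obtain c where c: "(\<lambda>\<alpha>. cmod (c \<alpha>) * r ^ mdeg model_coords \<alpha>) summable_on multi_indices model_coords"
    "\<forall>z\<in>polydisc model_coords 0 r.
      ((\<lambda>\<alpha>. c \<alpha> * monomial model_coords \<alpha> (z - 0)) has_sum f z) (multi_indices model_coords)"
    unfolding series_bound_def by blast
  have c2: "((\<lambda>\<alpha>. c \<alpha> * monomial model_coords \<alpha> z) has_sum f z) (multi_indices model_coords)"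
    if "z \<in> polydisc model_coords 0 r" for z
    using c(2) that by simp
  have "c \<alpha> = 0" if \<alpha>: "\<alpha> \<in> multi_indices model_coords" "\<alpha> \<notin> semigroup" for \<alpha>
  proof -
    \<comment> \<open>An exponent outside the semigroup violates the weight equation of some
      \<open>v\<close>, and invariance is tested in this direction.\<close>
    obtain v where v: "v \<in> isotropy_alg \<Lambda> I" "(\<Sum>i\<in>model_coords. of_nat (\<alpha> i) * weight \<Lambda> v i) \<noteq> 0"
      using \<alpha> unfolding semigroup_eq by blast
    obtain d where d: "0 < d" "d \<le> r"
      "\<And>t z. 0 \<le> t \<Longrightarrow> t \<le> 1 \<Longrightarrow> z \<in> polydisc model_coords 0 d \<Longrightarrow>
        (\<lambda>i. exp (of_real t * weight \<Lambda> v i) * z i) \<in> polydisc model_coords 0 r"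
      by (rule exp_scale_polydisc[OF finite_A r(1), of "weight \<Lambda> v"]) (rule that)
    have act: "(\<lambda>i. exp (of_real t * weight \<Lambda> v i) * z i) = transverse_act \<Lambda> (t *\<^sub>R v) z" for t z
      by (simp add: transverse_act_weight weight_scaleR)
    show ?thesis
    proof (rule invariant_series_support[OF finite_A r(1) zero_less_one c2 d(1,2) _ \<alpha>(1) v(2)])
      fix t :: real and z assume t: "0 < t" "t \<le> 1" and z: "z \<in> polydisc model_coords 0 d"
      \<comment> \<open>All earlier times also keep the point in the polydisc inside
        \<open>U\<close>, so the end point is on the same local leaf, where \<open>f\<close> is
        known to be constant; being on the same orbit would not be enough.\<close>
      have "transverse_act \<Lambda> (t *\<^sub>R v) z \<in> local_leaf \<Lambda> I U z"
        by (rule local_leaf_scaled[OF v(1)]) (use t d(3)[OF _ _ z] rU in \<open>auto simp: act\<close>)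
      moreover have "z \<in> U" using z polydisc_mono[OF d(2)] rU by blast
      ultimately show "(\<lambda>i. exp (of_real t * weight \<Lambda> v i) * z i) \<in> polydisc model_coords 0 r \<and>
          f (\<lambda>i. exp (of_real t * weight \<Lambda> v i) * z i) = f z"
        using U(2) d(3)[of t z] t z unfolding act by simp
    qed
  qed
  from hol_factor[OF r(1) c(1) c2 this] that show thesis by blast
qed

lemma eventually_mmap_eq: "\<forall>\<^sub>F z in near source. mmap z = envelope_map \<Lambda> I z"
  using eventually_near_pts[of source] by eventually_elim (simp add: source_def mmap_eq)

text \<open>The index type of \<open>Y\<close> is left free, since a descended germ takes values in
  another envelope, whose coordinates are not indexed by natural numbers. Each coordinate of
  \<open>F\<close> is replaced by a holomorphic function agreeing with it near 0, which is a first
  integral on a smaller neighbourhood.\<close>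

lemma envelope_universal:
  assumes Y: "analytic_germ Y" and F: "hol_map_germ (transverse_model \<Lambda> I) Y F"
    and const: "const_on_leaves \<Lambda> I F"
  obtains G where "hol_map_germ (toric_envelope \<Lambda> I) Y G"
    "\<forall>\<^sub>F z in near (transverse_model \<Lambda> I). G (envelope_map \<Lambda> I z) = F z"
proof -
  have F': "hol_map_germ source Y F" using F by (simp add: source_eq)
  have "\<exists>g. hol_at envelope_coords 0 g \<and> (\<forall>\<^sub>F z in near source. g (mmap z) = F z j)"
    if j: "j \<in> coords Y" for j
  proof -
    obtain f where f: "hol_at model_coords 0 f" "\<forall>\<^sub>F z in near source. F z j = f z"
      using F' j by (auto simp: hol_map_germ_def source_def)
    obtain W where W: "nbhd source W" "\<And>z. z \<in> W \<Longrightarrow> F z j = f z"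
      using eventually_near_obtain_nbhd[OF affine_source f(2)] by blast
    obtain U where U: "nbhd (transverse_model \<Lambda> I) U" "U \<subseteq> W"
      "\<And>z z'. z \<in> U \<Longrightarrow> z' \<in> local_leaf \<Lambda> I U z \<Longrightarrow> F z' = F z"
      by (rule const_on_leaves_small[OF const W(1)[unfolded source_eq]]) (rule that)
    have "f z' = f z" if "z \<in> U" "z' \<in> local_leaf \<Lambda> I U z" for z z'
    proof -
      have "z' \<in> U" using that(2) local_leaf_subset by blast
      then show ?thesis using W(2) U(2) U(3)[OF that] that(1) by (metis subsetD)
    qed
    then have "const_on_leaves \<Lambda> I f"
      unfolding const_on_leaves_def using U(1) by blast
    then obtain g where g: "hol_at envelope_coords 0 g" "\<forall>\<^sub>F z in near source. g (mmap z) = f z"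
      by (rule first_integral_factor[OF f(1)])
    from g(2) f(2) have "\<forall>\<^sub>F z in near source. g (mmap z) = F z j"
      by eventually_elim simp
    with g(1) show ?thesis by blast
  qed
  then obtain G where G: "hol_map_germ target Y G" "\<forall>\<^sub>F z in near source. G (mmap z) = F z"
    by (rule hol_map_factor[OF Y F'])
  from G(2) eventually_mmap_eq have "\<forall>\<^sub>F z in near source. G (envelope_map \<Lambda> I z) = F z"
    by eventually_elim simp
  then show thesis
    using that[OF G(1)[unfolded target_eq]] by (simp add: source_eq)
qed

lemma affine_transverse_model: "affine_germ (transverse_model \<Lambda> I)"
  using affine_source by (simp add: source_eq)

lemma affine_toric_envelope: "affine_germ (toric_envelope \<Lambda> I)"
  using affine_target by (simp add: target_eq)

lemma analytic_toric_envelope: "analytic_germ (toric_envelope \<Lambda> I)"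
  using analytic_target by (simp add: target_eq)

lemma hol_map_envelope_map: "hol_map_germ (transverse_model \<Lambda> I) (toric_envelope \<Lambda> I) (envelope_map \<Lambda> I)"
proof -
  have "\<forall>\<^sub>F z in near source. envelope_map \<Lambda> I z = mmap z"
    using eventually_mmap_eq by eventually_elim simp
  from hol_map_germ_cong[OF affine_source hol_map_mmap this] show ?thesis
    by (simp add: source_eq target_eq)
qed

lemma const_on_leaves_envelope_map: "const_on_leaves \<Lambda> I (envelope_map \<Lambda> I)"
  unfolding const_on_leaves_def
  using nbhd_pts[OF affine_transverse_model] envelope_map_local_leaf by blast

lemma envelope_unique:
  assumes Y: "affine_germ Y"
    and G: "hol_map_germ (toric_envelope \<Lambda> I) Y G" "hol_map_germ (toric_envelope \<Lambda> I) Y G'"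
    and eq: "\<forall>\<^sub>F z in near (transverse_model \<Lambda> I). G (envelope_map \<Lambda> I z) = G' (envelope_map \<Lambda> I z)"
  shows "\<forall>\<^sub>F y in near (toric_envelope \<Lambda> I). G y = G' y"
proof -
  from eq[folded source_eq] eventually_mmap_eq have "\<forall>\<^sub>F z in near source. G (mmap z) = G' (mmap z)"
    by eventually_elim simp
  from hol_map_target_unique[OF Y G[folded target_eq] this] show ?thesis
    by (simp add: target_eq)
qed

lemma analytic_envelope_toric: "analytic_envelope \<Lambda> I (toric_envelope \<Lambda> I) (envelope_map \<Lambda> I)"
  unfolding analytic_envelope_def
proof (intro conjI allI impI analytic_toric_envelope hol_map_envelope_map const_on_leaves_envelope_map; (elim conjE)?)
  fix Y :: "nat germ_space" and F
  assume Y: "analytic_germ Y" and F: "hol_map_germ (transverse_model \<Lambda> I) Y F" "const_on_leaves \<Lambda> I F"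
  obtain G where G: "hol_map_germ (toric_envelope \<Lambda> I) Y G"
    "\<forall>\<^sub>F z in near (transverse_model \<Lambda> I). G (envelope_map \<Lambda> I z) = F z"
    by (rule envelope_universal[OF Y F])
  have "\<forall>\<^sub>F y in near (toric_envelope \<Lambda> I). G' y = G y"
    if G': "hol_map_germ (toric_envelope \<Lambda> I) Y G'"
      "\<forall>\<^sub>F z in near (transverse_model \<Lambda> I). G' (envelope_map \<Lambda> I z) = F z" for G'
  proof (rule envelope_unique[OF analytic_imp_affine_germ[OF Y] G'(1) G(1)])
    from G'(2) G(2) show "\<forall>\<^sub>F z in near (transverse_model \<Lambda> I).
        G' (envelope_map \<Lambda> I z) = G (envelope_map \<Lambda> I z)"
      by eventually_elim simp
  qed
  with G show "\<exists>G. hol_map_germ (toric_envelope \<Lambda> I) Y G \<and>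
      (\<forall>\<^sub>F z in near (transverse_model \<Lambda> I). G (envelope_map \<Lambda> I z) = F z) \<and>
      (\<forall>G'. hol_map_germ (toric_envelope \<Lambda> I) Y G' \<and>
        (\<forall>\<^sub>F z in near (transverse_model \<Lambda> I). G' (envelope_map \<Lambda> I z) = F z) \<longrightarrow>
        (\<forall>\<^sub>F y in near (toric_envelope \<Lambda> I). G' y = G y))"
    by blast
qed

end

section \<open>Foliated germs and the induced action on the envelope\<close>

lemma nbhd_openin_trans:
  assumes "nbhd X U" "openin (top_of_set U) S" "base X \<in> S"
  shows "nbhd X S"
  using openin_trans[OF assms(2)] assms(1,3) by (simp add: nbhd_def)

lemma nbhd_subset_openin:
  assumes "nbhd X S" "nbhd X U" "S \<subseteq> U"
  shows "openin (top_of_set U) S"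
proof (rule openin_subset_trans[OF _ assms(3)])
  show "openin (top_of_set (pts X)) S" "U \<subseteq> pts X"
    using assms(1,2) openin_imp_subset by (auto simp: nbhd_def)
qed

text \<open>The inverse identities hold only near the base points. Restricting the domains and
  taking a preimage once on each side gives a neighbourhood that is carried homeomorphically onto a
  neighbourhood, inside any prescribed \<open>W\<close>.\<close>

lemma biholo_germ_homeomorphism:
  assumes X: "affine_germ X" and Y: "affine_germ Y" and h: "biholo_germ X Y h" and W: "nbhd X W"
  obtains U \<psi> where "nbhd X U" "U \<subseteq> W" "nbhd Y (h ` U)" "homeomorphism U (h ` U) h \<psi>"
    "biholo_germ Y X \<psi>" "\<forall>\<^sub>F x in near X. \<psi> (h x) = x" "\<forall>\<^sub>F y in near Y. h (\<psi> y) = y"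
proof -
  obtain \<psi> where \<psi>: "hol_map_germ Y X \<psi>" "\<forall>\<^sub>F x in near X. \<psi> (h x) = x" "\<forall>\<^sub>F y in near Y. h (\<psi> y) = y"
    and hh: "hol_map_germ X Y h"
    using h by (auto simp: biholo_germ_def)
  obtain U1 where U1: "nbhd X U1" "continuous_on U1 h" "h ` U1 \<subseteq> pts Y"
    by (rule hol_map_germ_continuous[OF X Y hh])
  obtain U2 where U2: "nbhd Y U2" "continuous_on U2 \<psi>" "\<psi> ` U2 \<subseteq> pts X"
    by (rule hol_map_germ_continuous[OF Y X \<psi>(1)])
  obtain W1 where W1: "nbhd X W1" "\<And>x. x \<in> W1 \<Longrightarrow> \<psi> (h x) = x"
    using eventually_near_obtain_nbhd[OF X \<psi>(2)] by blast
  obtain W2 where W2: "nbhd Y W2" "\<And>y. y \<in> W2 \<Longrightarrow> h (\<psi> y) = y"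
    using eventually_near_obtain_nbhd[OF Y \<psi>(3)] by blast
  define D where "D = U1 \<inter> W1 \<inter> W"
  define D' where "D' = U2 \<inter> W2"
  have D: "nbhd X D" and D': "nbhd Y D'"
    using U1(1) W1(1) W U2(1) W2(1) by (auto simp: D_def D'_def intro: nbhd_Int)
  \<comment> \<open>The points of the target whose image under \<psi> lies in the good domain
    \<open>D\<close>; with \<open>U\<close> the preimage of \<open>V\<close> in \<open>D\<close>,
    the image of \<open>U\<close> is all of \<open>V\<close>.\<close>
  define V where "V = D' \<inter> \<psi> -` D"
  define U where "U = D \<inter> h -` V"
  have base: "h (base X) = base Y" "\<psi> (base Y) = base X"
    using hh \<psi>(1) by (simp_all add: hol_map_germ_def)
  have "openin (top_of_set D') V"
    unfolding V_def
    by (rule continuous_openin_preimage[of _ _ "pts X"])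
      (use U2 D in \<open>auto simp: D'_def nbhd_def intro: continuous_on_subset\<close>)
  then have V: "nbhd Y V"
    by (rule nbhd_openin_trans[OF D']) (use base D D' in \<open>auto simp: V_def nbhd_def\<close>)
  have "openin (top_of_set D) U"
    unfolding U_def
    by (rule continuous_openin_preimage[of _ _ "pts Y"])
      (use U1 V in \<open>auto simp: D_def nbhd_def intro: continuous_on_subset\<close>)
  then have U: "nbhd X U"
    by (rule nbhd_openin_trans[OF D]) (use base D V in \<open>auto simp: U_def nbhd_def\<close>)
  have "h ` U = V"
  proof (intro equalityI subsetI)
    fix y assume y: "y \<in> V"
    then have "h (\<psi> y) = y" using W2(2) by (auto simp: V_def D'_def)
    moreover have "\<psi> y \<in> U"
      using y \<open>h (\<psi> y) = y\<close> by (auto simp: U_def V_def)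
    ultimately show "y \<in> h ` U" by (metis imageI)
  qed (auto simp: U_def)
  have hom: "homeomorphism U (h ` U) h \<psi>"
  proof (rule homeomorphismI)
    show "continuous_on U h"
      by (rule continuous_on_subset[OF U1(2)]) (auto simp: U_def D_def)
    show "continuous_on (h ` U) \<psi>"
      unfolding \<open>h ` U = V\<close> by (rule continuous_on_subset[OF U2(2)]) (auto simp: V_def D'_def)
    show "\<psi> ` h ` U \<subseteq> U"
      using W1(2) by (auto simp: U_def D_def)
  qed (use W1(2) in \<open>auto simp: U_def D_def\<close>)
  have "biholo_germ Y X \<psi>"
    unfolding biholo_germ_def using \<psi> hh by blast
  show thesis
  proof (rule that[OF U _ _ hom \<open>biholo_germ Y X \<psi>\<close> \<psi>(2,3)])
    show "U \<subseteq> W" by (auto simp: U_def D_def)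
    show "nbhd Y (h ` U)" using V \<open>h ` U = V\<close> by simp
  qed
qed

lemma homeomorphism_nbhd_image:
  assumes "nbhd X U" "nbhd Y (h ` U)" "homeomorphism U (h ` U) h \<psi>" "h (base X) = base Y"
    and "nbhd X S" "S \<subseteq> U"
  shows "nbhd Y (h ` S)"
proof (rule nbhd_openin_trans[OF assms(2)])
  show "openin (top_of_set (h ` U)) (h ` S)"
    by (rule homeomorphism_imp_open_map[OF assms(3) nbhd_subset_openin[OF assms(5,1,6)]])
  show "base Y \<in> h ` S"
    using assms(5) imageI[of "base X" S h] unfolding nbhd_def assms(4) by blast
qed

lemma affine_transverse_model: "affine_germ (transverse_model \<Lambda> I)"
  by (rule transverse.affine_transverse_model)

lemma affine_toric_envelope: "affine_germ (toric_envelope \<Lambda> I)"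
  by (rule transverse.affine_toric_envelope)

lemma foliated_germ_nbhd:
  assumes "foliated_germ \<Lambda> I I' h"
  obtains U where "nbhd (transverse_model \<Lambda> I) U"
    "\<And>V z. nbhd (transverse_model \<Lambda> I) V \<Longrightarrow> V \<subseteq> U \<Longrightarrow> z \<in> V \<Longrightarrow>
      bij_betw h (local_leaf \<Lambda> I V z) (local_leaf \<Lambda> I' (h ` V) (h z))"
proof -
  obtain U where U: "nbhd (transverse_model \<Lambda> I) U" "\<forall>V. nbhd (transverse_model \<Lambda> I) V \<and> V \<subseteq> U \<longrightarrow>
      (\<forall>z\<in>V. bij_betw h (local_leaf \<Lambda> I V z) (local_leaf \<Lambda> I' (h ` V) (h z)))"
    using assms unfolding foliated_germ_def by (elim conjE exE)
  show thesis
    by (rule that[OF U(1)]) (use U(2) in simp)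
qed

text \<open>Puts a homeomorphic representative and the leaf correspondence for all smaller
  neighbourhoods on one common domain; composing and inverting germs uses both.\<close>

lemma foliated_germE:
  assumes "foliated_germ \<Lambda> I I' h" and W: "nbhd (transverse_model \<Lambda> I) W"
  obtains U \<psi> where "nbhd (transverse_model \<Lambda> I) U" "U \<subseteq> W" "nbhd (transverse_model \<Lambda> I') (h ` U)"
    "homeomorphism U (h ` U) h \<psi>" "biholo_germ (transverse_model \<Lambda> I') (transverse_model \<Lambda> I) \<psi>"
    "\<forall>\<^sub>F x in near (transverse_model \<Lambda> I). \<psi> (h x) = x"
    "\<forall>\<^sub>F y in near (transverse_model \<Lambda> I'). h (\<psi> y) = y"
    "\<And>V z. nbhd (transverse_model \<Lambda> I) V \<Longrightarrow> V \<subseteq> U \<Longrightarrow> z \<in> V \<Longrightarrow>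
      bij_betw h (local_leaf \<Lambda> I V z) (local_leaf \<Lambda> I' (h ` V) (h z))"
    "\<And>V. nbhd (transverse_model \<Lambda> I) V \<Longrightarrow> V \<subseteq> U \<Longrightarrow> nbhd (transverse_model \<Lambda> I') (h ` V)"
proof -
  have bi: "biholo_germ (transverse_model \<Lambda> I) (transverse_model \<Lambda> I') h"
    using assms(1) by (simp add: foliated_germ_def)
  obtain U0 where U0: "nbhd (transverse_model \<Lambda> I) U0"
    "\<And>V z. nbhd (transverse_model \<Lambda> I) V \<Longrightarrow> V \<subseteq> U0 \<Longrightarrow> z \<in> V \<Longrightarrow>
      bij_betw h (local_leaf \<Lambda> I V z) (local_leaf \<Lambda> I' (h ` V) (h z))"
    by (rule foliated_germ_nbhd[OF assms(1)]) (rule that)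
  obtain U \<psi> where U: "nbhd (transverse_model \<Lambda> I) U" "U \<subseteq> U0 \<inter> W" "nbhd (transverse_model \<Lambda> I') (h ` U)"
    "homeomorphism U (h ` U) h \<psi>" "biholo_germ (transverse_model \<Lambda> I') (transverse_model \<Lambda> I) \<psi>"
    "\<forall>\<^sub>F x in near (transverse_model \<Lambda> I). \<psi> (h x) = x"
    "\<forall>\<^sub>F y in near (transverse_model \<Lambda> I'). h (\<psi> y) = y"
    by (rule biholo_germ_homeomorphism[OF affine_transverse_model affine_transverse_model bi
          nbhd_Int[OF U0(1) W]])
  have base: "h (base (transverse_model \<Lambda> I)) = base (transverse_model \<Lambda> I')"
    using bi by (simp add: biholo_germ_def hol_map_germ_def)
  show thesis
  proof (rule that[OF U(1) _ U(3-7)])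
    show "U \<subseteq> W" using U(2) by blast
    show "bij_betw h (local_leaf \<Lambda> I V z) (local_leaf \<Lambda> I' (h ` V) (h z))"
      if "nbhd (transverse_model \<Lambda> I) V" "V \<subseteq> U" "z \<in> V" for V z
      using U0(2)[OF that(1) _ that(3)] that(2) U(2) by blast
    show "nbhd (transverse_model \<Lambda> I') (h ` V)"
      if "nbhd (transverse_model \<Lambda> I) V" "V \<subseteq> U" for V
      by (rule homeomorphism_nbhd_image[OF U(1,3,4) base that])
  qed
qed

text \<open>\<open>h\<close> carries local leaves onto local leaves, and the envelope map is
  constant even on whole orbits.\<close>

lemma foliated_germ_const:
  assumes "foliated_germ \<Lambda> I I' h"
  shows "const_on_leaves \<Lambda> I (envelope_map \<Lambda> I' \<circ> h)"
proof -
  obtain U where U: "nbhd (transverse_model \<Lambda> I) U"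
    "\<And>V z. nbhd (transverse_model \<Lambda> I) V \<Longrightarrow> V \<subseteq> U \<Longrightarrow> z \<in> V \<Longrightarrow>
      bij_betw h (local_leaf \<Lambda> I V z) (local_leaf \<Lambda> I' (h ` V) (h z))"
    by (rule foliated_germ_nbhd[OF assms]) (rule that)
  have "(envelope_map \<Lambda> I' \<circ> h) z' = (envelope_map \<Lambda> I' \<circ> h) z"
    if "z \<in> U" "z' \<in> local_leaf \<Lambda> I U z" for z z'
  proof -
    have "h z' \<in> local_leaf \<Lambda> I' (h ` U) (h z)"
      using bij_betw_imp_surj_on[OF U(2)[OF U(1) order_refl that(1)]] that(2) by blast
    then show ?thesis by (simp add: envelope_map_local_leaf)
  qed
  then show ?thesis
    unfolding const_on_leaves_def using U(1) by blast
qed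

lemma foliated_germ_id: "foliated_germ \<Lambda> I I id"
  unfolding foliated_germ_def
proof (intro conjI exI[of _ "pts (transverse_model \<Lambda> I)"])
  show "biholo_germ (transverse_model \<Lambda> I) (transverse_model \<Lambda> I) id"
    by (rule biholo_germ_id[OF affine_transverse_model])
  show "nbhd (transverse_model \<Lambda> I) (pts (transverse_model \<Lambda> I))"
    by (rule nbhd_pts[OF affine_transverse_model])
qed simp

text \<open>The leaf condition of \<open>k\<close> concerns neighbourhoods inside \<open>U'\<close>,
  so the domain of \<open>h\<close> is shrunk until its image lies there; images of smaller
  neighbourhoods are again neighbourhoods, to which that condition applies.\<close>

lemma foliated_germ_compose:
  assumes h: "foliated_germ \<Lambda> I I' h" and k: "foliated_germ \<Lambda> I' I'' k"
  shows "foliated_germ \<Lambda> I I'' (k \<circ> h)"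
proof -
  have bi: "biholo_germ (transverse_model \<Lambda> I) (transverse_model \<Lambda> I') h"
    "biholo_germ (transverse_model \<Lambda> I') (transverse_model \<Lambda> I'') k"
    using h k by (simp_all add: foliated_germ_def)
  obtain U' where U': "nbhd (transverse_model \<Lambda> I') U'"
    "\<And>V z. nbhd (transverse_model \<Lambda> I') V \<Longrightarrow> V \<subseteq> U' \<Longrightarrow> z \<in> V \<Longrightarrow>
      bij_betw k (local_leaf \<Lambda> I' V z) (local_leaf \<Lambda> I'' (k ` V) (k z))"
    by (rule foliated_germ_nbhd[OF k]) (rule that)
  have "hol_map_germ (transverse_model \<Lambda> I) (transverse_model \<Lambda> I') h"
    using bi(1) by (simp add: biholo_germ_def)
  then have "\<forall>\<^sub>F z in near (transverse_model \<Lambda> I). h z \<in> U'"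
    by (intro eventually_compose_filterlim[OF eventually_near_nbhd[OF U'(1)]]
        hol_map_germ_filterlim[OF affine_transverse_model affine_transverse_model])
  then obtain W where W: "nbhd (transverse_model \<Lambda> I) W" "\<And>z. z \<in> W \<Longrightarrow> h z \<in> U'"
    using eventually_near_obtain_nbhd[OF affine_transverse_model] by blast
  obtain U \<psi> where U: "nbhd (transverse_model \<Lambda> I) U" "U \<subseteq> W" "nbhd (transverse_model \<Lambda> I') (h ` U)"
    "homeomorphism U (h ` U) h \<psi>" "biholo_germ (transverse_model \<Lambda> I') (transverse_model \<Lambda> I) \<psi>"
    "\<forall>\<^sub>F x in near (transverse_model \<Lambda> I). \<psi> (h x) = x"
    "\<forall>\<^sub>F y in near (transverse_model \<Lambda> I'). h (\<psi> y) = y"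
    and leaf: "\<And>V z. nbhd (transverse_model \<Lambda> I) V \<Longrightarrow> V \<subseteq> U \<Longrightarrow> z \<in> V \<Longrightarrow>
      bij_betw h (local_leaf \<Lambda> I V z) (local_leaf \<Lambda> I' (h ` V) (h z))"
    and img: "\<And>V. nbhd (transverse_model \<Lambda> I) V \<Longrightarrow> V \<subseteq> U \<Longrightarrow> nbhd (transverse_model \<Lambda> I') (h ` V)"
    by (rule foliated_germE[OF h W(1)]) (rule that)
  have "bij_betw (k \<circ> h) (local_leaf \<Lambda> I V z) (local_leaf \<Lambda> I'' ((k \<circ> h) ` V) ((k \<circ> h) z))"
    if V: "nbhd (transverse_model \<Lambda> I) V" "V \<subseteq> U" "z \<in> V" for V z
  proof -
    have "h ` V \<subseteq> U'" using V(2) U(2) W(2) by blast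
    then have "bij_betw k (local_leaf \<Lambda> I' (h ` V) (h z)) (local_leaf \<Lambda> I'' (k ` h ` V) (k (h z)))"
      using U'(2)[OF img[OF V(1,2)]] V(3) by blast
    from bij_betw_trans[OF leaf[OF V] this] show ?thesis by (simp add: image_comp)
  qed
  then show ?thesis
    unfolding foliated_germ_def
    using biholo_germ_compose[OF affine_transverse_model affine_transverse_model affine_transverse_model bi]
      U(1) by blast
qed

text \<open>The leaf condition speaks of every small neighbourhood and its exact image, so it can be
  read backwards: a small neighbourhood \<open>V\<close> in the target is the image under
  \<open>h\<close> of its image under \<psi>, and the bijection of leaves there is inverted.\<close>

lemma foliated_germ_inverse:
  assumes h: "foliated_germ \<Lambda> I I' h"
  obtains \<psi> where "foliated_germ \<Lambda> I' I \<psi>" "\<forall>\<^sub>F x in near (transverse_model \<Lambda> I). \<psi> (h x) = x"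
    "\<forall>\<^sub>F y in near (transverse_model \<Lambda> I'). h (\<psi> y) = y"
proof -
  obtain U \<psi> where U: "nbhd (transverse_model \<Lambda> I) U" "U \<subseteq> pts (transverse_model \<Lambda> I)"
    "nbhd (transverse_model \<Lambda> I') (h ` U)"
    "homeomorphism U (h ` U) h \<psi>" and \<psi>: "biholo_germ (transverse_model \<Lambda> I') (transverse_model \<Lambda> I) \<psi>"
    "\<forall>\<^sub>F x in near (transverse_model \<Lambda> I). \<psi> (h x) = x"
    "\<forall>\<^sub>F y in near (transverse_model \<Lambda> I'). h (\<psi> y) = y"
    and leaf: "\<And>V z. nbhd (transverse_model \<Lambda> I) V \<Longrightarrow> V \<subseteq> U \<Longrightarrow> z \<in> V \<Longrightarrow>
      bij_betw h (local_leaf \<Lambda> I V z) (local_leaf \<Lambda> I' (h ` V) (h z))"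
    and "\<And>V. nbhd (transverse_model \<Lambda> I) V \<Longrightarrow> V \<subseteq> U \<Longrightarrow> nbhd (transverse_model \<Lambda> I') (h ` V)"
    by (rule foliated_germE[OF h nbhd_pts[OF affine_transverse_model]]) (rule that)
  have inv: "\<psi> (h x) = x" if "x \<in> U" for x
    using U(4) that by (auto simp: homeomorphism_def)
  have img: "\<psi> ` (h ` U) = U"
    using U(4) by (auto simp: homeomorphism_def)
  have base: "\<psi> (base (transverse_model \<Lambda> I')) = base (transverse_model \<Lambda> I)"
    using \<psi>(1) by (simp add: biholo_germ_def hol_map_germ_def)
  have "bij_betw \<psi> (local_leaf \<Lambda> I' V y) (local_leaf \<Lambda> I (\<psi> ` V) (\<psi> y))"
    if V: "nbhd (transverse_model \<Lambda> I') V" "V \<subseteq> h ` U" "y \<in> V" for V y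
  proof -
    have "homeomorphism (h ` U) (\<psi> ` (h ` U)) \<psi> h"
      unfolding img using U(4) by (rule homeomorphism_symD)
    from homeomorphism_nbhd_image[OF U(3) _ this base V(1,2)] U(1)
    have nV: "nbhd (transverse_model \<Lambda> I) (\<psi> ` V)"
      by (simp add: img)
    have sub: "\<psi> ` V \<subseteq> U" using V(2) img by blast
    have hV: "h ` \<psi> ` V = V"
      using V(2) inv by (force simp: image_iff)
    have hy: "h (\<psi> y) = y"
      using V(2,3) inv by auto
    have bij: "bij_betw h (local_leaf \<Lambda> I (\<psi> ` V) (\<psi> y)) (local_leaf \<Lambda> I' V y)"
      using leaf[OF nV sub, of "\<psi> y"] V(3) unfolding hV hy by blast
    have inv': "\<psi> (h x) = x" if "x \<in> local_leaf \<Lambda> I (\<psi> ` V) (\<psi> y)" for x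
      using that local_leaf_subset sub inv by blast
    show ?thesis
    proof (rule bij_betwI)
      show "\<psi> \<in> local_leaf \<Lambda> I' V y \<rightarrow> local_leaf \<Lambda> I (\<psi> ` V) (\<psi> y)"
        unfolding bij_betw_imp_surj_on[OF bij, symmetric] using inv' by auto
      show "h \<in> local_leaf \<Lambda> I (\<psi> ` V) (\<psi> y) \<rightarrow> local_leaf \<Lambda> I' V y"
        using bij_betw_imp_surj_on[OF bij] by auto
      show "h (\<psi> x) = x" if "x \<in> local_leaf \<Lambda> I' V y" for x
        using that unfolding bij_betw_imp_surj_on[OF bij, symmetric] using inv' by auto
    qed (use inv' in auto)
  qed
  then have "foliated_germ \<Lambda> I' I \<psi>"
    unfolding foliated_germ_def using \<psi>(1) U(3) by blast
  then show thesis using \<psi>(2,3) by (rule that)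
qed

section \<open>Descent of foliated germs to the envelope\<close>

lemma descends_factor:
  assumes h: "foliated_germ \<Lambda> I I' h"
  obtains k where "hol_map_germ (toric_envelope \<Lambda> I) (toric_envelope \<Lambda> I') k"
    "\<forall>\<^sub>F z in near (transverse_model \<Lambda> I). k (envelope_map \<Lambda> I z) = envelope_map \<Lambda> I' (h z)"
proof -
  have hh: "hol_map_germ (transverse_model \<Lambda> I) (transverse_model \<Lambda> I') h"
    using h by (simp add: foliated_germ_def biholo_germ_def)
  obtain k where k: "hol_map_germ (toric_envelope \<Lambda> I) (toric_envelope \<Lambda> I') k"
    "\<forall>\<^sub>F z in near (transverse_model \<Lambda> I). k (envelope_map \<Lambda> I z) = (envelope_map \<Lambda> I' \<circ> h) z"
    by (rule transverse.envelope_universal[OF transverse.analytic_toric_envelope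
          hol_map_germ_compose[OF affine_transverse_model affine_transverse_model hh
            transverse.hol_map_envelope_map] foliated_germ_const[OF h]])
  then show thesis using that by simp
qed

lemma filterlim_envelope_map:
  "filterlim (envelope_map \<Lambda> I) (near (toric_envelope \<Lambda> I)) (near (transverse_model \<Lambda> I))"
  by (rule hol_map_germ_filterlim[OF affine_transverse_model affine_toric_envelope
        transverse.hol_map_envelope_map])

lemma filterlim_foliated:
  "foliated_germ \<Lambda> I I' h \<Longrightarrow> filterlim h (near (transverse_model \<Lambda> I')) (near (transverse_model \<Lambda> I))"
  by (rule hol_map_germ_filterlim[OF affine_transverse_model affine_transverse_model])
    (simp add: foliated_germ_def biholo_germ_def)

lemma filterlim_biholo_envelope:
  "biholo_germ (toric_envelope \<Lambda> I) (toric_envelope \<Lambda> I') k \<Longrightarrow>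
    filterlim k (near (toric_envelope \<Lambda> I')) (near (toric_envelope \<Lambda> I))"
  by (rule hol_map_germ_filterlim[OF affine_toric_envelope affine_toric_envelope])
    (simp add: biholo_germ_def)

text \<open>Both \<open>k' \<circ> k\<close> and the identity factor the envelope map through
  itself, so uniqueness in the universal property identifies them. Used in both directions, this
  makes the descent biholomorphic.\<close>

lemma descends_inverse:
  assumes \<psi>: "\<forall>\<^sub>F z in near (transverse_model \<Lambda> I). \<psi> (h z) = z"
    and h: "foliated_germ \<Lambda> I I' h"
    and k: "hol_map_germ (toric_envelope \<Lambda> I) (toric_envelope \<Lambda> I') k"
      "\<forall>\<^sub>F z in near (transverse_model \<Lambda> I). k (envelope_map \<Lambda> I z) = envelope_map \<Lambda> I' (h z)"
    and k': "hol_map_germ (toric_envelope \<Lambda> I') (toric_envelope \<Lambda> I) k'"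
      "\<forall>\<^sub>F z in near (transverse_model \<Lambda> I'). k' (envelope_map \<Lambda> I' z) = envelope_map \<Lambda> I (\<psi> z)"
  shows "\<forall>\<^sub>F y in near (toric_envelope \<Lambda> I). k' (k y) = y"
proof -
  have "\<forall>\<^sub>F y in near (toric_envelope \<Lambda> I). (k' \<circ> k) y = id y"
  proof (rule transverse.envelope_unique[OF affine_toric_envelope _ hol_map_germ_id[OF affine_toric_envelope]])
    show "hol_map_germ (toric_envelope \<Lambda> I) (toric_envelope \<Lambda> I) (k' \<circ> k)"
      by (rule hol_map_germ_compose[OF affine_toric_envelope affine_toric_envelope k(1) k'(1)])
    from k(2) \<psi> eventually_compose_filterlim[OF k'(2) filterlim_foliated[OF h]]
    show "\<forall>\<^sub>F z in near (transverse_model \<Lambda> I).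
        (k' \<circ> k) (envelope_map \<Lambda> I z) = id (envelope_map \<Lambda> I z)"
      by eventually_elim simp
  qed
  then show ?thesis by simp
qed

lemma ex_descends:
  assumes h: "foliated_germ \<Lambda> I I' h"
  obtains k where "descends \<Lambda> I I' h k"
proof -
  obtain \<psi> where \<psi>: "foliated_germ \<Lambda> I' I \<psi>" "\<forall>\<^sub>F x in near (transverse_model \<Lambda> I). \<psi> (h x) = x"
    "\<forall>\<^sub>F y in near (transverse_model \<Lambda> I'). h (\<psi> y) = y"
    by (rule foliated_germ_inverse[OF h])
  obtain k where k: "hol_map_germ (toric_envelope \<Lambda> I) (toric_envelope \<Lambda> I') k"
    "\<forall>\<^sub>F z in near (transverse_model \<Lambda> I). k (envelope_map \<Lambda> I z) = envelope_map \<Lambda> I' (h z)"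
    by (rule descends_factor[OF h])
  obtain k' where k': "hol_map_germ (toric_envelope \<Lambda> I') (toric_envelope \<Lambda> I) k'"
    "\<forall>\<^sub>F z in near (transverse_model \<Lambda> I'). k' (envelope_map \<Lambda> I' z) = envelope_map \<Lambda> I (\<psi> z)"
    by (rule descends_factor[OF \<psi>(1)])
  have "biholo_germ (toric_envelope \<Lambda> I) (toric_envelope \<Lambda> I') k"
    unfolding biholo_germ_def
    using k(1) k'(1) descends_inverse[OF \<psi>(2) h k k'] descends_inverse[OF \<psi>(3) \<psi>(1) k' k] by blast
  then have "descends \<Lambda> I I' h k"
    unfolding descends_def using k(2) by blast
  then show thesis by (rule that)
qed

lemma descends_unique:
  assumes "descends \<Lambda> I I' h k" "descends \<Lambda> I I' h k'"
  shows "\<forall>\<^sub>F y in near (toric_envelope \<Lambda> I). k' y = k y"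
proof (rule transverse.envelope_unique[OF affine_toric_envelope])
  show "hol_map_germ (toric_envelope \<Lambda> I) (toric_envelope \<Lambda> I') k'"
    "hol_map_germ (toric_envelope \<Lambda> I) (toric_envelope \<Lambda> I') k"
    using assms by (simp_all add: descends_def biholo_germ_def)
  have "\<forall>\<^sub>F z in near (transverse_model \<Lambda> I). k (envelope_map \<Lambda> I z) = envelope_map \<Lambda> I' (h z)"
    "\<forall>\<^sub>F z in near (transverse_model \<Lambda> I). k' (envelope_map \<Lambda> I z) = envelope_map \<Lambda> I' (h z)"
    using assms by (simp_all add: descends_def)
  then show "\<forall>\<^sub>F z in near (transverse_model \<Lambda> I). k' (envelope_map \<Lambda> I z) = k (envelope_map \<Lambda> I z)"
    by eventually_elim simp
qed

lemma descends_cong: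
  assumes "descends \<Lambda> I I' h k" "\<forall>\<^sub>F z in near (transverse_model \<Lambda> I). h' z = h z"
    "\<forall>\<^sub>F y in near (toric_envelope \<Lambda> I). k' y = k y"
  shows "descends \<Lambda> I I' h' k'"
  unfolding descends_def
proof
  show "biholo_germ (toric_envelope \<Lambda> I) (toric_envelope \<Lambda> I') k'"
    using assms(1) by (intro biholo_germ_cong[OF affine_toric_envelope affine_toric_envelope _ assms(3)])
      (simp add: descends_def)
  have "\<forall>\<^sub>F z in near (transverse_model \<Lambda> I). k (envelope_map \<Lambda> I z) = envelope_map \<Lambda> I' (h z)"
    using assms(1) by (simp add: descends_def)
  with assms(2) eventually_compose_filterlim[OF assms(3) filterlim_envelope_map]
  show "\<forall>\<^sub>F z in near (transverse_model \<Lambda> I). k' (envelope_map \<Lambda> I z) = envelope_map \<Lambda> I' (h' z)"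
    by eventually_elim simp
qed

lemma descends_compose:
  assumes h: "foliated_germ \<Lambda> I I' h" and k: "descends \<Lambda> I I' h k" and k': "descends \<Lambda> I' I'' h' k'"
  shows "descends \<Lambda> I I'' (h' \<circ> h) (k' \<circ> k)"
  unfolding descends_def
proof
  show "biholo_germ (toric_envelope \<Lambda> I) (toric_envelope \<Lambda> I'') (k' \<circ> k)"
    using k k' unfolding descends_def
    by (blast intro: biholo_germ_compose[OF affine_toric_envelope affine_toric_envelope affine_toric_envelope])
  have 1: "\<forall>\<^sub>F z in near (transverse_model \<Lambda> I). k (envelope_map \<Lambda> I z) = envelope_map \<Lambda> I' (h z)"
    and 2: "\<forall>\<^sub>F z in near (transverse_model \<Lambda> I'). k' (envelope_map \<Lambda> I' z) = envelope_map \<Lambda> I'' (h' z)"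
    using k k' by (simp_all add: descends_def)
  from 1 eventually_compose_filterlim[OF 2 filterlim_foliated[OF h]]
  show "\<forall>\<^sub>F z in near (transverse_model \<Lambda> I).
      (k' \<circ> k) (envelope_map \<Lambda> I z) = envelope_map \<Lambda> I'' ((h' \<circ> h) z)"
    by eventually_elim simp
qed

section \<open>Groups of germs and the kernel of the action\<close>

lemma germ_eq_iff: "germ X f = germ X g \<longleftrightarrow> (\<forall>\<^sub>F x in near X. f x = g x)"
proof
  have "f \<in> germ X f" by (simp add: germ_def)
  also assume "germ X f = germ X g"
  finally show "\<forall>\<^sub>F x in near X. f x = g x" by (simp add: germ_def)
next
  assume eq: "\<forall>\<^sub>F x in near X. f x = g x"
  show "germ X f = germ X g"
    unfolding germ_def
  proof (intro Collect_cong iffI)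
    fix k
    show "\<forall>\<^sub>F x in near X. k x = g x" if "\<forall>\<^sub>F x in near X. k x = f x"
      using that eq by eventually_elim simp
    show "\<forall>\<^sub>F x in near X. k x = f x" if "\<forall>\<^sub>F x in near X. k x = g x"
      using that eq by eventually_elim simp
  qed
qed

text \<open>The product in \<open>germ_group\<close> ranges over all representatives. Since
  \<open>k\<close> tends to the base point, changing \<open>h\<close> away from that point does not
  affect the germ of \<open>h \<circ> k\<close>.\<close>

lemma germ_group_mult:
  assumes "filterlim k (near X) (near X)"
  shows "germ X h \<otimes>\<^bsub>germ_group X H\<^esub> germ X k = germ X (h \<circ> k)"
proof (intro equalityI subsetI)
  fix f assume "f \<in> germ X h \<otimes>\<^bsub>germ_group X H\<^esub> germ X k"
  then obtain h' k' where *: "\<forall>\<^sub>F x in near X. h' x = h x" "\<forall>\<^sub>F x in near X. k' x = k x"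
    "\<forall>\<^sub>F x in near X. f x = h' (k' x)"
    by (auto simp: germ_group_def germ_def)
  from *(2,3) eventually_compose_filterlim[OF *(1) assms]
  have "\<forall>\<^sub>F x in near X. f x = (h \<circ> k) x"
    by eventually_elim simp
  then show "f \<in> germ X (h \<circ> k)" by (simp add: germ_def)
next
  fix f assume "f \<in> germ X (h \<circ> k)"
  then have "\<forall>\<^sub>F x in near X. f x = h (k x)" by (simp add: germ_def)
  moreover have "h \<in> germ X h" "k \<in> germ X k" by (simp_all add: germ_def)
  ultimately show "f \<in> germ X h \<otimes>\<^bsub>germ_group X H\<^esub> germ X k"
    unfolding germ_group_def monoid.simps by blast
qed

lemma carrier_germ_group [simp]: "carrier (germ_group X H) = germ X ` H"
  by (simp add: germ_group_def)

lemma one_germ_group [simp]: "\<one>\<^bsub>germ_group X H\<^esub> = germ X id"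
  by (simp add: germ_group_def)

lemma group_germ_group:
  assumes lim: "\<And>h. h \<in> H \<Longrightarrow> filterlim h (near X) (near X)" and id: "id \<in> H"
    and comp: "\<And>h k. h \<in> H \<Longrightarrow> k \<in> H \<Longrightarrow> h \<circ> k \<in> H"
    and inv: "\<And>h. h \<in> H \<Longrightarrow> \<exists>k\<in>H. \<forall>\<^sub>F x in near X. k (h x) = x"
  shows "group (germ_group X H)"
proof (rule groupI)
  note mult = germ_group_mult[OF lim]
  show "x \<otimes>\<^bsub>germ_group X H\<^esub> y \<in> carrier (germ_group X H)"
    if "x \<in> carrier (germ_group X H)" "y \<in> carrier (germ_group X H)" for x y
    using that comp by (auto simp: mult)
  show "x \<otimes>\<^bsub>germ_group X H\<^esub> y \<otimes>\<^bsub>germ_group X H\<^esub> z =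
      x \<otimes>\<^bsub>germ_group X H\<^esub> (y \<otimes>\<^bsub>germ_group X H\<^esub> z)"
    if "x \<in> carrier (germ_group X H)" "y \<in> carrier (germ_group X H)" "z \<in> carrier (germ_group X H)"
    for x y z
    using that comp by (auto simp: mult o_assoc)
  show "\<one>\<^bsub>germ_group X H\<^esub> \<otimes>\<^bsub>germ_group X H\<^esub> x = x" if "x \<in> carrier (germ_group X H)" for x
    using that by (auto simp: mult)
  show "\<exists>y\<in>carrier (germ_group X H). y \<otimes>\<^bsub>germ_group X H\<^esub> x = \<one>\<^bsub>germ_group X H\<^esub>"
    if x: "x \<in> carrier (germ_group X H)" for x
  proof -
    obtain h where h: "h \<in> H" "x = germ X h" using x by auto
    obtain k where k: "k \<in> H" "\<forall>\<^sub>F x in near X. k (h x) = x" using inv[OF h(1)] by blast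
    then have "germ X k \<otimes>\<^bsub>germ_group X H\<^esub> x = \<one>\<^bsub>germ_group X H\<^esub>"
      by (simp add: h(2) mult[OF h(1)] germ_eq_iff)
    then show ?thesis using k(1) by auto
  qed
qed (use id in auto)

lemma group_isotropy_group: "group (isotropy_group \<Lambda> I)"
  unfolding isotropy_group_def
proof (rule group_germ_group)
  fix h assume "h \<in> {h. foliated_germ \<Lambda> I I h}"
  then have h: "foliated_germ \<Lambda> I I h" by simp
  then show "filterlim h (near (transverse_model \<Lambda> I)) (near (transverse_model \<Lambda> I))"
    by (rule filterlim_foliated)
  obtain \<psi> where "foliated_germ \<Lambda> I I \<psi>" "\<forall>\<^sub>F x in near (transverse_model \<Lambda> I). \<psi> (h x) = x"
    by (rule foliated_germ_inverse[OF h])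
  then show "\<exists>k\<in>{h. foliated_germ \<Lambda> I I h}. \<forall>\<^sub>F x in near (transverse_model \<Lambda> I). k (h x) = x"
    by blast
qed (use foliated_germ_id foliated_germ_compose in auto)

lemma group_envelope_aut: "group (envelope_aut \<Lambda> I)"
  unfolding envelope_aut_def
proof (rule group_germ_group)
  fix k assume "k \<in> {k. biholo_germ (toric_envelope \<Lambda> I) (toric_envelope \<Lambda> I) k}"
  then have k: "biholo_germ (toric_envelope \<Lambda> I) (toric_envelope \<Lambda> I) k" by simp
  then show "filterlim k (near (toric_envelope \<Lambda> I)) (near (toric_envelope \<Lambda> I))"
    by (rule filterlim_biholo_envelope)
  show "\<exists>k'\<in>{k. biholo_germ (toric_envelope \<Lambda> I) (toric_envelope \<Lambda> I) k}.
      \<forall>\<^sub>F x in near (toric_envelope \<Lambda> I). k' (k x) = x"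
    using k unfolding biholo_germ_def by blast
qed (use biholo_germ_id[OF affine_toric_envelope]
      biholo_germ_compose[OF affine_toric_envelope affine_toric_envelope affine_toric_envelope] in auto)

text \<open>\<open>envelope_action\<close> collects the descents of all representatives; by
  uniqueness of descents these fill exactly one germ, so the set-valued definition does give a map
  between the groups.\<close>

lemma envelope_action_germ:
  assumes "descends \<Lambda> I I h k"
  shows "envelope_action \<Lambda> I (germ (transverse_model \<Lambda> I) h) = germ (toric_envelope \<Lambda> I) k"
proof (intro equalityI subsetI)
  fix k' assume "k' \<in> envelope_action \<Lambda> I (germ (transverse_model \<Lambda> I) h)"
  then obtain h' where h': "\<forall>\<^sub>F z in near (transverse_model \<Lambda> I). h' z = h z" "descends \<Lambda> I I h' k'"
    by (auto simp: envelope_action_def germ_def)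
  have "\<forall>\<^sub>F z in near (transverse_model \<Lambda> I). h z = h' z"
    using h'(1) by eventually_elim simp
  then have "descends \<Lambda> I I h k'"
    by (rule descends_cong[OF h'(2)]) simp
  from descends_unique[OF assms this] show "k' \<in> germ (toric_envelope \<Lambda> I) k"
    by (simp add: germ_def)
next
  fix k' assume "k' \<in> germ (toric_envelope \<Lambda> I) k"
  then have "descends \<Lambda> I I h k'"
    by (intro descends_cong[OF assms]) (simp_all add: germ_def)
  then show "k' \<in> envelope_action \<Lambda> I (germ (transverse_model \<Lambda> I) h)"
    by (auto simp: envelope_action_def germ_def intro!: exI[of _ h] conjI)
qed

lemma group_hom_envelope_action: "group_hom (isotropy_group \<Lambda> I) (envelope_aut \<Lambda> I) (envelope_action \<Lambda> I)"
proof -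
  have "envelope_action \<Lambda> I \<in> hom (isotropy_group \<Lambda> I) (envelope_aut \<Lambda> I)"
  proof (rule homI)
    fix x assume "x \<in> carrier (isotropy_group \<Lambda> I)"
    then obtain h where h: "foliated_germ \<Lambda> I I h" "x = germ (transverse_model \<Lambda> I) h"
      by (auto simp: isotropy_group_def)
    obtain k where k: "descends \<Lambda> I I h k"
      by (rule ex_descends[OF h(1)])
    then have "biholo_germ (toric_envelope \<Lambda> I) (toric_envelope \<Lambda> I) k"
      by (simp add: descends_def)
    then show "envelope_action \<Lambda> I x \<in> carrier (envelope_aut \<Lambda> I)"
      by (simp add: h(2) envelope_action_germ[OF k] envelope_aut_def)
    fix y assume "y \<in> carrier (isotropy_group \<Lambda> I)"
    then obtain h' where h': "foliated_germ \<Lambda> I I h'" "y = germ (transverse_model \<Lambda> I) h'"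
      by (auto simp: isotropy_group_def)
    obtain k' where k': "descends \<Lambda> I I h' k'"
      by (rule ex_descends[OF h'(1)])
    have lim: "filterlim k' (near (toric_envelope \<Lambda> I)) (near (toric_envelope \<Lambda> I))"
      using k' by (intro filterlim_biholo_envelope) (simp add: descends_def)
    show "envelope_action \<Lambda> I (x \<otimes>\<^bsub>isotropy_group \<Lambda> I\<^esub> y) =
        envelope_action \<Lambda> I x \<otimes>\<^bsub>envelope_aut \<Lambda> I\<^esub> envelope_action \<Lambda> I y"
      unfolding isotropy_group_def envelope_aut_def h(2) h'(2)
        germ_group_mult[OF filterlim_foliated[OF h'(1)]] envelope_action_germ[OF k]
        envelope_action_germ[OF k'] germ_group_mult[OF lim]
      by (rule envelope_action_germ[OF descends_compose[OF h'(1) k' k]])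
  qed
  then show ?thesis
    by (simp add: group_hom_def group_hom_axioms_def group_isotropy_group group_envelope_aut)
qed

text \<open>Every first integral factors through the envelope, and the coordinates of the envelope
  map are first integrals themselves; acting trivially on the envelope and fixing all first
  integrals are therefore the same condition.\<close>

lemma descends_id_iff:
  assumes h: "foliated_germ \<Lambda> I I h" and k: "descends \<Lambda> I I h k"
  shows "germ (toric_envelope \<Lambda> I) k = germ (toric_envelope \<Lambda> I) id \<longleftrightarrow>
    (\<forall>f. first_integral \<Lambda> I f \<longrightarrow> (\<forall>\<^sub>F z in near (transverse_model \<Lambda> I). f (h z) = f z))"
proof -
  interpret transverse \<Lambda> I .
  let ?X = "transverse_model \<Lambda> I" and ?E = "toric_envelope \<Lambda> I"
  have kh: "\<forall>\<^sub>F z in near ?X. k (envelope_map \<Lambda> I z) = envelope_map \<Lambda> I (h z)"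
    using k by (simp add: descends_def)
  show ?thesis
  proof (intro iffI allI impI)
    fix f
    assume "germ ?E k = germ ?E id" and f: "first_integral \<Lambda> I f"
    then have k_id: "\<forall>\<^sub>F y in near ?E. k y = y"
      by (simp add: germ_eq_iff)
    obtain g where g0: "hol_at envelope_coords 0 g" "\<forall>\<^sub>F z in near source. g (mmap z) = f z"
      using f by (auto simp: first_integral_def transverse_model_def elim: first_integral_factor)
    from g0(2) eventually_mmap_eq have g: "\<forall>\<^sub>F z in near ?X. g (envelope_map \<Lambda> I z) = f z"
      unfolding source_eq by eventually_elim simp
    from kh g eventually_compose_filterlim[OF k_id filterlim_envelope_map]
      eventually_compose_filterlim[OF g filterlim_foliated[OF h]]
    show "\<forall>\<^sub>F z in near ?X. f (h z) = f z"
      by eventually_elim simp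
  next
    assume inv: "\<forall>f. first_integral \<Lambda> I f \<longrightarrow> (\<forall>\<^sub>F z in near ?X. f (h z) = f z)"
    have "\<forall>\<^sub>F z in near ?X. envelope_map \<Lambda> I (h z) b = envelope_map \<Lambda> I z b"
      if b: "b \<in> envelope_coords" for b
    proof -
      \<comment> \<open>\<open>first_integral\<close> asks for a power series at 0, so the
        coordinate of the envelope map is replaced by a holomorphic function agreeing with it near
        0.\<close>
      obtain F where F: "hol_at model_coords 0 F" "\<forall>\<^sub>F z in near source. envelope_map \<Lambda> I z b = F z"
        using hol_map_envelope_map b
        by (auto simp: hol_map_germ_def toric_envelope_def transverse_model_def source_def)
      obtain W where W: "nbhd source W" "\<And>z. z \<in> W \<Longrightarrow> envelope_map \<Lambda> I z b = F z"
        using eventually_near_obtain_nbhd[OF affine_source F(2)] by blast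
      have "F z' = F z" if "z \<in> W" "z' \<in> local_leaf \<Lambda> I W z" for z z'
      proof -
        have "z' \<in> W" using that(2) local_leaf_subset by blast
        then show ?thesis
          using W(2)[of z] W(2)[of z'] that envelope_map_local_leaf by metis
      qed
      then have "const_on_leaves \<Lambda> I F"
        unfolding const_on_leaves_def using W(1) by (auto simp: source_eq)
      then have "first_integral \<Lambda> I F"
        using F(1) by (simp add: first_integral_def transverse_model_def)
      then have "\<forall>\<^sub>F z in near ?X. F (h z) = F z"
        using inv by blast
      with F(2) eventually_compose_filterlim[OF F(2)[unfolded source_eq] filterlim_foliated[OF h]]
      show ?thesis
        unfolding source_eq by eventually_elim simp
    qed
    then have "\<forall>\<^sub>F z in near ?X. \<forall>b\<in>envelope_coords. envelope_map \<Lambda> I (h z) b = envelope_map \<Lambda> I z b"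
      by (intro eventually_ball_finite finite_B) blast
    moreover have pts: "\<forall>\<^sub>F z in near ?X. envelope_map \<Lambda> I z \<in> pts ?E"
      using hol_map_envelope_map by (simp add: hol_map_germ_def)
    moreover note eventually_compose_filterlim[OF pts filterlim_foliated[OF h]]
    ultimately have eq: "\<forall>\<^sub>F z in near ?X. envelope_map \<Lambda> I (h z) = envelope_map \<Lambda> I z"
    proof eventually_elim
      case (elim z)
      have "pts ?E \<subseteq> cspace envelope_coords"
        using affine_toric_envelope by (simp add: affine_germ_def toric_envelope_def)
      then have "envelope_map \<Lambda> I z \<in> cspace envelope_coords" "envelope_map \<Lambda> I (h z) \<in> cspace envelope_coords"
        using elim(2,3) by auto
      then have "envelope_map \<Lambda> I (h z) b = envelope_map \<Lambda> I z b" for b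
        using elim(1) unfolding cspace_def by (cases "b \<in> envelope_coords") auto
      then show ?case by (rule ext)
    qed
    \<comment> \<open>That the envelope map absorbs \<open>h\<close> means that the identity is a
      descent of \<open>h\<close>; uniqueness identifies it with \<open>k\<close>.\<close>
    have "descends \<Lambda> I I h id"
      unfolding descends_def
    proof
      show "biholo_germ ?E ?E id" by (rule biholo_germ_id[OF affine_toric_envelope])
      from eq show "\<forall>\<^sub>F z in near ?X. id (envelope_map \<Lambda> I z) = envelope_map \<Lambda> I (h z)"
        by eventually_elim simp
    qed
    from descends_unique[OF this k] show "germ ?E k = germ ?E id"
      by (simp add: germ_eq_iff)
  qed
qed

lemma kernel_envelope_action:
  "kernel (isotropy_group \<Lambda> I) (envelope_aut \<Lambda> I) (envelope_action \<Lambda> I) =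
    germ (transverse_model \<Lambda> I) ` {h. foliated_germ \<Lambda> I I h \<and>
      (\<forall>f. first_integral \<Lambda> I f \<longrightarrow> (\<forall>\<^sub>F z in near (transverse_model \<Lambda> I). f (h z) = f z))}"
proof -
  have "envelope_action \<Lambda> I (germ (transverse_model \<Lambda> I) h) = germ (toric_envelope \<Lambda> I) id \<longleftrightarrow>
      (\<forall>f. first_integral \<Lambda> I f \<longrightarrow> (\<forall>\<^sub>F z in near (transverse_model \<Lambda> I). f (h z) = f z))"
    if h: "foliated_germ \<Lambda> I I h" for h
  proof -
    obtain k where k: "descends \<Lambda> I I h k"
      by (rule ex_descends[OF h])
    show ?thesis
      unfolding envelope_action_germ[OF k] by (rule descends_id_iff[OF h k])
  qed
  then show ?thesis
    by (auto simp: kernel_def isotropy_group_def envelope_aut_def)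
qed

theorem theoremA:
  fixes \<Lambda> :: "'n::finite \<Rightarrow> complex^'k" and I :: "'n set"
  assumes "vec.span (range \<Lambda>) = UNIV"
    and "singular_support \<Lambda> I"
  shows
    "((\<exists>U\<^sub>0. nbhd (transverse_model \<Lambda> I) U\<^sub>0 \<and>
         (\<forall>U. nbhd (transverse_model \<Lambda> I) U \<and> U \<subseteq> U\<^sub>0 \<longrightarrow> \<not> t1_space (local_leaf_space \<Lambda> I U))) \<and>
      \<not> (\<exists>(Y :: nat germ_space) F U.
           analytic_germ Y \<and> hol_map_germ (transverse_model \<Lambda> I) Y F \<and>
           nbhd (transverse_model \<Lambda> I) U \<and>
           (\<forall>z\<in>U. {z'\<in>U. F z' = F z} = local_leaf \<Lambda> I U z))) \<and>
     (analytic_envelope \<Lambda> I (toric_envelope \<Lambda> I) (envelope_map \<Lambda> I) \<and>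
      normal_variety (coords (toric_envelope \<Lambda> I)) (pts (toric_envelope \<Lambda> I)) \<and>
      affine_toric_variety (coords (toric_envelope \<Lambda> I)) (pts (toric_envelope \<Lambda> I))) \<and>
     ((\<forall>I' h. singular_support \<Lambda> I' \<and> foliated_germ \<Lambda> I I' h \<longrightarrow>
         (\<exists>k. descends \<Lambda> I I' h k \<and>
            (\<forall>k'. descends \<Lambda> I I' h k' \<longrightarrow> (\<forall>\<^sub>F y in near (toric_envelope \<Lambda> I). k' y = k y)))) \<and>
      group_hom (isotropy_group \<Lambda> I) (envelope_aut \<Lambda> I) (envelope_action \<Lambda> I) \<and>
      kernel (isotropy_group \<Lambda> I) (envelope_aut \<Lambda> I) (envelope_action \<Lambda> I) =
        germ (transverse_model \<Lambda> I) ` {h. foliated_germ \<Lambda> I I h \<and>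
          (\<forall>f. first_integral \<Lambda> I f \<longrightarrow> (\<forall>\<^sub>F z in near (transverse_model \<Lambda> I). f (h z) = f z))})"
proof (intro conjI)
  interpret transverse \<Lambda> I .
  obtain v j where v: "v \<in> isotropy_alg \<Lambda> I" "j \<notin> I" "pairing (\<Lambda> j) v \<noteq> 0"
    by (rule singular_direction[OF assms])
  \<comment> \<open>Separation fails in every neighbourhood of 0, so the whole model serves as
    \<open>U\<^sub>0\<close>.\<close>
  show "\<exists>U\<^sub>0. nbhd (transverse_model \<Lambda> I) U\<^sub>0 \<and>
      (\<forall>U. nbhd (transverse_model \<Lambda> I) U \<and> U \<subseteq> U\<^sub>0 \<longrightarrow> \<not> t1_space (local_leaf_space \<Lambda> I U))"
    using nbhd_pts[OF affine_transverse_model] not_t1_local_leaf_space[OF v] by blast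
  show "\<not> (\<exists>(Y :: nat germ_space) F U. analytic_germ Y \<and> hol_map_germ (transverse_model \<Lambda> I) Y F \<and>
      nbhd (transverse_model \<Lambda> I) U \<and> (\<forall>z\<in>U. {z'\<in>U. F z' = F z} = local_leaf \<Lambda> I U z))"
    using no_analytic_quotient[OF v] by blast
  show "analytic_envelope \<Lambda> I (toric_envelope \<Lambda> I) (envelope_map \<Lambda> I)"
    by (rule analytic_envelope_toric)
  have "coords (toric_envelope \<Lambda> I) = envelope_coords"
    by (simp add: toric_envelope_def)
  then show "normal_variety (coords (toric_envelope \<Lambda> I)) (pts (toric_envelope \<Lambda> I))"
    "affine_toric_variety (coords (toric_envelope \<Lambda> I)) (pts (toric_envelope \<Lambda> I))"
    using toric_envelope_normal toric_envelope_toric by simp_all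
  show "\<forall>I' h. singular_support \<Lambda> I' \<and> foliated_germ \<Lambda> I I' h \<longrightarrow>
      (\<exists>k. descends \<Lambda> I I' h k \<and>
        (\<forall>k'. descends \<Lambda> I I' h k' \<longrightarrow> (\<forall>\<^sub>F y in near (toric_envelope \<Lambda> I). k' y = k y)))"
  proof (intro allI impI)
    fix I' h assume "singular_support \<Lambda> I' \<and> foliated_germ \<Lambda> I I' h"
    then obtain k where k: "descends \<Lambda> I I' h k"
      using ex_descends by blast
    then show "\<exists>k. descends \<Lambda> I I' h k \<and>
        (\<forall>k'. descends \<Lambda> I I' h k' \<longrightarrow> (\<forall>\<^sub>F y in near (toric_envelope \<Lambda> I). k' y = k y))"
      using descends_unique[OF k] by blast
  qed
qed (rule group_hom_envelope_action kernel_envelope_action)+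

end
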